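(* Let $\mathcal{W}$ be the Diederich--Fornæss worm domain associated with $\mu>0$ and $\eta$. Then the automorphism group of $\mathcal{W}$ (the group of biholomorphic maps $\mathcal{W}\to\mathcal{W}$ under composition) consists only of the maps of the form $$(z,w)\mapsto (e^{i\theta}z,\,w),\qquad \theta\in\mathbb{R},$$ i.e. rotations in the $z$-variable.
   Context: Fix $\mu>0$ and a smooth function $\eta:\mathbb{R}\to\mathbb{R}$ such that: (i) $\eta\ge 0$, $\eta$ is even and convex; (ii) $\eta^{-1}(0)=[-\mu,\mu]$; (iii) there exists $a>0$ such that $\eta(x)>1$ if $|x|>a$; (iv) $\eta'(x)\neq 0$ whenever $\eta(x)=1$. The Diederich--Fornæss worm domain is $$\mathcal{W}=\mathcal{W}_\mu=\left\{(z,w)\in\mathbb{C}^2:\ z\neq 0,\ \left|w-e^{i\log|z|^2}\right|^2<1-\eta\left(\log|z|^2\right)\right\}.$$ *)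

theory Defs
  imports "HOL-Analysis.Analysis" "HOL-Algebra.Bij"
begin

definition cscale2 :: "complex \<Rightarrow> complex \<times> complex \<Rightarrow> complex \<times> complex" where
  "cscale2 c p = (c * fst p, c * snd p)"

text \<open>Holomorphic maps in two variables: the (real) Frechet derivative exists at every point
  and is complex-linear. As for \<^const>\<open>has_derivative\<close> in general, the derivative within \<open>S\<close> is
  uniquely determined when \<open>S\<close> is open, which is the only case of interest here.\<close>

definition holomorphic2_on ::
    "(complex \<times> complex \<Rightarrow> complex \<times> complex) \<Rightarrow> (complex \<times> complex) set \<Rightarrow> bool"
    (infixl "holomorphic2'_on" 50) where
  "f holomorphic2_on S \<longleftrightarrow>
     (\<forall>p\<in>S. \<exists>D. (f has_derivative D) (at p within S) \<and> (\<forall>c v. D (cscale2 c v) = cscale2 c (D v)))"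

definition biholomorphic_self_map ::
    "(complex \<times> complex) set \<Rightarrow> (complex \<times> complex \<Rightarrow> complex \<times> complex) \<Rightarrow> bool" where
  "biholomorphic_self_map S f \<longleftrightarrow>
     bij_betw f S S \<and> f holomorphic2_on S \<and> inv_into S f holomorphic2_on S"

text \<open>Maps \<open>S \<rightarrow> S\<close> are represented by their extensional representatives
  (value \<^const>\<open>undefined\<close> off \<open>S\<close>), as in \<^const>\<open>BijGroup\<close>, from which the group
  operation (composition on \<open>S\<close>) and the unit are inherited.\<close>

definition aut_group ::
    "(complex \<times> complex) set \<Rightarrow> (complex \<times> complex \<Rightarrow> complex \<times> complex) monoid" where
  "aut_group S = BijGroup S \<lparr>carrier := {f \<in> extensional S. biholomorphic_self_map S f}\<rparr>"

definition smooth_real :: "(real \<Rightarrow> real) \<Rightarrow> bool" where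
  "smooth_real f \<longleftrightarrow> (\<forall>n. (deriv ^^ n) f differentiable_on UNIV)"

definition worm_profile :: "real \<Rightarrow> (real \<Rightarrow> real) \<Rightarrow> bool" where
  "worm_profile \<mu> \<eta> \<longleftrightarrow>
     smooth_real \<eta> \<and>
     (\<forall>x. \<eta> x \<ge> 0) \<and> (\<forall>x. \<eta> (- x) = \<eta> x) \<and> convex_on UNIV \<eta> \<and>
     \<eta> -` {0} = {-\<mu>..\<mu>} \<and>
     (\<exists>a>0. \<forall>x. \<bar>x\<bar> > a \<longrightarrow> \<eta> x > 1) \<and>
     (\<forall>x. \<eta> x = 1 \<longrightarrow> deriv \<eta> x \<noteq> 0)"

text \<open>The parameter \<open>\<mu>\<close> enters the domain only through \<open>\<eta>\<close>.\<close>

definition worm_domain :: "(real \<Rightarrow> real) \<Rightarrow> (complex \<times> complex) set" where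
  "worm_domain \<eta> = {(z, w). z \<noteq> 0 \<and>
     (cmod (w - exp (\<i> * complex_of_real (ln ((cmod z)\<^sup>2)))))\<^sup>2 < 1 - \<eta> (ln ((cmod z)\<^sup>2))}"

lemma holomorphic2_on_cong:
  assumes "\<And>p. p \<in> S \<Longrightarrow> f p = g p"
  shows "f holomorphic2_on S \<longleftrightarrow> g holomorphic2_on S"
proof -
  have "(f has_derivative D) (at p within S) \<longleftrightarrow> (g has_derivative D) (at p within S)"
    if "p \<in> S" for p D
    using assms that has_derivative_transform[of p S f g D] has_derivative_transform[of p S g f D]
    by auto
  then show ?thesis unfolding holomorphic2_on_def by simp
qed

lemma holomorphic2_on_id: "(\<lambda>p. p) holomorphic2_on S"
  unfolding holomorphic2_on_def by (intro ballI exI[of _ "\<lambda>p. p"]) auto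

lemma holomorphic2_on_compose:
  assumes "f holomorphic2_on S" "g holomorphic2_on S" "f ` S \<subseteq> S"
  shows "(\<lambda>p. g (f p)) holomorphic2_on S"
  unfolding holomorphic2_on_def
proof
  fix p assume p: "p \<in> S"
  obtain D where D: "(f has_derivative D) (at p within S)" "\<forall>c v. D (cscale2 c v) = cscale2 c (D v)"
    using assms(1) p unfolding holomorphic2_on_def by blast
  have "f p \<in> S" using p assms(3) by blast
  then obtain E where E: "(g has_derivative E) (at (f p) within S)"
      "\<forall>c v. E (cscale2 c v) = cscale2 c (E v)"
    using assms(2) unfolding holomorphic2_on_def by blast
  have "(g has_derivative E) (at (f p) within f ` S)"
    using E(1) assms(3) by (rule has_derivative_subset)
  with D(1) have "((\<lambda>p. g (f p)) has_derivative (\<lambda>v. E (D v))) (at p within S)"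
    by (rule has_derivative_in_compose)
  then show "\<exists>D. ((\<lambda>p. g (f p)) has_derivative D) (at p within S) \<and>
      (\<forall>c v. D (cscale2 c v) = cscale2 c (D v))"
    using D(2) E(2) by (intro exI[of _ "\<lambda>v. E (D v)"]) (simp del: split_paired_All)
qed

lemma aut_group_subgroup: "subgroup {f \<in> extensional S. biholomorphic_self_map S f} (BijGroup S)"
  (is "subgroup ?A _")
proof -
  interpret G: group "BijGroup S" by (rule group_BijGroup)
  have sub: "?A \<subseteq> Bij S" by (auto simp: Bij_def biholomorphic_self_map_def)
  show ?thesis
  proof (rule G.subgroupI)
    show "?A \<subseteq> carrier (BijGroup S)" using sub by (simp add: BijGroup_def)
    have "inv_into S (\<lambda>x\<in>S. x) p = p" if "p \<in> S" for p
      using that by (intro inv_into_f_eq) (auto simp: inj_on_def)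
    then have "restrict (\<lambda>x. x) S \<in> ?A"
      using holomorphic2_on_id[of S]
      by (auto simp: biholomorphic_self_map_def bij_betw_def inj_on_def
          cong: holomorphic2_on_cong)
    then show "?A \<noteq> {}" by blast
  next
    fix f assume f: "f \<in> ?A"
    then have b: "bij_betw f S S" and B: "f \<in> Bij S"
      using sub by (auto simp: biholomorphic_self_map_def)
    have bi: "bij_betw (inv_into S f) S S" using b by (rule bij_betw_inv_into)
    have "inv_into S (restrict (inv_into S f) S) p = f p" if "p \<in> S" for p
    proof (rule inv_into_f_eq)
      show "inj_on (restrict (inv_into S f) S) S" using bi by (simp add: bij_betw_def)
      show "f p \<in> S" using b that by (auto simp: bij_betw_def)
      then show "restrict (inv_into S f) S (f p) = p"
        using b that by (simp add: bij_betw_def)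
    qed
    moreover have "bij_betw (restrict (inv_into S f) S) S S"
      using bi by (simp add: bij_betw_def)
    ultimately show "inv\<^bsub>BijGroup S\<^esub> f \<in> ?A"
      using f by (simp add: inv_BijGroup[OF B] biholomorphic_self_map_def
          cong: holomorphic2_on_cong)
  next
    fix g f assume g: "g \<in> ?A" and f: "f \<in> ?A"
    then have bg: "bij_betw g S S" and bf: "bij_betw f S S"
      by (auto simp: biholomorphic_self_map_def)
    have fS: "f p \<in> S" "inv_into S g p \<in> S" "inv_into S f p \<in> S" if "p \<in> S" for p
      using bf bg that bij_betw_inv_into[OF bf] bij_betw_inv_into[OF bg]
      by (auto simp: bij_betw_def)
    have bc: "bij_betw (compose S g f) S S" using bf bg by (rule bij_betw_compose)
    have "inv_into S (compose S g f) p = inv_into S f (inv_into S g p)" if "p \<in> S" for p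
    proof (rule inv_into_f_eq)
      show "inj_on (compose S g f) S" using bc by (simp add: bij_betw_def)
      show "inv_into S f (inv_into S g p) \<in> S" using fS that by blast
      then show "compose S g f (inv_into S f (inv_into S g p)) = p"
        using bf bg that fS by (simp add: compose_def bij_betw_inv_into_right)
    qed
    moreover have "(\<lambda>p. g (f p)) holomorphic2_on S"
      using f g fS holomorphic2_on_compose[of f S g]
      by (auto simp: biholomorphic_self_map_def image_subset_iff)
    moreover have "(\<lambda>p. inv_into S f (inv_into S g p)) holomorphic2_on S"
      using f g fS holomorphic2_on_compose[of "inv_into S g" S "inv_into S f"]
      by (auto simp: biholomorphic_self_map_def image_subset_iff)
    ultimately have "compose S g f \<in> ?A"
      using bc by (simp add: biholomorphic_self_map_def compose_def cong: holomorphic2_on_cong)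
    then show "g \<otimes>\<^bsub>BijGroup S\<^esub> f \<in> ?A"
      using f g sub by (auto simp: BijGroup_def)
  qed
qed

lemma group_aut_group: "group (aut_group S)"
  unfolding aut_group_def
  by (rule subgroup.subgroup_is_group[OF aut_group_subgroup group_BijGroup])

end

theory Submission
  imports Defs "HOL-Complex_Analysis.Complex_Analysis"
begin

text \<open>Write \<open>t = log |z|\<^sup>2\<close>. In the coordinates \<open>\<zeta> = log z\<close> and \<open>V = e\<^sup>2\<^sup>i\<^sup>\<zeta> / w\<close> the universal
covering of the worm domain is the set of all \<open>(\<zeta>, V)\<close> with
\<open>2 Re V > e + \<eta>(t) |V|\<^sup>2 / e\<close>, where \<open>e = |e\<^sup>2\<^sup>i\<^sup>\<zeta>|\<close> (lemma \<open>cover_map_in_worm_iff\<close>). For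
\<open>|t| \<le> \<mu>\<close> the slice over \<open>\<zeta>\<close> is thus a half-plane, and the flat annulus \<open>w = 0\<close> of the
boundary is at \<open>V = \<infinity>\<close>. Rotations of \<open>z\<close> lift to the one-parameter group \<open>Rot\<close>, whose
element \<open>Rot (2 \<pi>)\<close> generates the deck transformations. An automorphism lifts to a
biholomorphic map \<open>L = (X, Y)\<close> of the covering that conjugates this generator to its \<open>n\<close>-th
power with \<open>n = 1\<close> or \<open>n = - 1\<close>.

The flat annulus is recognised as follows. Restrict an automorphism to the annuli
\<open>w = 1/R\<close>, \<open>R \<rightarrow> \<infinity>\<close>. By properness a limit of these maps is a holomorphic curve in the
boundary, and it is not constant since it still winds around \<open>z = 0\<close>. At boundary points
with \<open>w \<noteq> 0\<close> the Levi form excludes such curves (\<open>no_analytic_curve_in_worm_boundary\<close>), so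
the limit lies in \<open>w = 0\<close>. The winding number, combined with Harnack's inequality, also keeps
the images away from the edges \<open>|t| = \<mu>\<close> and from the sides of the half-planes
(\<open>nontangential_sequence\<close>).

Hence \<open>L\<close> has an angular derivative \<open>\<lambda> \<ge> 0\<close> in \<open>V\<close> at infinity (\<open>Julia_Wolff\<close>). The
Julia inequality for \<open>2 Y - c e\<^sup>2\<^sup>i\<^sup>X\<close> with all \<open>|c| = 1\<close> says that the height
\<open>Re V - e/2\<close>, which vanishes on the boundary of the half-planes, is multiplied by at least
\<open>\<lambda>\<close>. For \<open>n = 1\<close> the product of the angular derivatives of \<open>L\<close> and of its inverse is at
least \<open>1\<close>, so on an open set both inequalities are equalities. This is a functional equation
of the form \<open>|P|\<^sup>2 - |Q|\<^sup>2 = Re G\<close> with holomorphic \<open>P\<close>, \<open>Q\<close>, \<open>G\<close>; taking Laplacians and using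
the identity theorem and equivariance under the deck group, it forces \<open>L\<close> to be a lifted
rotation (\<open>degree_one_imp_Rot\<close>).

If \<open>n = - 1\<close>, then the square of \<open>L\<close>, the conjugate of a rotation by \<open>L\<close>, and the commutator of \<open>L\<close>
with the antiholomorphic symmetry \<open>(z, w) \<mapsto> (1 / cnj z, cnj w)\<close> have degree one and so are rotations.
This makes \<open>L\<close> act on the real points \<open>|z| = 1\<close>, \<open>0 < w < 2\<close> through a continuous involution
of an interval that fixes an end, so \<open>L\<close> preserves \<open>w\<close> (\<open>wcoord_L\<close>). It then reflects the
interval of \<open>t\<close>-values of every fibre. For \<open>w\<close> near \<open>2\<close> that interval is centred at \<open>arg w\<close>,
which determines \<open>L\<close> everywhere, and the map so obtained does not preserve the domain as
\<open>w \<rightarrow> 0\<close> (\<open>degree_not_minus_one\<close>).\<close>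

section \<open>Harnack inequalities and the Julia--Wolff lemma\<close>

text \<open>This is Schwarz's lemma for the Cayley transform of \<open>\<phi>\<close>. Subtracting only the imaginary part of
\<open>\<phi> 0\<close> gives one estimate that bounds the growth of the real part and the variation of the
imaginary part at the same time.\<close>
lemma Re_pos_disc_growth:
  assumes hol: "\<phi> holomorphic_on ball 0 1" and pos: "\<And>z. z \<in> ball 0 1 \<Longrightarrow> Re (\<phi> z) > 0"
    and z: "cmod z < 1"
  shows "cmod (\<phi> z - \<i> * Im (\<phi> 0)) \<le> Re (\<phi> 0) * ((1 + cmod z) / (1 - cmod z))"
proof -
  define a b where "a = Re (\<phi> 0)" and "b = Im (\<phi> 0)"
  have a: "a > 0" using pos[of 0] by (simp add: a_def)
  define \<omega> where "\<omega> = (\<lambda>z. (\<phi> z - \<i> * b - a) / (\<phi> z - \<i> * b + a))"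
  have den: "\<phi> x - \<i> * b + a \<noteq> 0" if "x \<in> ball 0 1" for x
    using pos[OF that] a by (auto simp: complex_eq_iff)
  have lt: "cmod (\<omega> x) < 1" if x: "cmod x < 1" for x
  proof -
    have "Re (\<phi> x) * a > 0" using pos[of x] x a by simp
    hence "(cmod (\<phi> x - \<i> * b - a))\<^sup>2 < (cmod (\<phi> x - \<i> * b + a))\<^sup>2"
      by (simp only: cmod_power2) (simp add: power2_eq_square algebra_simps)
    hence "cmod (\<phi> x - \<i> * b - a) < cmod (\<phi> x - \<i> * b + a)"
      using norm_ge_zero power_less_imp_less_base by blast
    thus ?thesis using den[of x] x by (simp add: \<omega>_def norm_divide)
  qed
  have "\<omega> holomorphic_on ball 0 1"
    unfolding \<omega>_def by (intro holomorphic_intros hol) (use den in auto)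
  moreover have "\<phi> 0 = a + \<i> * b" by (simp add: a_def b_def complex_eq)
  hence "\<omega> 0 = 0" by (simp add: \<omega>_def)
  ultimately have w: "cmod (\<omega> z) \<le> cmod z"
    using Schwarz_Lemma(1)[of \<omega> z] lt z by blast
  have w1: "1 - \<omega> z \<noteq> 0" using lt[OF z] by auto
  have "\<phi> z - \<i> * b = a * ((1 + \<omega> z) / (1 - \<omega> z))"
  proof -
    have "\<omega> z * (\<phi> z - \<i> * b + a) = \<phi> z - \<i> * b - a"
      using den[of z] z by (simp add: \<omega>_def)
    hence "(\<phi> z - \<i> * b) * (1 - \<omega> z) = a * (1 + \<omega> z)" by (simp add: algebra_simps)
    thus ?thesis using w1 by (simp add: field_simps)
  qed
  hence "cmod (\<phi> z - \<i> * b) = a * (cmod (1 + \<omega> z) / cmod (1 - \<omega> z))"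
    using a by (simp add: norm_mult norm_divide)
  also have "\<dots> \<le> a * ((1 + cmod z) / (1 - cmod z))"
  proof (intro mult_left_mono frac_le)
    show "cmod (1 + \<omega> z) \<le> 1 + cmod z"
      using norm_triangle_ineq[of 1 "\<omega> z"] w by simp
    show "1 - cmod z \<le> cmod (1 - \<omega> z)"
      using norm_triangle_ineq2[of 1 "\<omega> z"] w by simp
  qed (use a z in auto)
  finally show ?thesis by (simp add: a_def b_def)
qed

text \<open>Adding a small positive constant to a function makes its real part strictly positive; this
lemma removes the constant again.\<close>
lemma Re_nonneg_from_Re_pos_bound:
  fixes p :: complex
  assumes "\<And>e::real. e > 0 \<Longrightarrow> cmod (p + e) \<le> (q' + e) * K" "K \<ge> 0"
  shows "cmod p \<le> q' * K"
proof (rule field_le_epsilon)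
  fix d :: real assume d: "d > 0"
  define e where "e = d / (K + 1)"
  have e: "e > 0" using d assms(2) by (simp add: e_def)
  have "cmod p \<le> cmod (p + e) + e"
    using norm_triangle_ineq4[of "p + e" "of_real e"] e by simp
  also have "\<dots> \<le> q' * K + e * (K + 1)" using assms(1)[OF e] by (simp add: algebra_simps)
  also have "e * (K + 1) = d" using assms(2) by (simp add: e_def)
  finally show "cmod p \<le> q' * K + d" .
qed

lemma Re_nonneg_disc_growth:
  assumes hol: "\<phi> holomorphic_on ball a r" and pos: "\<And>z. z \<in> ball a r \<Longrightarrow> Re (\<phi> z) \<ge> 0"
    and z: "dist a z \<le> r / 2" "r > 0"
  shows "cmod (\<phi> z - \<i> * Im (\<phi> a)) \<le> Re (\<phi> a) * 3"
proof (rule Re_nonneg_from_Re_pos_bound)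
  fix e :: real assume e: "e > 0"
  define \<psi> where "\<psi> = (\<lambda>x::complex. \<phi> (a + r * x) + e)"
  define x where "x = (z - a) / r"
  have cx: "cmod x \<le> 1/2" using z by (simp add: x_def norm_divide dist_norm norm_minus_commute)
  have in_ball: "a + r * y \<in> ball a r" if "cmod y < 1" for y :: complex
    using that z by (simp add: dist_norm norm_mult)
  have "cmod (\<psi> x - \<i> * Im (\<psi> 0)) \<le> Re (\<psi> 0) * ((1 + cmod x) / (1 - cmod x))"
  proof (rule Re_pos_disc_growth)
    have "(\<lambda>x::complex. \<phi> (a + r * x)) holomorphic_on ball 0 1"
      by (rule holomorphic_on_compose_gen[OF _ hol, unfolded o_def])
         (use in_ball in \<open>auto intro!: holomorphic_intros\<close>)
    thus "\<psi> holomorphic_on ball 0 1" unfolding \<psi>_def by (intro holomorphic_intros)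
    show "Re (\<psi> y) > 0" if "y \<in> ball 0 1" for y
      using pos[OF in_ball[of y]] that e by (simp add: \<psi>_def)
  qed (use cx in simp)
  also have "\<dots> \<le> Re (\<psi> 0) * 3"
  proof (rule mult_left_mono)
    show "(1 + cmod x) / (1 - cmod x) \<le> 3" using cx by (simp add: divide_simps)
    show "0 \<le> Re (\<psi> 0)" using pos[OF in_ball[of 0]] e by (simp add: \<psi>_def)
  qed
  also have "\<psi> x = \<phi> z + e" using z by (simp add: \<psi>_def x_def)
  finally show "cmod (\<phi> z - \<i> * Im (\<phi> a) + e) \<le> (Re (\<phi> a) + e) * 3"
    by (simp add: \<psi>_def algebra_simps)
qed simp

text \<open>The half-plane is mapped to the disc with \<open>U\<close> at the centre. If \<open>V\<close> goes to a point of modulus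
\<open>\<rho>\<close>, then \<open>(1 + \<rho>) / (1 - \<rho>) \<le> 4 / (1 - \<rho>\<^sup>2)\<close>, and the right-hand side is explicit and symmetric
in \<open>U\<close> and \<open>V\<close>. Exchanging the two points therefore gives the lower Harnack bound.\<close>
lemma Re_nonneg_halfplane_growth:
  assumes hol: "\<phi> holomorphic_on {V. Re V > c}" and pos: "\<And>z. Re z > c \<Longrightarrow> Re (\<phi> z) \<ge> 0"
    and V: "Re V > c" "Re U > c"
  shows "cmod (\<phi> V - \<i> * Im (\<phi> U))
    \<le> Re (\<phi> U) * ((cmod (V + cnj U - 2 * c))\<^sup>2 / ((Re V - c) * (Re U - c)))"
proof (rule Re_nonneg_from_Re_pos_bound)
  fix e :: real assume e: "e > 0"
  define v u where "v = V - c" and "u = U - c"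
  have vu: "Re v > 0" "Re u > 0" using V by (auto simp: v_def u_def)
  define \<psi> where "\<psi> = (\<lambda>x::complex. \<phi> (c + (u + cnj u * x) / (1 - x)) + e)"
  define x where "x = (v - u) / (v + cnj u)"
  have den: "v + cnj u \<noteq> 0" using vu by (auto simp: complex_eq_iff)
  have nden: "cmod (v + cnj u) > 0" using den by simp
  have one: "(cmod (v + cnj u))\<^sup>2 - (cmod (v - u))\<^sup>2 = 4 * Re v * Re u"
    by (simp only: cmod_power2) (simp add: power2_eq_square algebra_simps)
  have x2: "1 - (cmod x)\<^sup>2 = 4 * Re v * Re u / (cmod (v + cnj u))\<^sup>2"
  proof -
    have "(cmod x)\<^sup>2 = (cmod (v - u))\<^sup>2 / (cmod (v + cnj u))\<^sup>2"
      by (simp add: x_def norm_divide power_divide)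
    hence "1 - (cmod x)\<^sup>2 = ((cmod (v + cnj u))\<^sup>2 - (cmod (v - u))\<^sup>2) / (cmod (v + cnj u))\<^sup>2"
      using nden by (simp add: diff_divide_distrib)
    thus ?thesis by (simp only: one)
  qed
  have "1 - (cmod x)\<^sup>2 > 0" unfolding x2 using vu nden by simp
  hence cx: "cmod x < 1" by (simp add: abs_square_less_1)
  have in_hp: "Re (c + (u + cnj u * y) / (1 - y)) > c" if y: "cmod y < 1" for y :: complex
  proof -
    have y1: "1 - y \<noteq> 0" using y by auto
    have "Re ((u + cnj u * y) * cnj (1 - y)) = Re u * (1 - (cmod y)\<^sup>2)"
      by (simp only: cmod_power2) (simp add: power2_eq_square algebra_simps)
    also have "\<dots> > 0" using vu y by (simp add: abs_square_less_1)
    finally have "Re ((u + cnj u * y) * cnj (1 - y)) / (cmod (1 - y))\<^sup>2 > 0"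
      using y1 by simp
    moreover have "(u + cnj u * y) / (1 - y) = ((u + cnj u * y) * cnj (1 - y)) / (cmod (1 - y))\<^sup>2"
      by (rule complex_div_cnj)
    ultimately show ?thesis by (simp only: plus_complex.simps Re_divide_of_real) simp
  qed
  have xv: "c + (u + cnj u * x) / (1 - x) = V"
  proof -
    have "1 - x = (u + cnj u) / (v + cnj u)" using den by (simp add: x_def field_simps)
    moreover have "u + cnj u * x = v * (u + cnj u) / (v + cnj u)"
      using den by (simp add: x_def field_simps)
    moreover have "u + cnj u \<noteq> 0" using vu by (auto simp: complex_eq_iff)
    ultimately have "(u + cnj u * x) / (1 - x) = v" using den by simp
    thus ?thesis by (simp add: v_def)
  qed
  have "cmod (\<psi> x - \<i> * Im (\<psi> 0)) \<le> Re (\<psi> 0) * ((1 + cmod x) / (1 - cmod x))"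
  proof (rule Re_pos_disc_growth)
    have "(\<lambda>x::complex. \<phi> (c + (u + cnj u * x) / (1 - x))) holomorphic_on ball 0 1"
      by (rule holomorphic_on_compose_gen[OF _ hol, unfolded o_def])
         (use in_hp in \<open>auto intro!: holomorphic_intros\<close>)
    thus "\<psi> holomorphic_on ball 0 1" unfolding \<psi>_def by (intro holomorphic_intros)
    show "Re (\<psi> y) > 0" if "y \<in> ball 0 1" for y
      using pos[OF in_hp[of y]] that e by (simp add: \<psi>_def)
  qed (use cx in simp)
  also have "\<dots> \<le> Re (\<psi> 0) * ((cmod (v + cnj u))\<^sup>2 / (Re v * Re u))"
  proof (rule mult_left_mono)
    have "(1 + cmod x) / (1 - cmod x) = (1 + cmod x)\<^sup>2 / (1 - (cmod x)\<^sup>2)"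
    proof -
      have "1 - (cmod x)\<^sup>2 = (1 - cmod x) * (1 + cmod x)" by (simp add: power2_eq_square algebra_simps)
      moreover have "1 + cmod x \<noteq> 0" using norm_ge_zero[of x] by linarith
      ultimately show ?thesis by (simp add: power2_eq_square)
    qed
    also have "\<dots> \<le> 2\<^sup>2 / (1 - (cmod x)\<^sup>2)"
      by (intro divide_right_mono power_mono) (use cx in \<open>auto simp: abs_square_le_1\<close>)
    also have "\<dots> = (cmod (v + cnj u))\<^sup>2 / (Re v * Re u)"
      unfolding x2 using vu nden by (simp add: field_simps)
    finally show "(1 + cmod x) / (1 - cmod x) \<le> (cmod (v + cnj u))\<^sup>2 / (Re v * Re u)" .
    show "0 \<le> Re (\<psi> 0)" using pos[OF in_hp[of 0]] e by (simp add: \<psi>_def)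
  qed
  also have "\<psi> x = \<phi> V + e" by (simp add: \<psi>_def xv)
  also have "\<psi> 0 = \<phi> U + e" by (simp add: \<psi>_def u_def)
  also have "v + cnj u = V + cnj U - 2 * c" by (simp add: v_def u_def)
  finally show "cmod (\<phi> V - \<i> * Im (\<phi> U) + e)
      \<le> (Re (\<phi> U) + e) * ((cmod (V + cnj U - 2 * c))\<^sup>2 / ((Re V - c) * (Re U - c)))"
    by (simp add: v_def u_def algebra_simps)
qed (use V in simp)

lemma open_convex_vertical_strip:
  shows "open {\<zeta>. \<bar>2 * Re \<zeta> + a\<bar> < d}" "convex {\<zeta>. \<bar>2 * Re \<zeta> + a\<bar> < d}"
proof -
  have "{\<zeta>. \<bar>2 * Re \<zeta> + a\<bar> < d} = {\<zeta>. Re \<zeta> < (d - a) / 2} \<inter> {\<zeta>. Re \<zeta> > (- d - a) / 2}"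
    by (auto simp: abs_less_iff)
  thus "open {\<zeta>. \<bar>2 * Re \<zeta> + a\<bar> < d}" "convex {\<zeta>. \<bar>2 * Re \<zeta> + a\<bar> < d}"
    by (simp_all only: open_Int convex_Int open_halfspace_Re_lt open_halfspace_Re_gt
        convex_halfspace_Re_lt convex_halfspace_Re_gt)
qed

text \<open>Applied to a function that gains a fixed imaginary period along \<open>2 \<pi> \<i>\<close>, this bounds its real
part at \<open>0\<close> from below. In this way a winding number becomes a distance from the boundary.\<close>
lemma Re_nonneg_strip_growth:
  assumes m: "m > 0"
  obtains K where "K > 0" "\<And>\<phi>. \<lbrakk>\<phi> holomorphic_on {\<zeta>. \<bar>2 * Re \<zeta>\<bar> < m};
      \<And>\<zeta>. \<bar>2 * Re \<zeta>\<bar> < m \<Longrightarrow> Re (\<phi> \<zeta>) \<ge> 0\<rbrakk>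
      \<Longrightarrow> cmod (\<phi> (2 * pi * \<i>) - \<i> * Im (\<phi> 0)) \<le> Re (\<phi> 0) * K"
proof
  define c where "c = pi / m"
  have c: "c > 0" using m by (simp add: c_def)
  define q where "q = exp (- 2 * pi * c)"
  show "(1 + q)\<^sup>2 / q > 0" unfolding q_def by (intro divide_pos_pos zero_less_power add_pos_pos) auto
  fix \<phi> assume hol: "\<phi> holomorphic_on {\<zeta>. \<bar>2 * Re \<zeta>\<bar> < m}"
    and pos: "\<And>\<zeta>. \<bar>2 * Re \<zeta>\<bar> < m \<Longrightarrow> Re (\<phi> \<zeta>) \<ge> 0"
  define \<psi> where "\<psi> = (\<lambda>V::complex. \<phi> (- \<i> * Ln V / c))"
  have in_strip: "\<bar>2 * Re (- \<i> * Ln V / c)\<bar> < m" if "Re V > 0" for V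
  proof -
    have "\<bar>Im (Ln V)\<bar> < pi / 2" using that by (subst Re_Ln_pos_lt_imp) auto
    moreover have "2 * Re (- \<i> * Ln V / c) = 2 * Im (Ln V) / c" by simp
    ultimately show ?thesis using m by (simp add: c_def abs_mult field_simps)
  qed
  have "(\<lambda>V::complex. \<phi> (- \<i> * Ln V / c)) holomorphic_on {V. Re V > 0}"
    by (rule holomorphic_on_compose_gen[OF _ hol, unfolded o_def])
       (use in_strip c in \<open>auto intro!: holomorphic_intros simp: complex_nonpos_Reals_iff\<close>)
  hence "cmod (\<psi> q - \<i> * Im (\<psi> 1))
    \<le> Re (\<psi> 1) * ((cmod (q + cnj 1 - 2 * (0::real)))\<^sup>2 / ((Re q - 0) * (Re 1 - 0)))"
    by (intro Re_nonneg_halfplane_growth) (use pos in_strip in \<open>auto simp: \<psi>_def q_def\<close>)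
  moreover have "\<psi> 1 = \<phi> 0" by (simp add: \<psi>_def)
  moreover have "\<psi> q = \<phi> (2 * pi * \<i>)"
  proof -
    have "Ln (complex_of_real q) = of_real (- 2 * pi * c)" by (simp add: q_def Ln_of_real)
    thus ?thesis using c by (simp add: \<psi>_def mult.commute)
  qed
  moreover have "cmod (q + 1) = 1 + q"
    using norm_of_real[of "q + 1", where 'a = complex] by (simp add: q_def add_pos_pos)
  ultimately show "cmod (\<phi> (2 * pi * \<i>) - \<i> * Im (\<phi> 0)) \<le> Re (\<phi> 0) * ((1 + q)\<^sup>2 / q)"
    by (simp add: add.commute)
qed

text \<open>The number \<open>lam\<close> is the infimum of \<open>Re \<phi> / (Re V - c)\<close>. After subtraction of \<open>lam (V - c)\<close> the
infimum is \<open>0\<close>, and the growth estimate centred at a point that almost attains it shows that the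
remainder is \<open>o(R)\<close>.\<close>
lemma Julia_halfplane:
  assumes hol: "\<phi> holomorphic_on {V. Re V > c}" and pos: "\<And>z. Re z > c \<Longrightarrow> Re (\<phi> z) \<ge> 0"
  obtains lam where "lam \<ge> 0" "\<And>V. Re V > c \<Longrightarrow> Re (\<phi> V) \<ge> lam * (Re V - c)"
    "((\<lambda>R. \<phi> (of_real R) / of_real R) \<longlongrightarrow> of_real lam) at_top"
proof -
  define Q where "Q = (\<lambda>V. Re (\<phi> V) / (Re V - c)) ` {V. Re V > c}"
  define lam where "lam = Inf Q"
  have ne: "Q \<noteq> {}" unfolding Q_def by (auto intro!: exI[of _ "of_real (c + 1)"])
  have Q0: "q \<ge> 0" if "q \<in> Q" for q using that pos by (auto simp: Q_def)
  have bdd: "bdd_below Q" using Q0 by (rule bdd_belowI)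
  have l0: "lam \<ge> 0" unfolding lam_def by (rule cInf_greatest[OF ne Q0])
  have julia: "Re (\<phi> V) \<ge> lam * (Re V - c)" if "Re V > c" for V
  proof -
    have "lam \<le> Re (\<phi> V) / (Re V - c)"
      unfolding lam_def by (rule cInf_lower[OF _ bdd]) (use that in \<open>auto simp: Q_def\<close>)
    thus ?thesis using that by (simp add: field_simps)
  qed
  define Z where "Z = (\<lambda>V::complex. \<phi> V - lam * (V - c))"
  have Zhol: "Z holomorphic_on {V. Re V > c}" unfolding Z_def by (intro holomorphic_intros hol)
  have Zpos: "Re (Z V) \<ge> 0" if "Re V > c" for V using julia[OF that] by (simp add: Z_def)
  have lim0: "((\<lambda>R. Z (of_real R) / of_real R) \<longlongrightarrow> 0) at_top"
  proof (rule tendstoI)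
    fix e :: real assume e: "e > 0"
    define d where "d = e / 4"
    have d: "d > 0" using e by (simp add: d_def)
    have "Inf Q < lam + d" using d by (simp add: lam_def)
    then obtain q where q: "q \<in> Q" "q < lam + d" using cInf_lessD[OF ne] by blast
    then obtain U where U: "Re U > c" "Re (\<phi> U) / (Re U - c) < lam + d" by (auto simp: Q_def)
    define x where "x = Re U - c"
    have x: "x > 0" using U by (simp add: x_def)
    have ZU: "Re (Z U) \<le> d * x"
      using U x by (simp add: Z_def x_def field_simps)
    define C where "C = cmod (cnj U - 2 * c)"
    have bound: "cmod (Z R) / R \<le> \<bar>Im (Z U)\<bar> / R + d * ((R + C)\<^sup>2 / ((R - c) * R))"
      if R: "R > c" "R > 0" for R :: real
    proof -
      have "cmod (Z R - \<i> * Im (Z U))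
          \<le> Re (Z U) * ((cmod (R + cnj U - 2 * c))\<^sup>2 / ((Re R - c) * (Re U - c)))"
        by (rule Re_nonneg_halfplane_growth[OF Zhol Zpos]) (use R U in auto)
      also have "\<dots> \<le> (d * x) * ((R + C)\<^sup>2 / ((R - c) * x))"
      proof (intro mult_mono frac_le power_mono)
        show "cmod (R + cnj U - 2 * c) \<le> R + C"
          using norm_triangle_ineq[of "of_real R" "cnj U - 2 * c"] R by (simp add: C_def add_diff_eq)
      qed (use R x d ZU in \<open>auto simp: x_def\<close>)
      also have "\<dots> = d * ((R + C)\<^sup>2 / (R - c))" using x R by (simp add: field_simps)
      finally have "cmod (Z R - \<i> * Im (Z U)) \<le> d * ((R + C)\<^sup>2 / (R - c))" .
      moreover have "cmod (Z R) \<le> cmod (Z R - \<i> * Im (Z U)) + \<bar>Im (Z U)\<bar>"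
        using norm_triangle_ineq[of "Z R - \<i> * Im (Z U)" "\<i> * Im (Z U)"] by (simp add: norm_mult)
      ultimately have "cmod (Z R) \<le> \<bar>Im (Z U)\<bar> + d * ((R + C)\<^sup>2 / (R - c))" by linarith
      hence "cmod (Z R) / R \<le> (\<bar>Im (Z U)\<bar> + d * ((R + C)\<^sup>2 / (R - c))) / R"
        using R by (intro divide_right_mono) auto
      thus ?thesis using R by (simp add: add_divide_distrib)
    qed
    have "((\<lambda>R. \<bar>Im (Z U)\<bar> / R + d * ((R + C)\<^sup>2 / ((R - c) * R))) \<longlongrightarrow> 0 + d * 1) at_top"
    proof (intro tendsto_intros)
      show "((\<lambda>R. \<bar>Im (Z U)\<bar> / R) \<longlongrightarrow> 0) at_top" by real_asymp
      show "((\<lambda>R. (R + C)\<^sup>2 / ((R - c) * R)) \<longlongrightarrow> 1) at_top" by real_asymp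
    qed
    hence "\<forall>\<^sub>F R in at_top. \<bar>Im (Z U)\<bar> / R + d * ((R + C)\<^sup>2 / ((R - c) * R)) < e"
      by (rule order_tendstoD) (use e in \<open>simp add: d_def\<close>)
    moreover have "\<forall>\<^sub>F R::real in at_top. R > c \<and> R > 0"
      by (intro eventually_conj eventually_gt_at_top)
    ultimately show "\<forall>\<^sub>F R in at_top. dist (Z (of_real R) / of_real R) 0 < e"
      by eventually_elim (use bound in \<open>force simp: norm_divide\<close>)
  qed
  have "((\<lambda>R. Z (of_real R) / of_real R + (of_real (lam * (R - c) / R) :: complex))
      \<longlongrightarrow> 0 + of_real lam) at_top"
  proof (intro tendsto_add lim0 tendsto_of_real)
    show "((\<lambda>R. lam * (R - c) / R) \<longlongrightarrow> lam) at_top" by real_asymp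
  qed
  hence "((\<lambda>R. \<phi> (of_real R) / of_real R) \<longlongrightarrow> of_real lam) at_top"
    by (simp add: Z_def add_divide_distrib[symmetric])
  thus thesis using that l0 julia by blast
qed

section \<open>Holomorphic functions of two variables\<close>

text \<open>The derivative is written out by its two complex coefficients, which makes complex linearity
part of its form and lets compositions be computed directly.\<close>
definition hol2 :: "(complex \<times> complex \<Rightarrow> complex) \<Rightarrow> (complex \<times> complex) set \<Rightarrow> bool" where
  "hol2 \<Phi> S \<longleftrightarrow> (\<forall>p\<in>S. \<exists>a b. (\<Phi> has_derivative (\<lambda>v. a * fst v + b * snd v)) (at p))"

lemma hol2_subset: "hol2 \<Phi> S \<Longrightarrow> T \<subseteq> S \<Longrightarrow> hol2 \<Phi> T"
  unfolding hol2_def by blast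

lemma hol2_continuous_on: "hol2 \<Phi> S \<Longrightarrow> continuous_on S \<Phi>"
  unfolding hol2_def
  by (intro continuous_at_imp_continuous_on ballI) (metis has_derivative_continuous)

lemma hol2_const: "hol2 (\<lambda>p. c) S"
  unfolding hol2_def by (intro ballI exI[of _ 0]) simp

lemma hol2_fst: "hol2 fst S"
  unfolding hol2_def by (intro ballI exI[of _ 1] exI[of _ 0]) (auto intro!: derivative_eq_intros)

lemma hol2_snd: "hol2 snd S"
  unfolding hol2_def by (intro ballI exI[of _ 0] exI[of _ 1]) (auto intro!: derivative_eq_intros)

lemma hol2_compose1:
  assumes "hol2 \<Phi> S" "\<And>p. p \<in> S \<Longrightarrow> h field_differentiable at (\<Phi> p)"
  shows "hol2 (\<lambda>p. h (\<Phi> p)) S"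
  unfolding hol2_def
proof
  fix p assume p: "p \<in> S"
  obtain a b where 1: "(\<Phi> has_derivative (\<lambda>v. a * fst v + b * snd v)) (at p)"
    using assms(1) p unfolding hol2_def by blast
  obtain c where "(h has_field_derivative c) (at (\<Phi> p))"
    using assms(2)[OF p] unfolding field_differentiable_def by blast
  from has_derivative_compose[OF 1, of h "(*) c"] this
  have "((\<lambda>p. h (\<Phi> p)) has_derivative (\<lambda>v. c * (a * fst v + b * snd v))) (at p)"
    unfolding has_field_derivative_def by simp
  thus "\<exists>a b. ((\<lambda>p. h (\<Phi> p)) has_derivative (\<lambda>v. a * fst v + b * snd v)) (at p)"
    by (intro exI[of _ "c * a"] exI[of _ "c * b"]) (simp add: algebra_simps)
qed

lemma hol2_compose2:
  assumes "hol2 \<Phi> T" "hol2 X S" "hol2 Y S" "\<And>p. p \<in> S \<Longrightarrow> (X p, Y p) \<in> T"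
  shows "hol2 (\<lambda>p. \<Phi> (X p, Y p)) S"
  unfolding hol2_def
proof
  fix p assume p: "p \<in> S"
  obtain a b where 1: "(X has_derivative (\<lambda>v. a * fst v + b * snd v)) (at p)"
    using assms(2) p unfolding hol2_def by blast
  obtain c d where 2: "(Y has_derivative (\<lambda>v. c * fst v + d * snd v)) (at p)"
    using assms(3) p unfolding hol2_def by blast
  obtain e f where 3: "(\<Phi> has_derivative (\<lambda>v. e * fst v + f * snd v)) (at (X p, Y p))"
    using assms(1) assms(4)[OF p] unfolding hol2_def by blast
  have "((\<lambda>p. \<Phi> (X p, Y p)) has_derivative
      (\<lambda>v. e * (a * fst v + b * snd v) + f * (c * fst v + d * snd v))) (at p)"
    using has_derivative_compose[OF has_derivative_Pair[OF 1 2] 3] by simp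
  thus "\<exists>a b. ((\<lambda>p. \<Phi> (X p, Y p)) has_derivative (\<lambda>v. a * fst v + b * snd v)) (at p)"
    by (intro exI[of _ "e * a + f * c"] exI[of _ "e * b + f * d"]) (simp add: algebra_simps)
qed

lemma hol2_add: assumes "hol2 X S" "hol2 Y S" shows "hol2 (\<lambda>p. X p + Y p) S"
proof -
  have "hol2 (\<lambda>p. fst p + snd p) UNIV"
    unfolding hol2_def by (intro ballI exI[of _ 1]) (auto intro!: derivative_eq_intros)
  from hol2_compose2[OF this assms] show ?thesis by simp
qed

lemma hol2_mult: assumes "hol2 X S" "hol2 Y S" shows "hol2 (\<lambda>p. X p * Y p) S"
proof -
  have "hol2 (\<lambda>p. fst p * snd p) UNIV"
    unfolding hol2_def
  proof
    fix p :: "complex \<times> complex"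
    show "\<exists>a b. ((\<lambda>p. fst p * snd p) has_derivative (\<lambda>v. a * fst v + b * snd v)) (at p)"
      by (intro exI[of _ "snd p"] exI[of _ "fst p"]) (auto intro!: derivative_eq_intros simp: algebra_simps)
  qed
  from hol2_compose2[OF this assms] show ?thesis by simp
qed

lemma hol2_uminus: "hol2 X S \<Longrightarrow> hol2 (\<lambda>p. - X p) S"
  by (rule hol2_compose1) (auto intro!: derivative_intros)

lemma hol2_diff: "hol2 X S \<Longrightarrow> hol2 Y S \<Longrightarrow> hol2 (\<lambda>p. X p - Y p) S"
  using hol2_add[OF _ hol2_uminus, of X S Y] by simp

lemma hol2_exp: "hol2 X S \<Longrightarrow> hol2 (\<lambda>p. exp (X p)) S"
  by (rule hol2_compose1) (auto intro: field_differentiable_within_exp)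

lemma hol2_divide:
  assumes "hol2 X S" "hol2 Y S" "\<And>p. p \<in> S \<Longrightarrow> Y p \<noteq> 0"
  shows "hol2 (\<lambda>p. X p / Y p) S"
proof -
  have "hol2 (\<lambda>p. inverse (Y p)) S"
    by (rule hol2_compose1[OF assms(2)]) (use assms(3) in \<open>auto intro!: derivative_intros\<close>)
  from hol2_mult[OF assms(1) this] show ?thesis by (simp add: divide_inverse)
qed

lemma hol2_Ln:
  assumes "hol2 X S" "\<And>p. p \<in> S \<Longrightarrow> X p \<notin> \<real>\<^sub>\<le>\<^sub>0"
  shows "hol2 (\<lambda>p. Ln (X p)) S"
  by (rule hol2_compose1[OF assms(1)]) (use assms(2) in \<open>auto intro: field_differentiable_at_Ln\<close>)

lemmas hol2_intros = hol2_const hol2_fst hol2_snd hol2_add hol2_mult hol2_uminus hol2_diff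
  hol2_exp hol2_divide

text \<open>One-variable function theory enters through this lemma: the curves used below are the two
coordinate directions and the fibres \<open>w = const\<close>.\<close>
lemma hol2_curve:
  assumes \<Phi>: "hol2 \<Phi> S" and U: "open U" and c: "c1 holomorphic_on U" "c2 holomorphic_on U"
    and S: "\<And>z. z \<in> U \<Longrightarrow> (c1 z, c2 z) \<in> S"
  shows "(\<lambda>z. \<Phi> (c1 z, c2 z)) holomorphic_on U"
  unfolding holomorphic_on_open[OF U]
proof
  fix z assume z: "z \<in> U"
  obtain d1 d2 where d: "(c1 has_field_derivative d1) (at z)" "(c2 has_field_derivative d2) (at z)"
    using c z unfolding holomorphic_on_open[OF U] by blast
  obtain a b where ab: "(\<Phi> has_derivative (\<lambda>v. a * fst v + b * snd v)) (at (c1 z, c2 z))"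
    using \<Phi> S[OF z] unfolding hol2_def by blast
  have "((\<lambda>z. \<Phi> (c1 z, c2 z)) has_derivative (\<lambda>h. a * (d1 * h) + b * (d2 * h))) (at z)"
    using has_derivative_compose[OF has_derivative_Pair[OF d[unfolded has_field_derivative_def]] ab]
    by simp
  thus "\<exists>f'. ((\<lambda>z. \<Phi> (c1 z, c2 z)) has_field_derivative f') (at z)"
    unfolding has_field_derivative_def
    by (intro exI[of _ "a * d1 + b * d2"]) (auto elim!: has_derivative_eq_rhs simp: algebra_simps)
qed

lemma hol2_slice1:
  assumes "hol2 \<Phi> S" "open U" "\<And>z. z \<in> U \<Longrightarrow> (z, w) \<in> S"
  shows "(\<lambda>z. \<Phi> (z, w)) holomorphic_on U"
  by (rule hol2_curve[OF assms(1,2)]) (use assms(3) in \<open>auto intro!: holomorphic_intros\<close>)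

lemma hol2_slice2:
  assumes "hol2 \<Phi> S" "open U" "\<And>w. w \<in> U \<Longrightarrow> (z, w) \<in> S"
  shows "(\<lambda>w. \<Phi> (z, w)) holomorphic_on U"
  by (rule hol2_curve[OF assms(1,2)]) (use assms(3) in \<open>auto intro!: holomorphic_intros\<close>)

lemma holomorphic_eq_0_on_ball:
  assumes "f holomorphic_on ball a r" "open U" "U \<noteq> {}" "U \<subseteq> ball a r"
    "\<And>z. z \<in> U \<Longrightarrow> f z = 0" "z \<in> ball a r"
  shows "f z = 0"
  using analytic_continuation_open[of U "ball a r" f "\<lambda>_. 0" z] assms by auto

lemma open_prod_ball:
  fixes S :: "(complex \<times> complex) set"
  assumes "open S" "(a, b) \<in> S"
  obtains r where "r > 0" "ball a r \<times> ball b r \<subseteq> S"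
proof -
  obtain A B where AB: "open A" "open B" "(a, b) \<in> A \<times> B" "A \<times> B \<subseteq> S"
    using assms by (rule open_prod_elim)
  then obtain r s where "r > 0" "ball a r \<subseteq> A" "s > 0" "ball b s \<subseteq> B"
    by (metis SigmaD1 SigmaD2 openE)
  thus thesis using AB by (intro that[of "min r s"]) (auto simp: subset_iff)
qed

text \<open>The interior of the zero set is relatively closed: a polydisc around a limit point meets it,
and the identity theorem in one variable spreads the zeros first along the second factor and
then along the first.\<close>
lemma hol2_identity:
  assumes \<Phi>: "hol2 \<Phi> S" and S: "open S" "connected S"
    and U: "open U" "U \<noteq> {}" "U \<subseteq> S" "\<And>p. p \<in> U \<Longrightarrow> \<Phi> p = 0" and p: "p \<in> S"
  shows "\<Phi> p = 0"
proof -
  define Z where "Z = interior {p \<in> S. \<Phi> p = 0}"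
  have ZS: "Z \<subseteq> S" unfolding Z_def using interior_subset by blast
  have UZ: "U \<subseteq> Z" unfolding Z_def by (rule interior_maximal) (use U in auto)
  have closed: "S \<inter> closure Z \<subseteq> Z"
  proof (clarify)
    fix a b assume ab: "(a, b) \<in> S" "(a, b) \<in> closure Z"
    obtain r where r: "r > 0" "ball a r \<times> ball b r \<subseteq> S" using open_prod_ball[OF S(1) ab(1)] .
    have "open (ball a r \<times> ball b r)" "(a, b) \<in> ball a r \<times> ball b r"
      using r by (auto intro: open_Times)
    with ab(2) obtain q where q: "q \<in> Z" "q \<in> ball a r \<times> ball b r"
      unfolding closure_iff_nhds_not_empty by blast
    obtain q1 q2 where q12: "q = (q1, q2)" by (cases q)
    have "open (Z \<inter> (ball a r \<times> ball b r))" by (auto simp: Z_def intro: open_Times)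
    then obtain e where e: "e > 0" "ball q1 e \<times> ball q2 e \<subseteq> Z \<inter> (ball a r \<times> ball b r)"
      using open_prod_ball q q12 by (metis IntI)
    have "ball q1 e \<times> ball q2 e \<subseteq> ball a r \<times> ball b r" using e by blast
    hence e1: "ball q1 e \<subseteq> ball a r" "ball q2 e \<subseteq> ball b r"
      unfolding times_subset_iff using e(1) by auto
    have Z0: "\<Phi> p = 0" if "p \<in> Z" for p
      using that interior_subset unfolding Z_def by blast
    have s1: "\<Phi> (x, y) = 0" if "x \<in> ball q1 e" "y \<in> ball b r" for x y
    proof (rule holomorphic_eq_0_on_ball[of "\<lambda>y. \<Phi> (x, y)" b r "ball q2 e" y])
      show "(\<lambda>y. \<Phi> (x, y)) holomorphic_on ball b r"
        by (rule hol2_slice2[OF \<Phi>]) (use that(1) e1 r(2) in blast)+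
      show "\<Phi> (x, z) = 0" if z: "z \<in> ball q2 e" for z
        using e(2) that \<open>x \<in> ball q1 e\<close> by (intro Z0) auto
    qed (use e e1 that in auto)
    have s2: "\<Phi> (x, y) = 0" if "x \<in> ball a r" "y \<in> ball b r" for x y
    proof (rule holomorphic_eq_0_on_ball[of "\<lambda>x. \<Phi> (x, y)" a r "ball q1 e" x])
      show "(\<lambda>x. \<Phi> (x, y)) holomorphic_on ball a r"
        by (rule hol2_slice1[OF \<Phi>]) (use that(2) r(2) in blast)+
    qed (use e e1 that s1 in auto)
    have "ball a r \<times> ball b r \<subseteq> Z" unfolding Z_def
      by (rule interior_maximal) (use s2 r in \<open>auto intro: open_Times\<close>)
    thus "(a, b) \<in> Z" using r by auto
  qed
  have "closedin (top_of_set S) Z"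
  proof -
    have "Z = S \<inter> closure Z" using closed ZS closure_subset by blast
    thus ?thesis by (metis closed_closure closedin_closed_Int)
  qed
  moreover have "openin (top_of_set S) Z"
    using ZS by (simp add: S(1) Z_def openin_open_eq)
  ultimately have "Z = {} \<or> Z = S" using S(2) unfolding connected_clopen by blast
  hence "Z = S" using UZ U(2) by blast
  thus ?thesis using p interior_subset unfolding Z_def by blast
qed

lemma second_derivative_test_max:
  fixes \<psi> :: "real \<Rightarrow> real"
  assumes r: "r > 0" and d1: "\<And>x. \<bar>x\<bar> < r \<Longrightarrow> (\<psi> has_real_derivative \<psi>1 x) (at x)"
    and d2: "(\<psi>1 has_real_derivative c) (at 0)" and max: "\<And>x. \<bar>x\<bar> < r \<Longrightarrow> \<psi> x \<le> \<psi> 0"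
  shows "\<psi>1 0 = 0" "c \<le> 0"
proof -
  show z: "\<psi>1 0 = 0"
    by (rule DERIV_local_max[OF d1, of 0 r]) (use r max in auto)
  show "c \<le> 0"
  proof (rule ccontr)
    assume "\<not> c \<le> 0"
    then obtain d where d: "d > 0" "\<And>h. 0 < h \<Longrightarrow> h < d \<Longrightarrow> \<psi>1 0 < \<psi>1 (0 + h)"
      using DERIV_pos_inc_right[OF d2] by auto
    \<comment> \<open>halving \<open>min d r\<close> keeps \<open>b\<close> strictly inside both neighbourhoods\<close>
    define b where "b = min d r / 2"
    have b: "0 < b" "b < d" "b < r" using d r by (auto simp: b_def)
    have "\<exists>z>0. z < b \<and> \<psi> b - \<psi> 0 = (b - 0) * \<psi>1 z"
      by (rule MVT2) (use b d1 in auto)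
    then obtain z where "0 < z" "z < b" "\<psi> b - \<psi> 0 = b * \<psi>1 z" by auto
    moreover have "\<psi>1 z > 0" using d(2)[of z] calculation b z by auto
    ultimately have "\<psi> b > \<psi> 0" using b by (smt (verit) mult_pos_pos)
    thus False using max[of b] b by auto
  qed
qed

text \<open>At a maximum the complex gradient vanishes and the Laplacian is at most \<open>0\<close>. The Laplacian is
the sum of the second derivatives along \<open>1\<close> and \<open>\<i>\<close>; the terms with a second complex
derivative cancel in it because \<open>1\<^sup>2 + \<i>\<^sup>2 = 0\<close>.\<close>
lemma hermitian_local_max:
  fixes A B C D G :: "complex \<Rightarrow> complex"
  assumes U: "open U" "z0 \<in> U" and hol: "A holomorphic_on U" "B holomorphic_on U"
      "C holomorphic_on U" "D holomorphic_on U" "G holomorphic_on U"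
    and max: "\<And>z. z \<in> U \<Longrightarrow>
      Re (A z * cnj (B z)) + Re (C z * cnj (D z)) + Re (G z)
      \<le> Re (A z0 * cnj (B z0)) + Re (C z0 * cnj (D z0)) + Re (G z0)"
  shows "deriv A z0 * cnj (B z0) + deriv B z0 * cnj (A z0)
      + deriv C z0 * cnj (D z0) + deriv D z0 * cnj (C z0) + deriv G z0 = 0"
    and "Re (deriv A z0 * cnj (deriv B z0)) + Re (deriv C z0 * cnj (deriv D z0)) \<le> 0"
proof -
  obtain r where r: "r > 0" "ball z0 r \<subseteq> U" using U by (rule openE)
  define N where "N = deriv A z0 * cnj (B z0) + deriv B z0 * cnj (A z0)
      + deriv C z0 * cnj (D z0) + deriv D z0 * cnj (C z0) + deriv G z0"
  define L where "L = Re (deriv A z0 * cnj (deriv B z0)) + Re (deriv C z0 * cnj (deriv D z0))"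
  define M where "M = deriv (deriv A) z0 * cnj (B z0) + deriv (deriv B) z0 * cnj (A z0)
      + deriv (deriv C) z0 * cnj (D z0) + deriv (deriv D) z0 * cnj (C z0) + deriv (deriv G) z0"
  have hol': "deriv A holomorphic_on U" "deriv B holomorphic_on U"
      "deriv C holomorphic_on U" "deriv D holomorphic_on U" "deriv G holomorphic_on U"
    using hol U(1) by (auto intro: holomorphic_deriv)
  have line: "Re (d * N) = 0 \<and> Re (d\<^sup>2 * M) + 2 * (cmod d)\<^sup>2 * L \<le> 0" if d: "cmod d = 1" for d
  proof -
    define l where "l = (\<lambda>x::real. z0 + of_real x * d)"
    have lU: "l x \<in> U" if "\<bar>x\<bar> < r" for x
      using that r d by (auto simp: l_def dist_norm norm_mult)
    have l: "(l has_vector_derivative d) (at x)" for x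
      unfolding l_def by (auto intro!: derivative_eq_intros)
    have chain: "((\<lambda>x. h (l x)) has_vector_derivative d * deriv h (l x)) (at x)"
      if "h holomorphic_on U" "\<bar>x\<bar> < r" for h x
      using field_vector_diff_chain_at[OF l holomorphic_derivI[OF that(1) U(1) lU[OF that(2)]]]
      by (simp add: o_def)
    have Re_vd: "((\<lambda>x. Re (h x)) has_real_derivative Re k) (at x)"
      if "(h has_vector_derivative k) (at x)" for h k and x :: real
      using bounded_linear.has_vector_derivative[OF bounded_linear_Re that]
      by (simp add: has_real_derivative_iff_has_vector_derivative)
    have cnj_vd: "((\<lambda>x. cnj (h x)) has_vector_derivative cnj k) (at x)"
      if "(h has_vector_derivative k) (at x)" for h k and x :: real
      using bounded_linear.has_vector_derivative[OF bounded_linear_cnj that] .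
    define \<psi> where "\<psi> = (\<lambda>x. Re (A (l x) * cnj (B (l x)) + C (l x) * cnj (D (l x)) + G (l x)))"
    define \<psi>1 where "\<psi>1 = (\<lambda>x. Re (A (l x) * cnj (d * deriv B (l x)) + d * deriv A (l x) * cnj (B (l x))
        + (C (l x) * cnj (d * deriv D (l x)) + d * deriv C (l x) * cnj (D (l x))) + d * deriv G (l x)))"
    have 1: "(\<psi> has_real_derivative \<psi>1 x) (at x)" if x: "\<bar>x\<bar> < r" for x
      unfolding \<psi>_def \<psi>1_def
      by (intro Re_vd has_vector_derivative_add has_vector_derivative_mult cnj_vd chain hol x)
    have "(\<psi>1 has_real_derivative Re
        (A (l 0) * cnj (d * (d * deriv (deriv B) (l 0))) + d * deriv A (l 0) * cnj (d * deriv B (l 0))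
        + (d * deriv A (l 0) * cnj (d * deriv B (l 0)) + d * (d * deriv (deriv A) (l 0)) * cnj (B (l 0)))
        + (C (l 0) * cnj (d * (d * deriv (deriv D) (l 0))) + d * deriv C (l 0) * cnj (d * deriv D (l 0))
        + (d * deriv C (l 0) * cnj (d * deriv D (l 0)) + d * (d * deriv (deriv C) (l 0)) * cnj (D (l 0))))
        + d * (d * deriv (deriv G) (l 0)))) (at 0)"
      (is "(_ has_real_derivative Re ?X) _")
      unfolding \<psi>1_def using r
      by (intro Re_vd has_vector_derivative_add has_vector_derivative_mult
          has_vector_derivative_mult_right cnj_vd chain hol hol') auto
    note 2 = this
    have mx: "\<psi> x \<le> \<psi> 0" if "\<bar>x\<bar> < r" for x
      using max[OF lU[OF that]] by (simp add: \<psi>_def l_def)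
    have l0: "l 0 = z0" by (simp add: l_def)
    have "\<psi>1 0 = Re (d * N)"
      unfolding \<psi>1_def l0 N_def by (simp add: algebra_simps)
    moreover have "Re ?X = Re (d\<^sup>2 * M) + 2 * (cmod d)\<^sup>2 * L"
      unfolding l0 L_def M_def cmod_power2 by (simp add: algebra_simps power2_eq_square)
    ultimately show ?thesis
      using second_derivative_test_max[OF r(1) 1 2 mx] by simp
  qed
  have "Re N = 0" "Im N = 0" using line[of 1] line[of \<i>] by auto
  thus "N = 0" by (simp add: complex_eq_iff)
  show "L \<le> 0" using line[of 1] line[of \<i>] by auto
qed

text \<open>The Laplacian of \<open>|P|\<^sup>2\<close> is \<open>4 |P'|\<^sup>2\<close>, and real parts of holomorphic functions are harmonic.\<close>
lemma norm_sq_diff_eq_Re: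
  assumes U: "open U" "z \<in> U"
    and hol: "P holomorphic_on U" "Q holomorphic_on U" "G holomorphic_on U"
    and eq: "\<And>z. z \<in> U \<Longrightarrow> (cmod (P z))\<^sup>2 - (cmod (Q z))\<^sup>2 = Re (G z)"
  shows "cmod (deriv P z) = cmod (deriv Q z)"
proof -
  have sq: "Re (x * cnj x) = (cmod x)\<^sup>2" for x
    using complex_norm_square[of x] by (metis Re_complex_of_real)
  have eq': "Re (P x * cnj (P x)) - Re (Q x * cnj (Q x)) - Re (G x) = 0" if "x \<in> U" for x
    using eq[OF that] unfolding sq by simp
  have dm: "deriv (\<lambda>z. - f z) z = - deriv f z" if "f holomorphic_on U" for f
    using that U by (intro deriv_minus holomorphic_on_imp_differentiable_at) auto
  have "Re (deriv P z * cnj (deriv P z)) + Re (deriv Q z * cnj (deriv (\<lambda>z. - Q z) z)) \<le> 0"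
  proof (rule hermitian_local_max(2)[where U = U and G = "\<lambda>z. - G z"])
    fix x assume x: "x \<in> U"
    show "Re (P x * cnj (P x)) + Re (Q x * cnj (- Q x)) + Re (- G x)
        \<le> Re (P z * cnj (P z)) + Re (Q z * cnj (- Q z)) + Re (- G z)"
      using eq'[OF x] eq'[OF U(2)]
      by (simp only: complex_cnj_minus mult_minus_right uminus_complex.simps)
  qed (use U in \<open>auto intro!: holomorphic_intros hol\<close>)
  moreover have "Re (deriv Q z * cnj (deriv Q z)) + Re (deriv P z * cnj (deriv (\<lambda>z. - P z) z)) \<le> 0"
  proof (rule hermitian_local_max(2)[where U = U and G = G])
    fix x assume x: "x \<in> U"
    show "Re (Q x * cnj (Q x)) + Re (P x * cnj (- P x)) + Re (G x)
        \<le> Re (Q z * cnj (Q z)) + Re (P z * cnj (- P z)) + Re (G z)"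
      using eq'[OF x] eq'[OF U(2)]
      by (simp only: complex_cnj_minus mult_minus_right uminus_complex.simps)
  qed (use U in \<open>auto intro!: holomorphic_intros hol\<close>)
  ultimately have "(cmod (deriv P z))\<^sup>2 = (cmod (deriv Q z))\<^sup>2"
    by (simp only: dm[OF hol(1)] dm[OF hol(2)] complex_cnj_minus mult_minus_right
        minus_complex.simps uminus_complex.simps sq)
  thus ?thesis by simp
qed

text \<open>The curve is \<open>(exp \<xi>, g)\<close> with \<open>log |z|\<^sup>2 = 2 Re \<xi>\<close>, and the convex function \<open>\<eta>\<close> is replaced by
a supporting line with value \<open>h0\<close> and slope \<open>m\<close> at the given point. The defining
function is then at most \<open>0\<close> along the curve with equality at \<open>z0\<close>. With
\<open>\<Gamma> = e\<^sup>-\<^sup>i\<^sup>u g\<close>, \<open>q = e\<^sup>-\<^sup>i\<^sup>u g'\<close> and \<open>p = \<xi>'\<close>, tangency turns its Laplacian, up to a positive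
factor, into \<open>|q - \<i> \<Gamma> p|\<^sup>2 + h0 |p|\<^sup>2\<close>. Since this cannot be positive, both terms vanish,
and the tangency condition then leaves only \<open>\<Gamma> = 0\<close>, that is \<open>w = 0\<close>.\<close>
lemma no_analytic_curve_in_worm_boundary:
  assumes U: "open U" "z0 \<in> U" and hol: "\<xi> holomorphic_on U" "g holomorphic_on U"
    and le: "\<And>z. z \<in> U \<Longrightarrow> (cmod (g z))\<^sup>2 - 2 * Re (exp (- \<i> * of_real (2 * Re (\<xi> z))) * g z)
        + h0 + m * (2 * Re (\<xi> z) - 2 * Re (\<xi> z0)) \<le> 0"
    and eq: "(cmod (g z0))\<^sup>2 - 2 * Re (exp (- \<i> * of_real (2 * Re (\<xi> z0))) * g z0) + h0 = 0"
    and h0: "h0 \<ge> 0" "h0 = 0 \<Longrightarrow> m = 0" and nz: "g z0 \<noteq> 0" "deriv \<xi> z0 \<noteq> 0"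
  shows False
proof -
  define E where "E = exp (- \<i> * of_real (2 * Re (\<xi> z0)))"
  define p q \<Gamma> where "p = deriv \<xi> z0" and "q = E * deriv g z0" and "\<Gamma> = E * g z0"
  have E1: "cmod E = 1" by (simp add: E_def)
  have EE: "E * cnj E = 1" using complex_norm_square[of E] E1 by simp
  have expE: "exp (- \<i> * \<xi> z) * cnj (exp (\<i> * \<xi> z)) = exp (- \<i> * of_real (2 * Re (\<xi> z)))" for z
  proof -
    have "- \<i> * \<xi> z + cnj (\<i> * \<xi> z) = - \<i> * of_real (2 * Re (\<xi> z))"
      by (simp add: complex_eq_iff)
    thus ?thesis by (simp add: exp_cnj exp_add[symmetric])
  qed
  have sq: "Re (x * cnj x) = (cmod x)\<^sup>2" for x
    using complex_norm_square[of x] by (metis Re_complex_of_real)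
  let ?C = "\<lambda>z. - 2 * (g z * exp (- \<i> * \<xi> z))" and ?D = "\<lambda>z. exp (\<i> * \<xi> z)"
    and ?G = "\<lambda>z. of_real (2 * m) * \<xi> z"
  have herm: "Re (g z * cnj (g z)) + Re (?C z * cnj (?D z)) + Re (?G z)
      = (cmod (g z))\<^sup>2 - 2 * Re (exp (- \<i> * of_real (2 * Re (\<xi> z))) * g z) + 2 * m * Re (\<xi> z)" for z
  proof -
    have "?C z * cnj (?D z) = - 2 * (exp (- \<i> * of_real (2 * Re (\<xi> z))) * g z)"
      unfolding expE[symmetric] by (simp add: mult_ac)
    thus ?thesis by (simp only: sq) simp
  qed
  have max: "Re (g z * cnj (g z)) + Re (?C z * cnj (?D z)) + Re (?G z)
      \<le> Re (g z0 * cnj (g z0)) + Re (?C z0 * cnj (?D z0)) + Re (?G z0)" if "z \<in> U" for z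
    unfolding herm using le[OF that] eq by (simp add: algebra_simps)
  have dg: "(g has_field_derivative deriv g z0) (at z0)"
    and d\<xi>: "(\<xi> has_field_derivative deriv \<xi> z0) (at z0)"
    using hol U by (auto intro: holomorphic_derivI)
  have dC: "deriv ?C z0 = - 2 * (deriv g z0 - \<i> * p * g z0) * exp (- \<i> * \<xi> z0)"
    by (rule DERIV_imp_deriv)
       (auto intro!: derivative_eq_intros dg d\<xi> simp: p_def algebra_simps)
  have dD: "deriv ?D z0 = \<i> * p * exp (\<i> * \<xi> z0)"
    by (rule DERIV_imp_deriv)
       (auto intro!: derivative_eq_intros d\<xi> simp: p_def algebra_simps)
  have dG: "deriv ?G z0 = of_real (2 * m) * p"
    by (rule DERIV_imp_deriv)
       (auto intro!: derivative_eq_intros d\<xi> simp: p_def algebra_simps)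
  note crit = hermitian_local_max[OF U hol(2) hol(2) _ _ _ max]
  have holCDG: "?C holomorphic_on U" "?D holomorphic_on U" "?G holomorphic_on U"
    by (intro holomorphic_intros hol)+
  have expE': "exp (\<i> * \<xi> z0) * cnj (exp (- \<i> * \<xi> z0)) = cnj E"
    unfolding E_def expE[symmetric] by (simp add: mult_ac)
  have "deriv g z0 * cnj (g z0) + deriv g z0 * cnj (g z0)
      + deriv ?C z0 * cnj (?D z0) + deriv ?D z0 * cnj (?C z0) + deriv ?G z0 = 0"
    by (rule crit(1)[OF holCDG])
  also have "deriv ?C z0 * cnj (?D z0) = - 2 * (deriv g z0 - \<i> * p * g z0) * E"
    unfolding dC E_def expE[symmetric] by (simp add: mult_ac)
  also have "deriv ?D z0 * cnj (?C z0) = - 2 * \<i> * p * cnj (g z0) * cnj E"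
    unfolding dD expE'[symmetric] by (simp add: mult_ac)
  finally have "2 * (deriv g z0 * (cnj (g z0) - E) + \<i> * p * (\<Gamma> - cnj \<Gamma>) + m * p) = 0"
    unfolding dG unfolding \<Gamma>_def complex_cnj_mult of_real_mult of_real_numeral by algebra
  hence "deriv g z0 * (cnj (g z0) - E) + \<i> * p * (\<Gamma> - cnj \<Gamma>) + m * p = 0"
    unfolding mult_eq_0_iff by simp
  moreover have "\<i> * (\<Gamma> - cnj \<Gamma>) = - of_real (2 * Im \<Gamma>)" by (simp add: complex_eq_iff)
  moreover have "deriv g z0 * (cnj (g z0) - E) = q * (cnj \<Gamma> - 1)"
  proof -
    have "q * (cnj \<Gamma> - 1) = deriv g z0 * (cnj (g z0) * (E * cnj E) - E)"
      by (simp add: q_def \<Gamma>_def algebra_simps)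
    thus ?thesis by (simp add: EE)
  qed
  ultimately have c1: "q * (cnj \<Gamma> - 1) + p * of_real (m - 2 * Im \<Gamma>) = 0"
    unfolding of_real_diff by algebra
  have "Re (deriv g z0 * cnj (deriv g z0)) + Re (deriv ?C z0 * cnj (deriv ?D z0)) \<le> 0"
    by (rule crit(2)[OF holCDG])
  also have "deriv ?C z0 * cnj (deriv ?D z0)
      = 2 * \<i> * cnj p * (q - \<i> * p * \<Gamma>)"
  proof -
    have "deriv ?C z0 * cnj (deriv ?D z0) = 2 * \<i> * cnj p * (deriv g z0 - \<i> * p * g z0) * E"
      unfolding dC dD E_def expE[symmetric] complex_cnj_mult complex_cnj_i by algebra
    thus ?thesis by (simp add: q_def \<Gamma>_def algebra_simps)
  qed
  also have "Re (deriv g z0 * cnj (deriv g z0)) = (cmod q)\<^sup>2"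
    using E1 by (simp only: sq) (simp add: q_def norm_mult)
  finally have c2: "(cmod q)\<^sup>2 + Re (2 * \<i> * cnj p * (q - \<i> * p * \<Gamma>)) \<le> 0" .
  have c3: "(cmod \<Gamma>)\<^sup>2 - 2 * Re \<Gamma> + h0 = 0"
    using eq E1 unfolding E_def[symmetric] \<Gamma>_def by (simp add: norm_mult)
  have qp: "q * cnj p = cnj \<Gamma> * q * cnj p + of_real ((cmod p)\<^sup>2 * (m - 2 * Im \<Gamma>))"
  proof -
    have "(q * (cnj \<Gamma> - 1) + p * of_real (m - 2 * Im \<Gamma>)) * cnj p = 0" using c1 by simp
    moreover have "p * cnj p = of_real ((cmod p)\<^sup>2)" by (metis complex_norm_square)
    ultimately show ?thesis unfolding of_real_mult of_real_diff by algebra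
  qed
  have "(cmod (q - \<i> * \<Gamma> * p))\<^sup>2
      = (cmod q)\<^sup>2 + (cmod \<Gamma>)\<^sup>2 * (cmod p)\<^sup>2 + Re (2 * \<i> * (cnj \<Gamma> * q * cnj p))"
    unfolding cmod_power2 by (simp add: power2_eq_square algebra_simps)
  also have "Re (2 * \<i> * (cnj \<Gamma> * q * cnj p)) = Re (2 * \<i> * (q * cnj p))"
    unfolding qp by simp
  also have "(cmod q)\<^sup>2 = ((cmod q)\<^sup>2 + Re (2 * \<i> * cnj p * (q - \<i> * p * \<Gamma>)))
      - Re (2 * \<i> * (q * cnj p)) - 2 * (cmod p)\<^sup>2 * Re \<Gamma>"
    unfolding cmod_power2 by (simp add: power2_eq_square algebra_simps)
  finally have "(cmod (q - \<i> * \<Gamma> * p))\<^sup>2 \<le> (cmod p)\<^sup>2 * ((cmod \<Gamma>)\<^sup>2 - 2 * Re \<Gamma>)"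
    using c2 by (simp add: algebra_simps)
  also have "(cmod \<Gamma>)\<^sup>2 - 2 * Re \<Gamma> = - h0" using c3 by simp
  finally have s: "(cmod (q - \<i> * \<Gamma> * p))\<^sup>2 + (cmod p)\<^sup>2 * h0 \<le> 0" by simp
  have p0: "p \<noteq> 0" using nz by (simp add: p_def)
  have "(cmod p)\<^sup>2 * h0 \<le> 0" using s zero_le_power2[of "cmod (q - \<i> * \<Gamma> * p)"] by linarith
  hence h00: "h0 = 0" using p0 h0(1) by (simp add: mult_le_0_iff)
  have q: "q = \<i> * \<Gamma> * p" using s h00 by simp
  have "p * (\<i> * \<Gamma> * (cnj \<Gamma> - 1) + of_real (- 2 * Im \<Gamma>)) = 0"
    using c1 h0(2)[OF h00] unfolding q by (simp add: algebra_simps)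
  hence "\<i> * \<Gamma> * (cnj \<Gamma> - 1) + of_real (- 2 * Im \<Gamma>) = 0" using p0 by simp
  hence "Im (\<i> * \<Gamma> * (cnj \<Gamma> - 1)) = 0" "Re (\<i> * \<Gamma> * (cnj \<Gamma> - 1)) = 2 * Im \<Gamma>"
    by (auto simp: complex_eq_iff)
  hence "(cmod \<Gamma>)\<^sup>2 = Re \<Gamma>" unfolding cmod_power2 by (auto simp: power2_eq_square algebra_simps)
  hence "\<Gamma> = 0" using c3 h00 by simp
  thus False using nz(1) E1 by (auto simp: \<Gamma>_def)
qed

section \<open>The universal covering of the worm domain\<close>

text \<open>A continuous function with values in the discrete set \<open>2 \<pi> \<i> \<int>\<close> is constant on a connected set.
It yields the degree of a lift and the uniqueness of lifts.\<close>
lemma exp_eq_1_imp_const_int: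
  assumes S: "connected S" and h: "continuous_on S h" and e: "\<And>x. x \<in> S \<Longrightarrow> exp (h x) = (1::complex)"
  obtains n :: int where "\<And>x. x \<in> S \<Longrightarrow> h x = 2 * pi * n * \<i>"
proof -
  have ex: "\<exists>n::int. h x = 2 * pi * n * \<i>" if "x \<in> S" for x
  proof -
    have "Re (h x) = 0 \<and> (\<exists>n::int. Im (h x) = of_int (2 * n) * pi)" using e[OF that] by (simp add: exp_eq_1)
    thus ?thesis by (auto simp: complex_eq_iff)
  qed
  have "h constant_on S"
  proof (rule continuous_discrete_range_constant[OF S h])
    fix x assume x: "x \<in> S"
    have "1 \<le> norm (h y - h x)" if y: "y \<in> S" "h y \<noteq> h x" for y
    proof -
      obtain n m :: int where nm: "h x = 2 * pi * n * \<i>" "h y = 2 * pi * m * \<i>" using ex x y by meson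
      have "m \<noteq> n" using nm y by auto
      have "h y - h x = of_real (2 * pi * of_int (m - n)) * \<i>" by (simp add: nm algebra_simps)
      hence "norm (h y - h x) = 2 * pi * of_int \<bar>m - n\<bar>" by (simp only: norm_mult norm_of_real) (simp add: abs_mult)
      also have "\<dots> \<ge> 1 * 1"
        by (rule mult_mono) (use \<open>m \<noteq> n\<close> pi_gt3 in auto)
      finally show ?thesis by simp
    qed
    thus "\<exists>e>0. \<forall>y. y \<in> S \<and> h y \<noteq> h x \<longrightarrow> e \<le> norm (h y - h x)" by (intro exI[of _ 1]) auto
  qed
  then obtain c where c: "\<And>x. x \<in> S \<Longrightarrow> h x = c" unfolding constant_on_def by auto
  show thesis
  proof (cases "S = {}")
    case True
    thus thesis using that[of 0] by auto
  next
    case False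
    then obtain x where x: "x \<in> S" by auto
    obtain n :: int where "h x = 2 * pi * n * \<i>" using ex[OF x] by auto
    thus thesis using that c x by metis
  qed
qed

text \<open>This is \<open>|e\<^sup>2\<^sup>i\<^sup>\<zeta>|\<close> (lemma \<open>norm_exp_emod\<close>).\<close>
definition emod :: "complex \<Rightarrow> real" where "emod \<zeta> = exp (- 2 * Im \<zeta>)"

text \<open>The coordinate \<open>w\<close> of the worm domain as a function on its covering.\<close>
definition wcoord :: "complex \<times> complex \<Rightarrow> complex" where "wcoord p = exp (2 * \<i> * fst p) / snd p"

definition cover_map :: "complex \<times> complex \<Rightarrow> complex \<times> complex" where "cover_map p = (exp (fst p), wcoord p)"

text \<open>The lift of the rotation \<open>z \<mapsto> e\<^sup>i\<^sup>\<theta> z\<close>; for \<open>\<theta> = 2 \<pi>\<close> it generates the deck transformations.\<close>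
definition Rot :: "real \<Rightarrow> complex \<times> complex \<Rightarrow> complex \<times> complex" where
  "Rot \<theta> p = (fst p + \<i> * \<theta>, of_real (exp (- 2 * \<theta>)) * snd p)"

lemma emod_pos [simp]: "emod \<zeta> > 0" by (simp add: emod_def)
lemma emod_nz [simp]: "emod \<zeta> \<noteq> 0" by (simp add: emod_def)
lemma emod_nn [simp]: "emod \<zeta> \<ge> 0" by (simp add: emod_def)

lemma norm_exp_emod: "cmod (exp (2 * \<i> * \<zeta>)) = emod \<zeta>"
  by (simp add: emod_def)

lemma norm_exp_ii: "(cmod (exp (\<i> * \<zeta>)))\<^sup>2 = emod \<zeta>"
  by (simp add: emod_def power2_eq_square exp_add[symmetric])

lemma norm_wcoord: "cmod (wcoord p) = emod (fst p) / cmod (snd p)"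
  by (simp only: wcoord_def norm_divide norm_exp_emod)

lemma Rot_0 [simp]: "Rot 0 p = p"
  by (simp add: Rot_def)

lemma Rot_Rot: "Rot a (Rot b p) = Rot (a + b) p"
proof -
  have "exp (- 2 * a) * exp (- 2 * b) = exp (- 2 * (a + b))" by (simp add: exp_add[symmetric])
  hence "of_real (exp (- 2 * a)) * (of_real (exp (- 2 * b)) * snd p)
      = of_real (exp (- 2 * (a + b))) * snd p"
    by (metis mult.assoc of_real_mult)
  thus ?thesis by (simp add: Rot_def algebra_simps)
qed

lemma exp_2i_shift:
  "exp (2 * \<i> * (\<zeta> + \<i> * of_real \<theta>)) = exp (2 * \<i> * \<zeta>) * of_real (exp (- 2 * \<theta>))"
proof -
  have "2 * \<i> * (\<zeta> + \<i> * of_real \<theta>) = 2 * \<i> * \<zeta> + of_real (- 2 * \<theta>)" by (simp add: complex_eq_iff)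
  thus ?thesis by (simp only: exp_add exp_of_real)
qed

lemma wcoord_Rot [simp]: "wcoord (Rot \<theta> p) = wcoord p"
  using exp_2i_shift[of "fst p" \<theta>] by (simp add: wcoord_def Rot_def)

lemma emod_Rot: "emod (fst (Rot \<theta> p)) = exp (- 2 * \<theta>) * emod (fst p)"
  by (simp add: emod_def Rot_def exp_add[symmetric] algebra_simps)

lemma cover_map_Rot: "cover_map (Rot \<theta> p) = (exp (\<i> * \<theta>) * fst (cover_map p), snd (cover_map p))"
  by (simp add: cover_map_def) (simp add: Rot_def exp_add mult.commute)

lemma cover_map_eq_imp_Rot:
  assumes "cover_map p = cover_map q" "snd p \<noteq> 0" "snd q \<noteq> 0"
  obtains n :: int where "p = Rot (2 * pi * n) q"
proof -
  have "exp (fst p) = exp (fst q)" and w: "wcoord p = wcoord q" using assms by (auto simp: cover_map_def)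
  then obtain n :: int where n: "fst p = fst q + (of_int (2 * n) * pi) * \<i>" by (auto simp: exp_eq)
  have f: "fst p = fst (Rot (2 * pi * n) q)" by (simp add: n Rot_def)
  have "wcoord p = wcoord (Rot (2 * pi * n) q)" using w by simp
  hence "exp (2 * \<i> * fst p) / snd p = exp (2 * \<i> * fst p) / snd (Rot (2 * pi * n) q)"
    unfolding wcoord_def f .
  hence "snd p = snd (Rot (2 * pi * n) q)" using assms(2,3) by (simp add: Rot_def field_simps)
  thus thesis using f that by (metis prod.collapse)
qed

locale worm =
  fixes \<mu> :: real and \<eta> :: "real \<Rightarrow> real"
  assumes mu: "\<mu> > 0" and prof: "worm_profile \<mu> \<eta>"
begin

lemma eta_nonneg: "\<eta> x \<ge> 0" and eta_even: "\<eta> (- x) = \<eta> x" and eta_convex: "convex_on UNIV \<eta>"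
  using prof by (auto simp: worm_profile_def)

lemma eta_eq_0: "\<eta> x = 0 \<longleftrightarrow> \<bar>x\<bar> \<le> \<mu>"
  using prof by (auto simp: worm_profile_def vimage_def set_eq_iff abs_le_iff)

lemma eta_abs: "\<eta> \<bar>x\<bar> = \<eta> x"
  using eta_even by (auto simp: abs_if)

lemma eta_mono: assumes "\<bar>x\<bar> \<le> \<bar>y\<bar>" shows "\<eta> x \<le> \<eta> y"
proof (cases "y = 0")
  case True thus ?thesis using assms by simp
next
  case False
  define s where "s = \<bar>x\<bar> / \<bar>y\<bar>"
  have s: "0 \<le> s" "s \<le> 1" using assms False by (auto simp: s_def field_simps)
  have "\<eta> ((1 - s) *\<^sub>R 0 + s *\<^sub>R \<bar>y\<bar>) \<le> (1 - s) * \<eta> 0 + s * \<eta> \<bar>y\<bar>"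
    by (rule convex_onD[OF eta_convex]) (use s in auto)
  hence "\<eta> \<bar>x\<bar> \<le> s * \<eta> y" using False eta_eq_0[of 0] mu by (simp add: s_def eta_abs)
  also have "\<dots> \<le> 1 * \<eta> y" using s eta_nonneg by (intro mult_right_mono) auto
  finally show ?thesis by (simp add: eta_abs)
qed

lemma eta_diff: "\<eta> differentiable (at x)"
proof -
  have "(deriv ^^ 0) \<eta> differentiable_on UNIV"
    using prof unfolding worm_profile_def smooth_real_def by blast
  thus ?thesis by (simp add: differentiable_on_def)
qed

lemma eta_cont: "continuous_on S \<eta>"
  using eta_diff by (intro continuous_at_imp_continuous_on ballI differentiable_imp_continuous_within)

lemma eta_bounded_sublevel: obtains b where "b > 0" "\<And>x. \<eta> x < 1 \<Longrightarrow> \<bar>x\<bar> < b"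
proof -
  obtain a where a: "a > 0" "\<And>x. \<bar>x\<bar> > a \<Longrightarrow> \<eta> x > 1" using prof by (auto simp: worm_profile_def)
  have "\<bar>x\<bar> < a + 1" if "\<eta> x < 1" for x
    using a(2)[of x] that by (cases "\<bar>x\<bar> > a") auto
  thus thesis using a(1) by (intro that[of "a + 1"]) auto
qed

text \<open>Where \<open>\<eta>\<close> vanishes the supporting line is horizontal, as the exclusion of analytic curves
in the boundary requires.\<close>
lemma eta_support:
  obtains m where "\<And>x. \<eta> x \<ge> \<eta> x0 + m * (x - x0)" "\<eta> x0 = 0 \<Longrightarrow> m = 0"
proof (cases "\<eta> x0 = 0")
  case True
  thus thesis using eta_nonneg by (intro that[of 0]) auto
next
  case False
  obtain D where D: "(\<eta> has_real_derivative D) (at x0)"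
    using eta_diff by (metis real_differentiable_def)
  have "\<eta> x - \<eta> x0 \<ge> D * (x - x0)" for x
    by (rule convex_on_imp_above_tangent[OF eta_convex]) (use D in auto)
  thus thesis using False by (intro that[of D]) (auto simp: algebra_simps)
qed

text \<open>The universal covering of the worm domain, with covering projection \<open>cover_map\<close>.\<close>
definition Cover :: "(complex \<times> complex) set" where
  "Cover = {(\<zeta>, V). 2 * Re V > emod \<zeta> + \<eta> (2 * Re \<zeta>) * (cmod V)\<^sup>2 / emod \<zeta>}"

lemma Cover_iff: "(\<zeta>, V) \<in> Cover \<longleftrightarrow> 2 * Re V > emod \<zeta> + \<eta> (2 * Re \<zeta>) * (cmod V)\<^sup>2 / emod \<zeta>"
  by (simp add: Cover_def)

lemma Cover_D: assumes "(\<zeta>, V) \<in> Cover" shows "2 * Re V > emod \<zeta>" "Re V > 0" "V \<noteq> 0"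
proof -
  have "\<eta> (2 * Re \<zeta>) * (cmod V)\<^sup>2 / emod \<zeta> \<ge> 0" using eta_nonneg by simp
  thus 1: "2 * Re V > emod \<zeta>" using assms by (simp add: Cover_iff)
  thus "Re V > 0" using emod_pos[of \<zeta>] by linarith
  thus "V \<noteq> 0" by auto
qed

lemma Cover_flat: assumes "\<bar>2 * Re \<zeta>\<bar> \<le> \<mu>" shows "(\<zeta>, V) \<in> Cover \<longleftrightarrow> 2 * Re V > emod \<zeta>"
proof -
  have "\<eta> (2 * Re \<zeta>) = 0" using eta_eq_0 assms by blast
  thus ?thesis by (simp add: Cover_iff)
qed

lemma worm_nz: assumes "(z, w) \<in> worm_domain \<eta>" shows "z \<noteq> 0" "w \<noteq> 0"
proof -
  show z: "z \<noteq> 0" using assms by (auto simp: worm_domain_def)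
  show "w \<noteq> 0"
  proof
    assume "w = 0"
    hence "(cmod (exp (\<i> * complex_of_real (ln ((cmod z)\<^sup>2)))))\<^sup>2 < 1 - \<eta> (ln ((cmod z)\<^sup>2))"
      using assms by (simp add: worm_domain_def)
    thus False using eta_nonneg[of "ln ((cmod z)\<^sup>2)"] by (simp add: norm_exp_i_times)
  qed
qed

lemma ln_norm_exp_sq: "ln ((cmod (exp \<zeta>))\<^sup>2) = 2 * Re \<zeta>"
  by (simp add: ln_realpow)

lemma worm_dist_sq: assumes "V \<noteq> 0"
  shows "(cmod (wcoord (\<zeta>, V) - exp (\<i> * of_real (2 * Re \<zeta>))))\<^sup>2
    = (emod \<zeta> / cmod V)\<^sup>2 - 2 * (emod \<zeta> * Re V / (cmod V)\<^sup>2) + 1"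
proof -
  define E where "E = exp (\<i> * of_real (2 * Re \<zeta>))"
  define w where "w = wcoord (\<zeta>, V)"
  have E1: "cmod E = 1" unfolding E_def by (rule norm_exp_i_times)
  have "w * cnj E = of_real (emod \<zeta>) * (1 / V)"
  proof -
    have "2 * \<i> * \<zeta> - \<i> * of_real (2 * Re \<zeta>) = of_real (- 2 * Im \<zeta>)" by (simp add: complex_eq_iff)
    hence "exp (2 * \<i> * \<zeta>) * cnj E = of_real (emod \<zeta>)"
      unfolding E_def emod_def exp_of_real[symmetric]
      by (simp add: exp_cnj exp_add[symmetric])
    thus ?thesis by (simp add: w_def wcoord_def)
  qed
  also have "1 / V = cnj V / of_real ((cmod V)\<^sup>2)" using complex_div_cnj[of 1 V] by simp
  also have "of_real (emod \<zeta>) * \<dots> = of_real (emod \<zeta> / (cmod V)\<^sup>2) * cnj V" by simp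
  finally have wE: "Re (w * cnj E) = emod \<zeta> * Re V / (cmod V)\<^sup>2" by simp
  have "(cmod (w - E))\<^sup>2 = (cmod w)\<^sup>2 - 2 * Re (w * cnj E) + (cmod E)\<^sup>2"
    unfolding cmod_power2 by (simp add: power2_eq_square algebra_simps)
  from this[unfolded wE E1] show ?thesis by (simp add: w_def E_def norm_wcoord)
qed

text \<open>With \<open>e = emod \<zeta>\<close> one has \<open>w e\<^sup>-\<^sup>i\<^sup>t = e / V\<close>, so the inequality that defines the worm domain
becomes the one that defines \<open>Cover\<close> after multiplication by \<open>|V|\<^sup>2 / e\<close>.\<close>
lemma cover_map_in_worm_iff: assumes V: "V \<noteq> 0"
  shows "cover_map (\<zeta>, V) \<in> worm_domain \<eta> \<longleftrightarrow> (\<zeta>, V) \<in> Cover"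
proof -
  define e t v where "e = emod \<zeta>" and "t = \<eta> (2 * Re \<zeta>)" and "v = cmod V"
  have e: "e > 0" and v: "v > 0" using V by (auto simp: e_def v_def)
  have "cover_map (\<zeta>, V) \<in> worm_domain \<eta> \<longleftrightarrow> (e / v)\<^sup>2 - 2 * (e * Re V / v\<^sup>2) + 1 < 1 - t"
    unfolding cover_map_def worm_domain_def fst_conv prod.case mem_Collect_eq ln_norm_exp_sq
      worm_dist_sq[OF V] by (simp add: e_def t_def v_def)
  also have "\<dots> \<longleftrightarrow> ((e / v)\<^sup>2 - 2 * (e * Re V / v\<^sup>2) + t) * (v\<^sup>2 / e) < 0"
  proof -
    define A where "A = (e / v)\<^sup>2 - 2 * (e * Re V / v\<^sup>2)"
    have "v\<^sup>2 / e > 0" using e v by simp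
    hence "(A + t) * (v\<^sup>2 / e) < 0 \<longleftrightarrow> A + t < 0" by (metis mult_less_cancel_right_pos mult_zero_left)
    thus ?thesis unfolding A_def[symmetric] by linarith
  qed
  also have "((e / v)\<^sup>2 - 2 * (e * Re V / v\<^sup>2) + t) * (v\<^sup>2 / e) = e - 2 * Re V + t * v\<^sup>2 / e"
    using e v by (simp add: field_simps power2_eq_square)
  also have "\<dots> < 0 \<longleftrightarrow> (\<zeta>, V) \<in> Cover" by (auto simp: Cover_iff e_def t_def v_def)
  finally show ?thesis .
qed

lemma cover_map_Cover: "p \<in> Cover \<Longrightarrow> cover_map p \<in> worm_domain \<eta>"
  using cover_map_in_worm_iff Cover_D(3) by (metis prod.collapse)

lemma worm_point_lift:
  assumes "(z, w) \<in> worm_domain \<eta>" "exp \<zeta> = z"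
  shows "(\<zeta>, exp (2 * \<i> * \<zeta>) / w) \<in> Cover" "cover_map (\<zeta>, exp (2 * \<i> * \<zeta>) / w) = (z, w)"
proof -
  have w: "w \<noteq> 0" using worm_nz assms by blast
  show *: "cover_map (\<zeta>, exp (2 * \<i> * \<zeta>) / w) = (z, w)"
    using w assms by (simp add: cover_map_def wcoord_def)
  show "(\<zeta>, exp (2 * \<i> * \<zeta>) / w) \<in> Cover"
    using cover_map_in_worm_iff[of "exp (2 * \<i> * \<zeta>) / w" \<zeta>] * assms w by simp
qed

lemma Rot_Om_imp: assumes "p \<in> Cover" shows "Rot \<theta> p \<in> Cover"
proof -
  obtain \<zeta> V where p: "p = (\<zeta>, V)" by (cases p)
  define x where "x = exp (- (2 * \<theta>))"
  have x: "x > 0" by (simp add: x_def)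
  have "emod (\<zeta> + \<i> * \<theta>) = x * emod \<zeta>" using emod_Rot[of \<theta> p] by (simp add: p Rot_def x_def)
  moreover have "x * (emod \<zeta> + \<eta> (2 * Re \<zeta>) * (cmod V)\<^sup>2 / emod \<zeta>) < x * (2 * Re V)"
    using assms x by (simp add: p Cover_iff)
  moreover have "x * (emod \<zeta> + \<eta> (2 * Re \<zeta>) * (cmod V)\<^sup>2 / emod \<zeta>)
      = x * emod \<zeta> + \<eta> (2 * Re \<zeta>) * (cmod (of_real x * V))\<^sup>2 / (x * emod \<zeta>)"
    using x by (simp add: norm_mult field_simps power2_eq_square)
  ultimately show ?thesis
    by (simp add: p Rot_def Cover_iff x_def[symmetric])
qed

lemma Rot_Cover [simp]: "Rot \<theta> p \<in> Cover \<longleftrightarrow> p \<in> Cover"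
  using Rot_Om_imp[of p \<theta>] Rot_Om_imp[of "Rot \<theta> p" "- \<theta>"] by (auto simp: Rot_Rot)

lemma Cover_eta_wcoord: assumes "p \<in> Cover"
  shows "\<eta> (2 * Re (fst p)) < 2 * cmod (wcoord p)" "cmod (wcoord p) < 2" "wcoord p \<noteq> 0" "\<eta> (2 * Re (fst p)) < 1"
proof -
  obtain \<zeta> V where p: "p = (\<zeta>, V)" by (cases p)
  have pOm: "(\<zeta>, V) \<in> Cover" using assms p by simp
  define e t v where "e = emod \<zeta>" and "t = \<eta> (2 * Re \<zeta>)" and "v = cmod V"
  have e: "e > 0" and v: "v > 0" using Cover_D[OF pOm] by (auto simp: e_def v_def)
  have RV: "Re V \<le> v" unfolding v_def by (rule complex_Re_le_cmod)
  have in_om: "2 * Re V > e + t * v\<^sup>2 / e" using pOm by (simp add: Cover_iff e_def t_def v_def)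
  have "t * v\<^sup>2 / e < 2 * v" using in_om e RV by linarith
  hence "t < 2 * (e / v)" using e v by (simp add: field_simps power2_eq_square)
  thus "\<eta> (2 * Re (fst p)) < 2 * cmod (wcoord p)" by (simp add: norm_wcoord p t_def e_def v_def)
  have "e < 2 * v" using Cover_D(1)[OF pOm] RV by (simp add: e_def)
  thus "cmod (wcoord p) < 2" using v by (simp add: norm_wcoord p e_def v_def field_simps)
  show "wcoord p \<noteq> 0" using Cover_D(3)[OF pOm] by (simp add: wcoord_def p)
  have W: "cover_map p \<in> worm_domain \<eta>" using cover_map_Cover assms by simp
  hence "0 < 1 - \<eta> (2 * Re \<zeta>)"
    unfolding p cover_map_def worm_domain_def fst_conv prod.case mem_Collect_eq ln_norm_exp_sq
    using zero_le_power2 by (metis order_le_less_trans)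
  thus "\<eta> (2 * Re (fst p)) < 1" by (simp add: p)
qed

lemma Cover_t_bounded: obtains b where "b > 0" "\<And>p. p \<in> Cover \<Longrightarrow> \<bar>2 * Re (fst p)\<bar> < b"
  using eta_bounded_sublevel Cover_eta_wcoord(4) by metis

lemma continuous_on_emod [continuous_intros]: "continuous_on S f \<Longrightarrow> continuous_on S (\<lambda>x. emod (f x))"
  unfolding emod_def by (intro continuous_intros)

lemma continuous_on_eta [continuous_intros]: "continuous_on S f \<Longrightarrow> continuous_on S (\<lambda>x. \<eta> (f x))"
  using continuous_on_compose2[OF eta_cont[of UNIV]] by auto

lemma open_Cover: "open Cover"
proof -
  have "Cover = {p. emod (fst p) + \<eta> (2 * Re (fst p)) * (cmod (snd p))\<^sup>2 / emod (fst p) < 2 * Re (snd p)}"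
    by (auto simp: Cover_def)
  also have "open \<dots>"
    by (rule open_Collect_less) (auto intro!: continuous_intros)
  finally show ?thesis .
qed

lemma convex_slice:
  assumes "(\<zeta>, V) \<in> Cover" "(\<zeta>, U) \<in> Cover" "0 \<le> s" "s \<le> 1"
  shows "(\<zeta>, (1 - s) *\<^sub>R V + s *\<^sub>R U) \<in> Cover"
proof -
  define e t where "e = emod \<zeta>" and "t = \<eta> (2 * Re \<zeta>)"
  define a b where "a = cmod V" and "b = cmod U"
  have e: "e > 0" and t: "t \<ge> 0" using eta_nonneg by (auto simp: e_def t_def)
  have sq: "(cmod ((1 - s) *\<^sub>R V + s *\<^sub>R U))\<^sup>2 \<le> (1 - s) * a\<^sup>2 + s * b\<^sup>2"
  proof -
    have "cmod ((1 - s) *\<^sub>R V + s *\<^sub>R U) \<le> (1 - s) * a + s * b"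
      using norm_triangle_ineq[of "(1 - s) *\<^sub>R V" "s *\<^sub>R U"] assms by (simp add: a_def b_def)
    hence "(cmod ((1 - s) *\<^sub>R V + s *\<^sub>R U))\<^sup>2 \<le> ((1 - s) * a + s * b)\<^sup>2" by (rule power_mono) simp
    also have "\<dots> = (1 - s) * a\<^sup>2 + s * b\<^sup>2 - s * (1 - s) * (a - b)\<^sup>2"
      by (simp add: power2_eq_square algebra_simps)
    finally show ?thesis using assms by (smt (verit) mult_nonneg_nonneg zero_le_power2)
  qed
  have le: "t * (cmod ((1 - s) *\<^sub>R V + s *\<^sub>R U))\<^sup>2 / e
      \<le> (1 - s) * (t * a\<^sup>2 / e) + s * (t * b\<^sup>2 / e)"
  proof -
    define q where "q = (cmod ((1 - s) *\<^sub>R V + s *\<^sub>R U))\<^sup>2"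
    have "t / e * q \<le> t / e * ((1 - s) * a\<^sup>2 + s * b\<^sup>2)"
      using sq e t unfolding q_def by (intro mult_left_mono) auto
    also have "\<dots> = (1 - s) * (t * a\<^sup>2 / e) + s * (t * b\<^sup>2 / e)"
      using e by (simp add: field_simps)
    finally show ?thesis by (simp add: q_def)
  qed
  have V: "2 * Re V - e - t * a\<^sup>2 / e > 0" and U: "2 * Re U - e - t * b\<^sup>2 / e > 0"
    using assms(1,2) by (auto simp: Cover_iff e_def t_def a_def b_def)
  have "(1 - s) * (2 * Re V - e - t * a\<^sup>2 / e) + s * (2 * Re U - e - t * b\<^sup>2 / e) > 0"
  proof (cases "s = 0")
    case False
    hence "s * (2 * Re U - e - t * b\<^sup>2 / e) > 0" using assms(3) U by simp
    moreover have "(1 - s) * (2 * Re V - e - t * a\<^sup>2 / e) \<ge> 0" using assms(4) V by simp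
    ultimately show ?thesis by simp
  qed (use V in simp)
  hence "2 * Re ((1 - s) *\<^sub>R V + s *\<^sub>R U) > e + ((1 - s) * (t * a\<^sup>2 / e) + s * (t * b\<^sup>2 / e))"
    by (simp add: algebra_simps)
  thus ?thesis using le unfolding Cover_iff e_def t_def by linarith
qed

lemma centre_Cover: assumes "\<eta> (2 * Re \<zeta>) < 1" shows "(\<zeta>, of_real (emod \<zeta>)) \<in> Cover"
  using assms by (simp add: Cover_iff power2_eq_square)

text \<open>Every slice over a fixed \<open>\<zeta>\<close> is convex (a half-plane or a disc) and contains \<open>emod \<zeta>\<close>, which
corresponds to the centre of the disc in \<open>w\<close>. The covering retracts onto this section, whose
base is a convex strip.\<close>
lemma contractible_Cover: "contractible Cover"
proof -
  define J where "J = {\<zeta>. \<eta> (2 * Re \<zeta>) < 1}"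
  have conv: "convex J"
  proof (rule convexI)
    fix x y and u v :: real assume xy: "x \<in> J" "y \<in> J" "0 \<le> u" "0 \<le> v" "u + v = 1"
    have u: "u = 1 - v" using xy by simp
    have "\<eta> ((1 - v) *\<^sub>R (2 * Re x) + v *\<^sub>R (2 * Re y)) \<le> (1 - v) * \<eta> (2 * Re x) + v * \<eta> (2 * Re y)"
      by (rule convex_onD[OF eta_convex]) (use xy in auto)
    also have "\<dots> \<le> max (\<eta> (2 * Re x)) (\<eta> (2 * Re y))"
      by (rule convex_bound_le) (use xy in auto)
    also have "\<dots> < 1" using xy by (simp add: J_def)
    finally show "u *\<^sub>R x + v *\<^sub>R y \<in> J" by (simp add: J_def u algebra_simps)
  qed
  define c where "c = (\<lambda>\<zeta>. (\<zeta>, complex_of_real (emod \<zeta>)))"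
  have cc: "continuous_on S c" for S unfolding c_def by (intro continuous_intros)
  have 1: "homotopic_with_canon (\<lambda>z. True) Cover Cover id (c \<circ> fst)"
  proof (rule homotopic_with_linear)
    show "continuous_on Cover (c \<circ> fst)"
      by (intro continuous_on_compose cc continuous_on_fst continuous_on_id)
    fix p assume p: "p \<in> Cover"
    obtain \<zeta> V where pe: "p = (\<zeta>, V)" by (cases p)
    have "(\<zeta>, of_real (emod \<zeta>)) \<in> Cover" using Cover_eta_wcoord(4)[OF p] by (intro centre_Cover) (simp add: pe)
    thus "closed_segment (id p) ((c \<circ> fst) p) \<subseteq> Cover"
      using convex_slice[of \<zeta> V "of_real (emod \<zeta>)"] p
      by (auto simp: closed_segment_def pe c_def scaleR_left_diff_distrib[symmetric] algebra_simps
          simp del: scaleR_conv_of_real)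
  qed auto
  obtain a where 2: "homotopic_with_canon (\<lambda>z. True) Cover Cover (c \<circ> fst) (\<lambda>x. a)"
  proof (rule nullhomotopic_through_contractible)
    show "continuous_on Cover fst" by (intro continuous_intros)
    show "fst \<in> Cover \<rightarrow> J" using Cover_eta_wcoord(4) by (auto simp: J_def)
    show "c \<in> J \<rightarrow> Cover" using centre_Cover by (auto simp: J_def c_def)
    show "contractible J" using conv by (rule convex_imp_contractible)
  qed (use cc in auto)
  show ?thesis unfolding contractible_def using homotopic_with_trans[OF 1 2] by blast
qed

lemma connected_Cover: "connected Cover"
  using contractible_Cover contractible_imp_connected by blast

lemma open_worm: "open (worm_domain \<eta>)"
proof -
  have "worm_domain \<eta> = {p \<in> {p. fst p \<noteq> 0}. (cmod (snd p - exp (\<i> * of_real (ln ((cmod (fst p))\<^sup>2)))))\<^sup>2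
      - 1 + \<eta> (ln ((cmod (fst p))\<^sup>2)) < 0}"
    by (auto simp: worm_domain_def)
  also have "\<dots> = {p. fst p \<noteq> 0} \<inter> (\<lambda>p. (cmod (snd p - exp (\<i> * of_real (ln ((cmod (fst p))\<^sup>2)))))\<^sup>2
      - 1 + \<eta> (ln ((cmod (fst p))\<^sup>2))) -` {..<0}" by auto
  also have "open \<dots>"
  proof (rule continuous_open_preimage)
    show "open {p :: complex \<times> complex. fst p \<noteq> 0}"
      by (intro open_Collect_neq continuous_intros)
  qed (auto intro!: continuous_intros)
  finally show ?thesis .
qed

end

section \<open>Lifted automorphisms near the flat part of the boundary\<close>

context worm
begin

text \<open>The integer \<open>n\<close> is the degree of the map around \<open>z = 0\<close>.\<close>
definition deck_map :: "int \<Rightarrow> (complex \<times> complex \<Rightarrow> complex \<times> complex) \<Rightarrow> bool" where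
  "deck_map n L \<longleftrightarrow> (\<forall>p\<in>Cover. L p \<in> Cover) \<and> hol2 (\<lambda>p. fst (L p)) Cover \<and> hol2 (\<lambda>p. snd (L p)) Cover \<and>
     (\<forall>p\<in>Cover. L (Rot (2 * pi) p) = Rot (2 * pi * n) (L p))"

lemma deck_map_Rot_int:
  assumes "deck_map n L" "p \<in> Cover"
  shows "L (Rot (2 * pi * of_int k) p) = Rot (2 * pi * of_int (n * k)) (L p)"
proof -
  have step: "L (Rot (2 * pi) q) = Rot (2 * pi * n) (L q)" if "q \<in> Cover" for q
    using assms that by (simp add: deck_map_def)
  have nat: "L (Rot (2 * pi * of_nat k) q) = Rot (2 * pi * of_int (n * int k)) (L q)" if "q \<in> Cover" for q and k :: nat
  proof (induction k)
    case (Suc k)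
    have "L (Rot (2 * pi * of_nat (Suc k)) q) = L (Rot (2 * pi) (Rot (2 * pi * of_nat k) q))"
      by (simp add: Rot_Rot algebra_simps)
    also have "\<dots> = Rot (2 * pi * n) (L (Rot (2 * pi * of_nat k) q))" using that by (intro step) simp
    also have "\<dots> = Rot (2 * pi * n) (Rot (2 * pi * of_int (n * int k)) (L q))" by (simp only: Suc)
    also have "\<dots> = Rot (2 * pi * of_int (n * int (Suc k))) (L q)" by (simp add: Rot_Rot algebra_simps)
    finally show ?case .
  qed simp
  show ?thesis
  proof (cases "k \<ge> 0")
    case True
    thus ?thesis using nat[OF assms(2), of "Suc 0 * nat k"] by simp
  next
    case False
    define j where "j = nat (- k)"
    define q where "q = Rot (2 * pi * of_int k) p"
    have q: "q \<in> Cover" using assms by (simp add: q_def)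
    have kj: "k = - int j" using False by (simp add: j_def)
    have "L p = L (Rot (2 * pi * of_nat j) q)" by (simp add: q_def Rot_Rot kj)
    also have "\<dots> = Rot (2 * pi * of_int (n * int j)) (L q)" by (rule nat[OF q])
    finally show ?thesis by (simp add: Rot_Rot q_def kj)
  qed
qed

end

text \<open>A lifted automorphism together with its lifted inverse. The degree \<open>n\<close> is its own inverse in the
integers, so both maps have the same degree.\<close>
locale deck_pair = worm +
  fixes L L' :: "complex \<times> complex \<Rightarrow> complex \<times> complex" and n :: int
  assumes L: "deck_map n L" and L': "deck_map n L'" and nn: "n * n = 1"
    and L'L: "p \<in> Cover \<Longrightarrow> L' (L p) = p" and LL': "p \<in> Cover \<Longrightarrow> L (L' p) = p"
begin

lemma swap: "deck_pair \<mu> \<eta> L' L n"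
  by unfold_locales (use L L' nn L'L LL' in auto)

lemma L_Cover [simp]: "p \<in> Cover \<Longrightarrow> L p \<in> Cover" and L'_Cover [simp]: "p \<in> Cover \<Longrightarrow> L' p \<in> Cover"
  using L L' by (auto simp: deck_map_def)

lemma X_hol: "hol2 (\<lambda>p. fst (L p)) Cover" and Y_hol: "hol2 (\<lambda>p. snd (L p)) Cover"
  using L by (auto simp: deck_map_def)

lemma wcoord_L_hol: "hol2 (\<lambda>p. wcoord (L p)) Cover"
proof -
  have "snd (L p) \<noteq> 0" if "p \<in> Cover" for p
    using Cover_D(3)[of "fst (L p)" "snd (L p)"] L_Cover[OF that] by simp
  thus ?thesis unfolding wcoord_def by (intro hol2_intros X_hol Y_hol)
qed

lemma n_cases: "n = 1 \<or> n = - 1"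
  using nn by (metis zmult_eq_1_iff)

lemma wcoord_L_Rot: assumes "p \<in> Cover" shows "wcoord (L (Rot (2 * pi * of_int k) p)) = wcoord (L p)"
  using deck_map_Rot_int[OF L assms] by simp

text \<open>The fibre \<open>w = 1/R\<close>, parametrised by \<open>\<zeta>\<close>.\<close>
definition fibre :: "real \<Rightarrow> complex \<Rightarrow> complex \<times> complex" where
  "fibre R \<zeta> = (\<zeta>, exp (2 * \<i> * \<zeta>) * of_real R)"

text \<open>The bound \<open>1\<close> ensures \<open>cos t > 1/2\<close> for \<open>|t| < strip_width\<close>, so that fibres with \<open>R \<ge> 1\<close> lie in
the covering over this range.\<close>
definition strip_width :: real where "strip_width = min \<mu> 1"

lemma strip_width: "strip_width > 0" "strip_width \<le> 1" "strip_width \<le> \<mu>"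
  using mu by (auto simp: strip_width_def)

lemma exp_2i: "exp (2 * \<i> * \<zeta>) = of_real (emod \<zeta>) * cis (2 * Re \<zeta>)"
proof -
  have "2 * \<i> * \<zeta> = of_real (- 2 * Im \<zeta>) + \<i> * of_real (2 * Re \<zeta>)" by (simp add: complex_eq_iff)
  thus ?thesis by (simp only: exp_add exp_of_real emod_def cis_conv_exp)
qed

lemma fibre_Cover: assumes "R \<ge> 1" "\<bar>2 * Re \<zeta>\<bar> < strip_width" shows "fibre R \<zeta> \<in> Cover"
proof -
  have "cos (pi / 3) < cos \<bar>2 * Re \<zeta>\<bar>"
    by (rule cos_monotone_0_pi) (use assms strip_width pi_gt3 in auto)
  hence c: "1 / 2 < cos (2 * Re \<zeta>)" by (simp add: cos_60)
  hence "emod \<zeta> * 1 < emod \<zeta> * (2 * cos (2 * Re \<zeta>))" by (intro mult_strict_left_mono) auto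
  also have "\<dots> * 1 \<le> \<dots> * R" by (rule mult_left_mono) (use assms c in auto)
  finally have "emod \<zeta> < 2 * Re (exp (2 * \<i> * \<zeta>) * of_real R)" by (simp add: exp_2i)
  thus ?thesis unfolding fibre_def using assms strip_width by (subst Cover_flat) auto
qed

lemma wcoord_fibre: "R \<noteq> 0 \<Longrightarrow> wcoord (fibre R \<zeta>) = 1 / of_real R"
  by (simp add: wcoord_def fibre_def)

lemma fibre_shift: "fibre R (\<zeta> + 2 * pi * of_int k * \<i>) = Rot (2 * pi * of_int k) (fibre R \<zeta>)"
proof -
  have "2 * \<i> * (\<zeta> + 2 * pi * of_int k * \<i>) = 2 * \<i> * \<zeta> + of_real (- 2 * (2 * pi * of_int k))"
    by (simp add: complex_eq_iff)
  hence "exp (2 * \<i> * (\<zeta> + 2 * pi * of_int k * \<i>)) = exp (2 * \<i> * \<zeta>) * of_real (exp (- 2 * (2 * pi * of_int k)))"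
    by (simp only: exp_add exp_of_real)
  thus ?thesis by (simp add: fibre_def Rot_def)
qed

definition fibre_strip :: "complex set" where "fibre_strip = {\<zeta>. \<bar>2 * Re \<zeta>\<bar> < strip_width}"

lemma fibre_strip: "open fibre_strip" "convex fibre_strip" "connected fibre_strip"
proof -
  show "open fibre_strip" "convex fibre_strip"
    using open_convex_vertical_strip[of 0 strip_width] by (simp_all add: fibre_strip_def)
  thus "connected fibre_strip" using convex_connected by blast
qed

lemma fibre_hol:
  assumes "hol2 \<Phi> Cover" "R \<ge> 1" shows "(\<lambda>\<zeta>. \<Phi> (fibre R \<zeta>)) holomorphic_on fibre_strip"
  unfolding fibre_def
  by (rule hol2_curve[OF assms(1) fibre_strip(1)])
     (use fibre_Cover[OF assms(2)] in \<open>auto simp: fibre_def fibre_strip_def intro!: holomorphic_intros\<close>)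

text \<open>Automorphisms are proper: if the images converged inside the domain, then so would the points
themselves by continuity of the inverse, while \<open>w\<close> tends to \<open>0\<close>. The images in the covering
may drift along the deck group, so they are first moved back next to a fixed lift of the
limit.\<close>
lemma L_no_interior_limit:
  assumes p: "\<And>k::nat. p k \<in> Cover" and w: "(\<lambda>k. wcoord (p k)) \<longlonglongrightarrow> 0"
    and z: "(\<lambda>k. exp (fst (L (p k)))) \<longlonglongrightarrow> z" and w': "(\<lambda>k. wcoord (L (p k))) \<longlonglongrightarrow> w'"
  shows "(z, w') \<notin> worm_domain \<eta>"
proof
  assume W: "(z, w') \<in> worm_domain \<eta>"
  have nz: "z \<noteq> 0" "w' \<noteq> 0" using worm_nz[OF W] by auto
  define x where "x = Ln z"
  have ex: "exp x = z" using nz by (simp add: x_def)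
  define q where "q = (x, exp (2 * \<i> * x) / w')"
  have q: "q \<in> Cover" unfolding q_def by (rule worm_point_lift(1)[OF W ex])
  \<comment> \<open>logarithms of the image coordinates, chosen close to \<open>x\<close>\<close>
  define y where "y = (\<lambda>k. x + Ln (exp (fst (L (p k))) / z))"
  have "(\<lambda>k. exp (fst (L (p k))) / z) \<longlonglongrightarrow> z / z" by (intro tendsto_divide z tendsto_const nz)
  hence "(\<lambda>k. Ln (exp (fst (L (p k))) / z)) \<longlonglongrightarrow> Ln 1"
    using nz by (intro tendsto_Ln) auto
  hence y: "y \<longlonglongrightarrow> x" unfolding y_def by (auto intro: tendsto_eq_intros)
  have ey: "exp (y k) = exp (fst (L (p k)))" for k
    using nz by (simp add: y_def exp_add ex)
  define r where "r = (\<lambda>k. (y k, exp (2 * \<i> * y k) / wcoord (L (p k))))"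
  have rq: "r \<longlonglongrightarrow> q" unfolding r_def q_def
    by (intro tendsto_intros y w' nz)
  have prL: "cover_map (L (p k)) = (exp (fst (L (p k))), wcoord (L (p k)))" for k by (simp add: cover_map_def)
  have Wk: "(exp (fst (L (p k))), wcoord (L (p k))) \<in> worm_domain \<eta>" for k
    using cover_map_Cover[OF L_Cover[OF p]] prL by metis
  have rOm: "r k \<in> Cover" and prr: "cover_map (r k) = cover_map (L (p k))" for k
    unfolding r_def prL by (rule worm_point_lift[OF Wk ey])+
  have wr: "wcoord (L' (r k)) = wcoord (p k)" for k
  proof -
    have "snd (r k) \<noteq> 0" "snd (L (p k)) \<noteq> 0"
      using Cover_D(3)[of "fst (r k)" "snd (r k)"] Cover_D(3)[of "fst (L (p k))" "snd (L (p k))"] rOm p by auto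
    then obtain m :: int where "r k = Rot (2 * pi * m) (L (p k))"
      using cover_map_eq_imp_Rot[OF prr] by blast
    hence "L' (r k) = Rot (2 * pi * of_int (n * m)) (p k)"
      using deck_map_Rot_int[OF L' L_Cover[OF p], of m k] L'L[OF p] by simp
    thus ?thesis by simp
  qed
  have "continuous_on Cover (\<lambda>p. wcoord (L' p))"
    by (rule hol2_continuous_on[OF deck_pair.wcoord_L_hol[OF swap]])
  hence "(\<lambda>k. wcoord (L' (r k))) \<longlonglongrightarrow> wcoord (L' q)"
    using continuous_on_tendsto_compose[OF _ rq q] rOm by (auto simp: o_def)
  hence "wcoord (L' q) = 0" using LIMSEQ_unique w unfolding wr by blast
  thus False using Cover_eta_wcoord(3)[OF L'_Cover[OF q]] by simp
qed

text \<open>If the limit were constant, then \<open>exp X\<close> would stay in a disc that does not contain \<open>0\<close>, and \<open>X\<close>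
would return to its initial value along the period \<open>2 \<pi> \<i>\<close>; but it increases by
\<open>2 \<pi> n \<i>\<close>.\<close>
lemma fibre_limit_nonconstant:
  assumes R: "\<And>k. R k \<ge> 1"
    and lim: "\<And>K. compact K \<Longrightarrow> K \<subseteq> fibre_strip \<Longrightarrow> uniform_limit K (\<lambda>k \<zeta>. exp (fst (L (fibre (R k) \<zeta>)))) f sequentially"
    and f: "f 0 \<noteq> 0"
  shows "\<not> f constant_on fibre_strip"
proof
  assume "f constant_on fibre_strip"
  moreover have "0 \<in> fibre_strip" using strip_width by (simp add: fibre_strip_def)
  ultimately obtain c where c: "\<And>\<zeta>. \<zeta> \<in> fibre_strip \<Longrightarrow> f \<zeta> = c" "c \<noteq> 0"
    using f unfolding constant_on_def by auto
  define I where "I = closed_segment 0 (2 * pi * \<i>)"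
  have I: "I \<subseteq> fibre_strip" "compact I" "connected I" "0 \<in> I" "2 * pi * \<i> \<in> I"
  proof -
    show "I \<subseteq> fibre_strip" using strip_width by (auto simp: I_def fibre_strip_def closed_segment_def)
  qed (simp_all add: I_def)
  have "\<forall>\<^sub>F k in sequentially. \<forall>\<zeta>\<in>I. dist (exp (fst (L (fibre (R k) \<zeta>)))) (f \<zeta>) < cmod c"
    using uniform_limitD[OF lim[OF I(2,1)]] c(2) by simp
  then obtain k where "\<And>\<zeta>. \<zeta> \<in> I \<Longrightarrow> dist (exp (fst (L (fibre (R k) \<zeta>)))) (f \<zeta>) < cmod c"
    by (auto simp: eventually_sequentially)
  hence k: "dist (exp (fst (L (fibre (R k) \<zeta>)))) c < cmod c" if "\<zeta> \<in> I" for \<zeta>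
    using c(1) I(1) that by (metis subsetD)
  define x where "x = (\<lambda>\<zeta>. fst (L (fibre (R k) \<zeta>)))"
  define h where "h = (\<lambda>\<zeta>. x \<zeta> - Ln (exp (x \<zeta>) / c))"
  have xc: "continuous_on I x" unfolding x_def
    by (rule continuous_on_subset[OF holomorphic_on_imp_continuous_on[OF fibre_hol[OF X_hol R]] I(1)])
  have pos: "Re (exp (x \<zeta>) / c) > 0" if "\<zeta> \<in> I" for \<zeta>
  proof -
    have "cmod (exp (x \<zeta>) / c - 1) = cmod ((exp (x \<zeta>) - c) / c)" using c(2) by (simp add: diff_divide_distrib)
    also have "\<dots> < 1" using k[OF that] c(2) by (simp add: norm_divide dist_norm x_def)
    finally have "\<bar>Re (exp (x \<zeta>) / c - 1)\<bar> < 1" using abs_Re_le_cmod order_le_less_trans by blast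
    thus ?thesis by simp
  qed
  have hc: "continuous_on I (\<lambda>\<zeta>. h \<zeta> - h 0)"
    unfolding h_def by (intro continuous_intros xc) (use pos c(2) in \<open>auto simp: complex_nonpos_Reals_iff not_le\<close>)
  have eh: "exp (h \<zeta>) = c" for \<zeta>
    using c(2) by (simp add: h_def exp_diff)
  obtain j :: int where j: "\<And>\<zeta>. \<zeta> \<in> I \<Longrightarrow> h \<zeta> - h 0 = 2 * pi * j * \<i>"
    by (rule exp_eq_1_imp_const_int[OF I(3) hc]) (use eh c(2) in \<open>auto simp: exp_diff\<close>)
  have "j = 0" using j[OF I(4)] by simp
  hence h2: "h (2 * pi * \<i>) = h 0" using j[OF I(5)] by simp
  have "fibre (R k) (0 + 2 * pi * of_int 1 * \<i>) = Rot (2 * pi * of_int 1) (fibre (R k) 0)" by (rule fibre_shift)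
  hence "L (fibre (R k) (2 * pi * \<i>)) = Rot (2 * pi * of_int n) (L (fibre (R k) 0))"
    using deck_map_Rot_int[OF L fibre_Cover[OF R], of 0 1 k] strip_width by simp
  hence x2: "x (2 * pi * \<i>) = x 0 + \<i> * (2 * pi * n)" by (simp add: x_def Rot_def)
  hence "x (2 * pi * \<i>) = x 0 + (of_int (2 * n) * pi) * \<i>" by (simp add: mult_ac)
  hence "exp (x (2 * pi * \<i>)) = exp (x 0)" using exp_eq[of "x (2 * pi * \<i>)" "x 0"] by blast
  hence "x (2 * pi * \<i>) = x 0" using h2 by (simp add: h_def)
  thus False using x2 nn by auto
qed

text \<open>By Montel's theorem the restrictions to the fibres \<open>w = 1 / R k\<close> subconverge to a curve
\<open>(F, G)\<close> in the boundary. By Hurwitz's theorem \<open>G\<close> vanishes identically or nowhere, and the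
latter is impossible because there are no nonconstant curves in that part of the boundary.\<close>
lemma fibres_go_to_flat_part:
  assumes R: "\<And>k. R k \<ge> 1" and Rlim: "filterlim R at_top sequentially"
  obtains r :: "nat \<Rightarrow> nat" where "strict_mono r"
    "\<And>K. compact K \<Longrightarrow> K \<subseteq> fibre_strip \<Longrightarrow> uniform_limit K (\<lambda>k \<zeta>. wcoord (L (fibre (R (r k)) \<zeta>))) (\<lambda>_. 0) sequentially"
proof -
  obtain b where b: "b > 0" "\<And>p. p \<in> Cover \<Longrightarrow> \<bar>2 * Re (fst p)\<bar> < b" using Cover_t_bounded by blast
  define f where "f = (\<lambda>k \<zeta>. exp (fst (L (fibre (R k) \<zeta>))))"
  define g where "g = (\<lambda>k \<zeta>. wcoord (L (fibre (R k) \<zeta>)))"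
  have pOm: "fibre (R k) \<zeta> \<in> Cover" if "\<zeta> \<in> fibre_strip" for k \<zeta> using fibre_Cover[OF R] that by (simp add: fibre_strip_def)
  have fhol: "f k holomorphic_on fibre_strip" and ghol: "g k holomorphic_on fibre_strip" for k
    unfolding f_def g_def by (intro fibre_hol[of "\<lambda>p. exp (fst (L p))"] fibre_hol[of "\<lambda>p. wcoord (L p)"] hol2_exp X_hol wcoord_L_hol R)+
  have ub: "\<bar>2 * Re (fst (L (fibre (R k) \<zeta>)))\<bar> < b" if "\<zeta> \<in> fibre_strip" for k \<zeta>
    using b(2)[OF L_Cover[OF pOm[OF that]]] .
  have fb: "exp (- b) \<le> cmod (f k \<zeta>)" "cmod (f k \<zeta>) \<le> exp b" if "\<zeta> \<in> fibre_strip" for k \<zeta>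
    using ub[OF that, of k] b(1) by (auto simp: f_def)
  have gb: "cmod (g k \<zeta>) \<le> 2" if "\<zeta> \<in> fibre_strip" for k \<zeta>
    using Cover_eta_wcoord(2)[OF L_Cover[OF pOm[OF that]]] by (simp add: g_def less_imp_le)
  obtain F r1 where F: "F holomorphic_on fibre_strip" "strict_mono (r1 :: nat \<Rightarrow> nat)"
      "\<And>x. x \<in> fibre_strip \<Longrightarrow> (\<lambda>k. f (r1 k) x) \<longlonglongrightarrow> F x"
      "\<And>K. \<lbrakk>compact K; K \<subseteq> fibre_strip\<rbrakk> \<Longrightarrow> uniform_limit K (f \<circ> r1) F sequentially"
    by (rule Montel[OF fibre_strip(1), of "range f" f]) (use fhol fb in \<open>fastforce+\<close>)
  obtain G r2 where G: "G holomorphic_on fibre_strip" "strict_mono (r2 :: nat \<Rightarrow> nat)"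
      "\<And>x. x \<in> fibre_strip \<Longrightarrow> (\<lambda>k. (g \<circ> r1) (r2 k) x) \<longlonglongrightarrow> G x"
      "\<And>K. \<lbrakk>compact K; K \<subseteq> fibre_strip\<rbrakk> \<Longrightarrow> uniform_limit K ((g \<circ> r1) \<circ> r2) G sequentially"
    by (rule Montel[OF fibre_strip(1), of "range g" "g \<circ> r1"]) (use ghol gb in \<open>fastforce+\<close>)
  define r where "r = r1 \<circ> r2"
  have r: "strict_mono r" unfolding r_def using F(2) G(2) by (rule strict_mono_o)
  have flim: "(\<lambda>k. f (r k) x) \<longlonglongrightarrow> F x" if "x \<in> fibre_strip" for x
    using LIMSEQ_subseq_LIMSEQ[OF F(3)[OF that] G(2)] by (simp add: r_def o_def)
  have glim: "(\<lambda>k. g (r k) x) \<longlonglongrightarrow> G x" if "x \<in> fibre_strip" for x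
    using G(3)[OF that] by (simp add: r_def o_def)
  have Flim': "uniform_limit K (\<lambda>k. f (r1 k)) F sequentially" if "compact K" "K \<subseteq> fibre_strip" for K
    using F(4)[OF that] by (simp add: o_def)
  have Glim': "uniform_limit K (\<lambda>k. g (r k)) G sequentially" if "compact K" "K \<subseteq> fibre_strip" for K
    using G(4)[OF that] by (simp add: o_def r_def)
  have Fnz: "F x \<noteq> 0" if "x \<in> fibre_strip" for x
  proof -
    have "(\<lambda>k. cmod (f (r k) x)) \<longlonglongrightarrow> cmod (F x)" by (intro tendsto_intros flim that)
    hence "exp (- b) \<le> cmod (F x)" by (rule Lim_bounded2) (use fb that in auto)
    thus ?thesis by (auto simp: not_le)
  qed
  have z0: "0 \<in> fibre_strip" using strip_width by (simp add: fibre_strip_def)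
  have G0: "G x = 0" if x: "x \<in> fibre_strip" for x
  proof (rule ccontr)
    assume Gx: "G x \<noteq> 0"
    have gnz: "g (r k) y \<noteq> 0" if "y \<in> fibre_strip" for y k
      using Cover_eta_wcoord(3)[OF L_Cover[OF pOm[OF that]]] by (simp add: g_def)
    have Gnz: "G y \<noteq> 0" if y: "y \<in> fibre_strip" for y
    proof (cases "G constant_on fibre_strip")
      case True
      thus ?thesis using Gx x y unfolding constant_on_def by metis
    next
      case False
      show ?thesis
        by (rule Hurwitz_no_zeros[OF fibre_strip(1,3) _ G(1) Glim' False gnz y]) (use ghol in auto)
    qed
    have nc: "\<not> F constant_on fibre_strip"
      by (rule fibre_limit_nonconstant[of "\<lambda>k. R (r1 k)"])
         (use R Flim' Fnz[OF z0] in \<open>auto simp: f_def\<close>)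
    obtain z where z: "z \<in> fibre_strip" "deriv F z \<noteq> 0"
    proof -
      have "\<exists>z\<in>fibre_strip. deriv F z \<noteq> 0"
      proof (rule ccontr)
        assume "\<not> ?thesis"
        hence "(F has_field_derivative 0) (at z)" if "z \<in> fibre_strip" for z
          using holomorphic_derivI[OF F(1) fibre_strip(1) that] that by metis
        hence "F constant_on fibre_strip"
          using has_field_derivative_0_imp_constant_on[of fibre_strip F] fibre_strip by blast
        thus False using nc by simp
      qed
      thus thesis using that by blast
    qed
    obtain \<xi> where \<xi>: "\<xi> holomorphic_on fibre_strip" "\<And>z. z \<in> fibre_strip \<Longrightarrow> F z = exp (\<xi> z)"
      using contractible_imp_holomorphic_log[OF F(1) convex_imp_contractible[OF fibre_strip(2)] Fnz] by metis
    have \<xi>': "deriv \<xi> z \<noteq> 0"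
    proof
      assume 0: "deriv \<xi> z = 0"
      have "((\<lambda>z. exp (\<xi> z)) has_field_derivative exp (\<xi> z) * deriv \<xi> z) (at z)"
        by (intro DERIV_chain2[OF DERIV_exp] holomorphic_derivI[OF \<xi>(1) fibre_strip(1) z(1)])
      hence "((\<lambda>z. exp (\<xi> z)) has_field_derivative 0) (at z)" using 0 by simp
      hence "(F has_field_derivative 0) (at z)"
        by (rule has_field_derivative_transform_within_open[OF _ fibre_strip(1) z(1)]) (use \<xi>(2) in simp)
      thus False using z(2) DERIV_imp_deriv by blast
    qed
    have bdry: "(cmod (G y))\<^sup>2 - 2 * Re (exp (- \<i> * of_real (2 * Re (\<xi> y))) * G y) + \<eta> (2 * Re (\<xi> y)) = 0"
      if y: "y \<in> fibre_strip" for y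
    proof -
      define t where "t = 2 * Re (\<xi> y)"
      define E where "E = exp (\<i> * of_real t)"
      have lnF: "ln ((cmod (F y))\<^sup>2) = t" using \<xi>(2)[OF y] ln_norm_exp_sq by (simp add: t_def)
      have notW: "(F y, G y) \<notin> worm_domain \<eta>"
      proof (rule L_no_interior_limit[of "\<lambda>k. fibre (R (r k)) y"])
        have "filterlim (\<lambda>k. R (r k)) at_top sequentially"
          using filterlim_compose[OF Rlim filterlim_subseq[OF r]] .
        hence "(\<lambda>k. inverse (R (r k))) \<longlonglongrightarrow> 0" by (rule tendsto_inverse_0_at_top)
        hence "(\<lambda>k. complex_of_real (inverse (R (r k)))) \<longlonglongrightarrow> of_real 0" by (rule tendsto_of_real)
        moreover have "wcoord (fibre (R (r k)) y) = of_real (inverse (R (r k)))" for k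
          using R[of "r k"] wcoord_fibre[of "R (r k)" y] by (simp add: field_simps)
        ultimately show "(\<lambda>k. wcoord (fibre (R (r k)) y)) \<longlonglongrightarrow> 0" by simp
      qed (use pOm[OF y] flim[OF y] glim[OF y] in \<open>auto simp: f_def g_def\<close>)
      have "(\<lambda>k. (cmod (g (r k) y - exp (\<i> * of_real (ln ((cmod (f (r k) y))\<^sup>2)))))\<^sup>2
          - (1 - \<eta> (ln ((cmod (f (r k) y))\<^sup>2)))) \<longlonglongrightarrow> (cmod (G y - E))\<^sup>2 - (1 - \<eta> t)"
        unfolding E_def lnF[symmetric]
        by (intro tendsto_intros flim glim y continuous_on_tendsto_compose[OF eta_cont[of UNIV]])
           (use Fnz y in auto)
      moreover have "(cmod (g (r k) y - exp (\<i> * of_real (ln ((cmod (f (r k) y))\<^sup>2)))))\<^sup>2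
          - (1 - \<eta> (ln ((cmod (f (r k) y))\<^sup>2))) \<le> 0" for k
      proof -
        have "cover_map (L (fibre (R (r k)) y)) \<in> worm_domain \<eta>" by (intro cover_map_Cover L_Cover pOm y)
        thus ?thesis by (simp add: cover_map_def worm_domain_def f_def g_def)
      qed
      ultimately have "(cmod (G y - E))\<^sup>2 - (1 - \<eta> t) \<le> 0" by (intro Lim_bounded) auto
      moreover have "(cmod (G y - E))\<^sup>2 \<ge> 1 - \<eta> t"
        using notW Fnz[OF y] by (simp add: worm_domain_def lnF E_def)
      moreover have "(cmod (G y - E))\<^sup>2 = (cmod (G y))\<^sup>2 - 2 * Re (cnj E * G y) + (cmod E)\<^sup>2"
        unfolding cmod_power2 by (simp add: power2_eq_square algebra_simps)
      moreover have "cmod E = 1" unfolding E_def by (rule norm_exp_i_times)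
      moreover have "cnj E = exp (- \<i> * of_real t)" by (simp add: E_def exp_cnj)
      ultimately show ?thesis by (simp only: t_def[symmetric]) simp
    qed
    obtain m where m: "\<And>x. \<eta> x \<ge> \<eta> (2 * Re (\<xi> z)) + m * (x - 2 * Re (\<xi> z))" "\<eta> (2 * Re (\<xi> z)) = 0 \<Longrightarrow> m = 0"
      using eta_support by blast
    show False
    proof (rule no_analytic_curve_in_worm_boundary[OF fibre_strip(1) z(1) \<xi>(1) G(1) _ bdry[OF z(1)] eta_nonneg m(2) Gnz[OF z(1)] \<xi>'])
      fix y assume y: "y \<in> fibre_strip"
      show "(cmod (G y))\<^sup>2 - 2 * Re (exp (- \<i> * of_real (2 * Re (\<xi> y))) * G y)
          + \<eta> (2 * Re (\<xi> z)) + m * (2 * Re (\<xi> y) - 2 * Re (\<xi> z)) \<le> 0"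
        using bdry[OF y] m(1)[of "2 * Re (\<xi> y)"] by linarith
    qed
  qed
  show thesis
  proof (rule that[OF r])
    fix K assume K: "compact K" "K \<subseteq> fibre_strip"
    have "uniform_limit K (\<lambda>k. g (r k)) (\<lambda>_. 0) sequentially"
    proof (rule uniform_limitI)
      fix e :: real assume "e > 0"
      from uniform_limitD[OF Glim'[OF K] this]
      show "\<forall>\<^sub>F k in sequentially. \<forall>x\<in>K. dist (g (r k) x) 0 < e"
        by eventually_elim (use G0 K(2) in \<open>auto simp: subset_iff\<close>)
    qed
    thus "uniform_limit K (\<lambda>k \<zeta>. wcoord (L (fibre (R (r k)) \<zeta>))) (\<lambda>_. 0) sequentially"
      by (simp add: g_def)
  qed
qed

text \<open>The functions \<open>\<mu> + c/2 \<plusminus> 2 X\<close> and \<open>\<pi>/2 \<plusminus> \<i> Ln Y\<close> have nonnegative real part on the fibre once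
\<open>w\<close> is small on its image, and along \<open>2 \<pi> \<i>\<close> their imaginary parts change by \<open>4 \<pi>\<close> in absolute
value. The estimate on the strip therefore bounds their real parts at \<open>0\<close> from below.\<close>
lemma deep_fibres_nontangential:
  obtains \<epsilon> c \<delta> where "\<epsilon> > 0" "c > 0" "\<delta> > 0"
    "\<And>R. \<lbrakk>R \<ge> 1; \<And>\<zeta>. \<bar>2 * Re \<zeta>\<bar> < strip_width / 2 \<Longrightarrow> cmod (wcoord (L (fibre R \<zeta>))) < \<epsilon>\<rbrakk> \<Longrightarrow>
      \<bar>2 * Re (fst (L (0, of_real R)))\<bar> \<le> \<mu> - c \<and>
      Re (snd (L (0, of_real R))) \<ge> \<delta> * cmod (snd (L (0, of_real R)))"
proof -
  obtain K where K: "K > 0" "\<And>\<phi>. \<lbrakk>\<phi> holomorphic_on {\<zeta>. \<bar>2 * Re \<zeta>\<bar> < strip_width / 2};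
      \<And>\<zeta>. \<bar>2 * Re \<zeta>\<bar> < strip_width / 2 \<Longrightarrow> Re (\<phi> \<zeta>) \<ge> 0\<rbrakk>
      \<Longrightarrow> cmod (\<phi> (2 * pi * \<i>) - \<i> * Im (\<phi> 0)) \<le> Re (\<phi> 0) * K"
    using Re_nonneg_strip_growth[of "strip_width / 2"] strip_width(1) by auto
  define c where "c = 4 * pi / K"
  have c: "c > 0" using K(1) by (simp add: c_def)
  have period: "Re (\<phi> 0) \<ge> c"
    if "\<phi> holomorphic_on {\<zeta>. \<bar>2 * Re \<zeta>\<bar> < strip_width / 2}" "\<And>\<zeta>. \<bar>2 * Re \<zeta>\<bar> < strip_width / 2 \<Longrightarrow> Re (\<phi> \<zeta>) \<ge> 0"
       "\<bar>Im (\<phi> (2 * pi * \<i>)) - Im (\<phi> 0)\<bar> = 4 * pi" for \<phi>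
  proof -
    have "4 * pi \<le> cmod (\<phi> (2 * pi * \<i>) - \<i> * Im (\<phi> 0))"
      using abs_Im_le_cmod[of "\<phi> (2 * pi * \<i>) - \<i> * Im (\<phi> 0)"] that(3) by simp
    also have "\<dots> \<le> Re (\<phi> 0) * K" by (rule K(2)[OF that(1,2)])
    finally show ?thesis using K(1) by (simp add: c_def field_simps)
  qed
  \<comment> \<open>since \<open>\<eta> < 2 |w|\<close> on the domain, \<open>|w| < \<epsilon>\<close> confines \<open>t\<close> to \<open>|t| \<le> \<mu> + c/2\<close>\<close>
  define \<epsilon> where "\<epsilon> = \<eta> (\<mu> + c / 2) / 2"
  have "\<eta> (\<mu> + c / 2) \<noteq> 0" using eta_eq_0[of "\<mu> + c / 2"] c mu by simp
  hence eps: "\<epsilon> > 0" using eta_nonneg[of "\<mu> + c / 2"] by (simp add: \<epsilon>_def)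
  have main: "\<bar>2 * Re (fst (L (0, of_real R)))\<bar> \<le> \<mu> - c / 2 \<and> c \<le> pi / 2 \<and>
      Re (snd (L (0, of_real R))) \<ge> sin c * cmod (snd (L (0, of_real R)))"
    if R: "R \<ge> 1" and small: "\<And>\<zeta>. \<bar>2 * Re \<zeta>\<bar> < strip_width / 2 \<Longrightarrow> cmod (wcoord (L (fibre R \<zeta>))) < \<epsilon>" for R
  proof -
    have sub: "{\<zeta>. \<bar>2 * Re \<zeta>\<bar> < strip_width / 2} \<subseteq> fibre_strip" using strip_width(1) by (auto simp: fibre_strip_def)
    have pOm: "fibre R \<zeta> \<in> Cover" if "\<bar>2 * Re \<zeta>\<bar> < strip_width / 2" for \<zeta>
      using fibre_Cover[OF R, of \<zeta>] that strip_width(1) by auto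
    have f0: "fibre R 0 = (0, of_real R)" by (simp add: fibre_def)
    have "fibre R (0 + 2 * pi * of_int 1 * \<i>) = Rot (2 * pi * of_int 1) (fibre R 0)" by (rule fibre_shift)
    hence shift: "L (fibre R (2 * pi * \<i>)) = Rot (2 * pi * of_int n) (L (fibre R 0))"
      using deck_map_Rot_int[OF L fibre_Cover[OF R], of 0 1] strip_width by simp
    have n1: "\<bar>real_of_int n\<bar> = 1" using n_cases by auto
    define x y where "x = (\<lambda>\<zeta>. fst (L (fibre R \<zeta>)))" and "y = (\<lambda>\<zeta>. snd (L (fibre R \<zeta>)))"
    have xh: "x holomorphic_on {\<zeta>. \<bar>2 * Re \<zeta>\<bar> < strip_width / 2}" and yh: "y holomorphic_on {\<zeta>. \<bar>2 * Re \<zeta>\<bar> < strip_width / 2}"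
      unfolding x_def y_def
      by (rule holomorphic_on_subset[OF fibre_hol[OF X_hol R] sub] holomorphic_on_subset[OF fibre_hol[OF Y_hol R] sub])+
    have x2: "x (2 * pi * \<i>) = x 0 + \<i> * of_real (2 * pi * n)"
      using shift by (simp add: x_def Rot_def)
    have y2: "y (2 * pi * \<i>) = of_real (exp (- 2 * (2 * pi * n))) * y 0"
      using shift by (simp add: y_def Rot_def)
    have ypos: "Re (y \<zeta>) > 0" if "\<bar>2 * Re \<zeta>\<bar> < strip_width / 2" for \<zeta>
      using Cover_D(2)[of "x \<zeta>" "y \<zeta>"] L_Cover[OF pOm[OF that]] by (simp add: x_def y_def)
    have ub: "\<bar>2 * Re (x \<zeta>)\<bar> \<le> \<mu> + c / 2" if z: "\<bar>2 * Re \<zeta>\<bar> < strip_width / 2" for \<zeta>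
    proof (rule ccontr)
      assume "\<not> ?thesis"
      hence "\<eta> (\<mu> + c / 2) \<le> \<eta> (2 * Re (x \<zeta>))" by (intro eta_mono) (use mu c in auto)
      also have "\<dots> < 2 * cmod (wcoord (L (fibre R \<zeta>)))"
        using Cover_eta_wcoord(1)[OF L_Cover[OF pOm[OF z]]] by (simp add: x_def)
      also have "\<dots> < 2 * \<epsilon>" using small[OF z] by simp
      finally show False by (simp add: \<epsilon>_def)
    qed
    have "c \<le> Re (of_real (\<mu> + c / 2) - 2 * x 0)"
    proof (rule period)
      fix \<zeta> assume "\<bar>2 * Re \<zeta>\<bar> < strip_width / 2"
      from ub[OF this] show "0 \<le> Re (of_real (\<mu> + c / 2) - 2 * x \<zeta>)" by (auto simp: abs_le_iff)
    qed (intro holomorphic_intros xh, use x2 n1 in \<open>simp add: abs_mult\<close>)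
    moreover have "c \<le> Re (of_real (\<mu> + c / 2) + 2 * x 0)"
    proof (rule period)
      fix \<zeta> assume "\<bar>2 * Re \<zeta>\<bar> < strip_width / 2"
      from ub[OF this] show "0 \<le> Re (of_real (\<mu> + c / 2) + 2 * x \<zeta>)" by (auto simp: abs_le_iff)
    qed (intro holomorphic_intros xh, use x2 n1 in \<open>simp add: abs_mult\<close>)
    ultimately have 1: "\<bar>2 * Re (x 0)\<bar> \<le> \<mu> - c / 2" by (auto simp: abs_le_iff)
    have y0: "Re (y 0) > 0" using ypos[of 0] strip_width(1) by simp
    have ylim: "\<bar>Im (Ln (y \<zeta>))\<bar> < pi / 2" if "\<bar>2 * Re \<zeta>\<bar> < strip_width / 2" for \<zeta>
      using ypos[OF that] by (subst Re_Ln_pos_lt_imp) auto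
    have y0': "y 0 \<noteq> 0" using y0 by auto
    have Ln2: "Re (Ln (y (2 * pi * \<i>))) = Re (Ln (y 0)) - 4 * pi * n"
    proof -
      have "y (2 * pi * \<i>) \<noteq> 0" using y2 y0' by simp
      hence "Re (Ln (y (2 * pi * \<i>))) = ln (cmod (y (2 * pi * \<i>)))" by simp
      also have "cmod (y (2 * pi * \<i>)) = exp (- 2 * (2 * pi * n)) * cmod (y 0)"
        unfolding y2 norm_mult norm_of_real by simp
      also have "ln \<dots> = - 2 * (2 * pi * n) + ln (cmod (y 0))"
        using y0' by (subst ln_mult) auto
      finally show ?thesis using y0' by simp
    qed
    have lh: "(\<lambda>\<zeta>. Ln (y \<zeta>)) holomorphic_on {\<zeta>. \<bar>2 * Re \<zeta>\<bar> < strip_width / 2}"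
      by (intro holomorphic_on_Ln' yh) (use ypos in \<open>force simp: complex_nonpos_Reals_iff\<close>)
    have n4: "\<bar>4 * pi * real_of_int n\<bar> = 4 * pi" using n1 by (simp add: abs_mult)
    have "c \<le> Re (of_real (pi / 2) - \<i> * Ln (y 0))"
    proof (rule period)
      fix \<zeta> assume "\<bar>2 * Re \<zeta>\<bar> < strip_width / 2"
      from ylim[OF this] show "0 \<le> Re (of_real (pi / 2) - \<i> * Ln (y \<zeta>))" by simp
    qed (intro holomorphic_intros lh, use Ln2 n4 in simp)
    moreover have "c \<le> Re (of_real (pi / 2) + \<i> * Ln (y 0))"
    proof (rule period)
      fix \<zeta> assume "\<bar>2 * Re \<zeta>\<bar> < strip_width / 2"
      from ylim[OF this] show "0 \<le> Re (of_real (pi / 2) + \<i> * Ln (y \<zeta>))" by simp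
    qed (intro holomorphic_intros lh, use Ln2 n4 in simp)
    ultimately have a: "\<bar>Im (Ln (y 0))\<bar> \<le> pi / 2 - c" by (auto simp: abs_le_iff)
    have c2: "c \<le> pi / 2" using a by linarith
    have "sin c = cos (pi / 2 - c)" by (simp add: cos_sin_eq)
    also have "\<dots> \<le> cos \<bar>Im (Ln (y 0))\<bar>" by (rule cos_monotone_0_pi_le) (use a c in auto)
    finally have s: "sin c \<le> cos (Im (Ln (y 0)))" by simp
    have "Re (y 0) = Re (exp (Ln (y 0)))" using y0' by simp
    also have "\<dots> = cmod (y 0) * cos (Im (Ln (y 0)))"
      unfolding Re_exp using y0' by simp
    finally have "Re (y 0) = cmod (y 0) * cos (Im (Ln (y 0)))" .
    hence 2: "Re (y 0) \<ge> sin c * cmod (y 0)" using mult_left_mono[OF s, of "cmod (y 0)"] by (simp add: mult.commute)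
    show ?thesis using 1 2 c2 by (simp add: x_def y_def f0)
  qed
  show thesis
  proof (cases "c \<le> pi / 2")
    case True
    hence "sin c > 0" using c by (intro sin_gt_zero) auto
    thus thesis using that[of \<epsilon> "c / 2" "sin c"] eps c main by auto
  next
    case False
    thus thesis using that[of \<epsilon> "c / 2" 1] eps c main by (metis half_gt_zero zero_less_one)
  qed
qed

text \<open>Along this sequence both the points \<open>(0, R k)\<close> and their images approach the flat annulus
nontangentially, and the images stay away from its two edges.\<close>
lemma nontangential_sequence:
  obtains R :: "nat \<Rightarrow> real" and c \<delta> where "c > 0" "\<delta> > 0" "\<And>k. R k \<ge> 1" "filterlim R at_top sequentially"
    "(\<lambda>k. wcoord (L (0, of_real (R k)))) \<longlonglongrightarrow> 0"
    "\<And>k. \<bar>2 * Re (fst (L (0, of_real (R k))))\<bar> \<le> \<mu> - c"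
    "\<And>k. Re (snd (L (0, of_real (R k)))) \<ge> \<delta> * cmod (snd (L (0, of_real (R k))))"
proof -
  obtain \<epsilon> c \<delta> where ecd: "\<epsilon> > 0" "c > 0" "\<delta> > 0"
    "\<And>R. \<lbrakk>R \<ge> 1; \<And>\<zeta>. \<bar>2 * Re \<zeta>\<bar> < strip_width / 2 \<Longrightarrow> cmod (wcoord (L (fibre R \<zeta>))) < \<epsilon>\<rbrakk> \<Longrightarrow>
      \<bar>2 * Re (fst (L (0, of_real R)))\<bar> \<le> \<mu> - c \<and>
      Re (snd (L (0, of_real R))) \<ge> \<delta> * cmod (snd (L (0, of_real R)))"
    using deep_fibres_nontangential by blast
  define S where "S = (\<lambda>k. real (Suc k))"
  have S1: "S k \<ge> 1" for k by (simp add: S_def)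
  have Slim: "filterlim S at_top sequentially"
    unfolding S_def by (rule filterlim_compose[OF filterlim_real_sequentially filterlim_Suc])
  obtain r :: "nat \<Rightarrow> nat" where r: "strict_mono r"
    "\<And>K. compact K \<Longrightarrow> K \<subseteq> fibre_strip \<Longrightarrow> uniform_limit K (\<lambda>k \<zeta>. wcoord (L (fibre (S (r k)) \<zeta>))) (\<lambda>_. 0) sequentially"
    using fibres_go_to_flat_part[of S] S1 Slim by blast
  \<comment> \<open>one period of the smaller strip: \<open>w\<close> of the image is periodic, so smallness on \<open>K\<close> suffices\<close>
  define K where "K = cbox (Complex (- strip_width / 4) 0) (Complex (strip_width / 4) (2 * pi))"
  have K: "compact K" "K \<subseteq> fibre_strip"
    using strip_width(1) by (auto simp: K_def fibre_strip_def in_cbox_complex_iff)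
  have lim0: "(\<lambda>k. wcoord (L (fibre (S (r k)) 0))) \<longlonglongrightarrow> 0"
    by (rule tendsto_uniform_limitI[OF r(2)[OF K]]) (use strip_width(1) in \<open>simp add: K_def in_cbox_complex_iff\<close>)
  obtain N where N: "\<And>k \<zeta>. k \<ge> N \<Longrightarrow> \<zeta> \<in> K \<Longrightarrow> cmod (wcoord (L (fibre (S (r k)) \<zeta>))) < \<epsilon>"
    using uniform_limitD[OF r(2)[OF K] ecd(1)] by (auto simp: eventually_sequentially dist_norm)
  have small: "cmod (wcoord (L (fibre (S (r k)) \<zeta>))) < \<epsilon>" if k: "k \<ge> N" and z: "\<bar>2 * Re \<zeta>\<bar> < strip_width / 2" for k \<zeta>
  proof -
    define j where "j = \<lfloor>Im \<zeta> / (2 * pi)\<rfloor>"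
    define \<xi> where "\<xi> = \<zeta> - 2 * pi * of_int j * \<i>"
    have "of_int j \<le> Im \<zeta> / (2 * pi)" "Im \<zeta> / (2 * pi) \<le> of_int j + 1" unfolding j_def by linarith+
    hence "0 \<le> Im \<xi>" "Im \<xi> \<le> 2 * pi" by (auto simp: \<xi>_def field_simps)
    hence xiK: "\<xi> \<in> K" using z by (auto simp: K_def in_cbox_complex_iff \<xi>_def)
    have "fibre (S (r k)) \<zeta> = Rot (2 * pi * of_int j) (fibre (S (r k)) \<xi>)"
      unfolding fibre_shift[symmetric] by (simp add: \<xi>_def)
    moreover have "fibre (S (r k)) \<xi> \<in> Cover" using xiK K(2) fibre_Cover[OF S1] by (auto simp: fibre_strip_def)
    ultimately have "wcoord (L (fibre (S (r k)) \<zeta>)) = wcoord (L (fibre (S (r k)) \<xi>))" using wcoord_L_Rot by metis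
    thus ?thesis using N[OF k xiK] by simp
  qed
  define R where "R = (\<lambda>k. S (r (k + N)))"
  have f0: "fibre (R k) 0 = (0, of_real (R k))" for k by (simp add: fibre_def)
  show thesis
  proof (rule that[of c \<delta> R])
    have "strict_mono (\<lambda>k. r (k + N))" using r(1) by (simp add: strict_mono_def)
    thus "filterlim R at_top sequentially"
      unfolding R_def by (intro filterlim_compose[OF Slim filterlim_subseq])
    show "(\<lambda>k. wcoord (L (0, of_real (R k)))) \<longlonglongrightarrow> 0"
      using LIMSEQ_ignore_initial_segment[OF lim0, of N] by (simp add: fibre_def R_def)
  qed (use ecd(2,3) S1 ecd(4)[OF S1 small] in \<open>auto simp: R_def\<close>)
qed

end

section \<open>Angular derivatives along the flat part\<close>

text \<open>A bound on the hyperbolic distance of two points of the right half-plane, in the form in which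
Harnack's inequality supplies it.\<close>
definition Harnack_close :: "real \<Rightarrow> complex \<Rightarrow> complex \<Rightarrow> bool" where
  "Harnack_close K a b \<longleftrightarrow> cmod (a - \<i> * Im b) \<le> Re b * K"

lemma Harnack_close_Re: "Harnack_close K a b \<Longrightarrow> Re a \<le> Re b * K"
  unfolding Harnack_close_def using complex_Re_le_cmod[of "a - \<i> * Im b"] by simp

lemma Harnack_close_Im: "Harnack_close K a b \<Longrightarrow> \<bar>Im a - Im b\<bar> \<le> Re b * K"
  unfolding Harnack_close_def using abs_Im_le_cmod[of "a - \<i> * Im b"] by simp

lemma Harnack_close_norm: assumes "Harnack_close K a b" "K \<ge> 0" shows "cmod a \<le> (1 + K) * cmod b"
proof -
  have "cmod a \<le> cmod (a - \<i> * Im b) + \<bar>Im b\<bar>"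
    using norm_triangle_ineq[of "a - \<i> * Im b" "\<i> * Im b"] by (simp add: norm_mult)
  also have "\<dots> \<le> cmod b * K + cmod b"
    using assms abs_Im_le_cmod[of b] mult_right_mono[OF complex_Re_le_cmod[of b] assms(2)]
    unfolding Harnack_close_def by linarith
  finally show ?thesis by (simp add: algebra_simps)
qed

lemma Harnack_close_mono: "Harnack_close K a b \<Longrightarrow> K \<le> K' \<Longrightarrow> Re b \<ge> 0 \<Longrightarrow> Harnack_close K' a b"
  unfolding Harnack_close_def by (meson mult_left_mono order_trans)

lemma Harnack_close_trans:
  assumes ab: "Harnack_close K a b" and bc: "Harnack_close K' b c" and K: "K \<ge> 0"
  shows "Harnack_close (K * K' + K') a c"
proof -
  have "cmod (a - \<i> * Im c) \<le> cmod (a - \<i> * Im b) + \<bar>Im b - Im c\<bar>"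
  proof -
    have "a - \<i> * Im c = (a - \<i> * Im b) + \<i> * of_real (Im b - Im c)" by (simp add: algebra_simps)
    moreover have "cmod (\<i> * of_real (Im b - Im c)) = \<bar>Im b - Im c\<bar>" by (simp only: norm_mult norm_of_real) simp
    ultimately show ?thesis by (metis norm_triangle_ineq)
  qed
  also have "\<dots> \<le> Re b * K + Re c * K'"
    using ab Harnack_close_Im[OF bc] unfolding Harnack_close_def by linarith
  also have "Re b * K \<le> (Re c * K') * K" by (rule mult_right_mono[OF Harnack_close_Re[OF bc] K])
  finally show ?thesis unfolding Harnack_close_def by (simp add: algebra_simps)
qed

text \<open>The two points are joined by a path that first moves \<open>V\<close> to \<open>|V|\<close> inside a half-plane and then moves
the other coordinate through two discs, so the constant depends only on the opening \<open>\<delta>\<close> of the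
sector that contains \<open>V\<close>.\<close>
lemma Harnack_product:
  assumes \<Phi>: "hol2 \<Phi> S" and S: "\<And>\<zeta> V. dist \<zeta>0 \<zeta> < 4 * \<rho> \<Longrightarrow> Re V > M \<Longrightarrow> (\<zeta>, V) \<in> S \<and> Re (\<Phi> (\<zeta>, V)) \<ge> 0"
    and \<rho>: "\<rho> > 0" and M: "M \<ge> 0" and \<delta>: "\<delta> > 0"
    and V: "Re V \<ge> \<delta> * cmod V" "\<delta> * cmod V > 2 * M"
    and z: "dist \<zeta>0 \<zeta> \<le> \<rho>" "dist \<zeta>0 \<xi> \<le> \<rho>"
  shows "Harnack_close (12 * (36 / \<delta>) + 12 + 36 / \<delta>) (\<Phi> (\<zeta>, V)) (\<Phi> (\<xi>, of_real (cmod V)))"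
    and "Harnack_close (12 * (36 / \<delta>) + 12 + 36 / \<delta>) (\<Phi> (\<xi>, of_real (cmod V))) (\<Phi> (\<zeta>, V))"
proof -
  define R where "R = cmod V"
  define k where "k = 36 / \<delta>"
  have k: "k > 0" using \<delta> by (simp add: k_def)
  have R0: "R > 0" using V M \<delta> by (auto simp: R_def zero_less_mult_iff intro: le_less_trans)
  have d1: "\<delta> \<le> 1"
  proof -
    have "\<delta> * R \<le> 1 * R" using V(1) complex_Re_le_cmod[of V] by (simp add: R_def)
    thus ?thesis using R0 by simp
  qed
  have dR: "\<delta> * R \<le> R" using d1 R0 by simp
  have RM: "2 * M < R" "M < Re V" using V dR M by (auto simp: R_def)
  have pos: "Re (\<Phi> (x, W)) \<ge> 0" if "dist \<zeta>0 x < 4 * \<rho>" "Re W > M" for x W using S that by blast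
  have centre: "Harnack_close 3 (\<Phi> (x, of_real R)) (\<Phi> (y, of_real R))"
    if "dist y x \<le> \<rho>" "dist \<zeta>0 y \<le> \<rho>" for x y
    unfolding Harnack_close_def
  proof (rule Re_nonneg_disc_growth[of "\<lambda>x. \<Phi> (x, of_real R)" y "2 * \<rho>"])
    have *: "dist \<zeta>0 w < 4 * \<rho>" if "w \<in> ball y (2 * \<rho>)" for w
      using that \<open>dist \<zeta>0 y \<le> \<rho>\<close> dist_triangle[of \<zeta>0 w y] \<rho> by (simp add: dist_commute)
    show "(\<lambda>x. \<Phi> (x, of_real R)) holomorphic_on ball y (2 * \<rho>)"
      by (rule hol2_slice1[OF \<Phi>]) (use S * RM M in auto)
    show "0 \<le> Re (\<Phi> (w, of_real R))" if "w \<in> ball y (2 * \<rho>)" for w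
      using pos[OF *[OF that]] RM M by simp
  qed (use that \<rho> in auto)
  have half: "Harnack_close k (\<Phi> (x, W)) (\<Phi> (x, U))"
    if x: "dist \<zeta>0 x \<le> \<rho>" and WU: "Re W \<ge> \<delta> * R" "Re U \<ge> \<delta> * R" "cmod W \<le> R" "cmod U \<le> R"
       "Re W \<ge> R \<or> Re U \<ge> R" for x W U
  proof -
    have xr: "dist \<zeta>0 x < 4 * \<rho>" using x \<rho> by simp
    have gt: "Re W > M" "Re U > M" using WU V M by (auto simp: R_def)
    have h: "cmod (\<Phi> (x, W) - \<i> * Im (\<Phi> (x, U)))
      \<le> Re (\<Phi> (x, U)) * ((cmod (W + cnj U - 2 * M))\<^sup>2 / ((Re W - M) * (Re U - M)))"
    proof (rule Re_nonneg_halfplane_growth[of "\<lambda>W. \<Phi> (x, W)" M])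
      have "open {V. M < Re V}" by (rule open_halfspace_Re_gt)
      thus "(\<lambda>W. \<Phi> (x, W)) holomorphic_on {V. M < Re V}"
        by (intro hol2_slice2[OF \<Phi>]) (use S xr in auto)
    qed (use pos xr gt in auto)
    have "(cmod (W + cnj U - 2 * M))\<^sup>2 / ((Re W - M) * (Re U - M)) \<le> (3 * R)\<^sup>2 / (\<delta> * R / 2 * (R / 2))"
    proof (intro frac_le power_mono)
      have "cmod (W + cnj U - 2 * M) \<le> cmod W + cmod (cnj U) + cmod (of_real (2 * M) :: complex)"
        using norm_triangle_ineq4[of "W + cnj U" "of_real (2 * M)"] norm_triangle_ineq[of W "cnj U"] by simp
      also have "\<dots> \<le> 3 * R" using WU RM M by simp
      finally show "cmod (W + cnj U - 2 * M) \<le> 3 * R" .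
      show "0 < \<delta> * R / 2 * (R / 2)" using \<delta> R0 by simp
      have a: "Re W - M \<ge> \<delta> * R / 2" "Re U - M \<ge> \<delta> * R / 2" using WU V by (auto simp: R_def)
      from WU(5) show "\<delta> * R / 2 * (R / 2) \<le> (Re W - M) * (Re U - M)"
      proof
        assume "Re W \<ge> R"
        hence "R / 2 \<le> Re W - M" using RM by simp
        from mult_mono[OF this a(2)] show ?thesis using \<delta> R0 RM gt by (simp add: mult.commute)
      next
        assume "Re U \<ge> R"
        hence "R / 2 \<le> Re U - M" using RM by simp
        from mult_mono[OF a(1) this] show ?thesis using \<delta> R0 RM gt by (simp add: mult.commute)
      qed
    qed (use R0 in auto)
    also have "\<dots> = k" using R0 \<delta> by (simp add: k_def field_simps power2_eq_square)
    finally have "Re (\<Phi> (x, U)) * ((cmod (W + cnj U - 2 * M))\<^sup>2 / ((Re W - M) * (Re U - M))) \<le> Re (\<Phi> (x, U)) * k"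
      by (intro mult_left_mono pos xr gt)
    thus ?thesis using h unfolding Harnack_close_def by linarith
  qed
  have c1: "Harnack_close 12 (\<Phi> (x, of_real R)) (\<Phi> (y, of_real R))" if "dist \<zeta>0 x \<le> \<rho>" "dist \<zeta>0 y \<le> \<rho>" for x y
    using Harnack_close_trans[OF centre[of \<zeta>0 x] centre[of y \<zeta>0]] that \<rho> by (simp add: dist_commute)
  have h1: "Harnack_close k (\<Phi> (\<zeta>, V)) (\<Phi> (\<zeta>, of_real R))"
    by (rule half) (use z V R0 dR in \<open>auto simp: R_def\<close>)
  have h2: "Harnack_close k (\<Phi> (\<zeta>, of_real R)) (\<Phi> (\<zeta>, V))"
    by (rule half) (use z V R0 dR in \<open>auto simp: R_def\<close>)
  have zr: "dist \<zeta>0 \<zeta> < 4 * \<rho>" "dist \<zeta>0 \<xi> < 4 * \<rho>" using z \<rho> by auto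
  have "Harnack_close (k * 12 + 12) (\<Phi> (\<zeta>, V)) (\<Phi> (\<xi>, of_real R))"
    using Harnack_close_trans[OF h1 c1[OF z]] k by simp
  thus "Harnack_close (12 * (36 / \<delta>) + 12 + 36 / \<delta>) (\<Phi> (\<zeta>, V)) (\<Phi> (\<xi>, of_real (cmod V)))"
    unfolding k_def[symmetric] R_def[symmetric]
    by (rule Harnack_close_mono) (use k pos[OF zr(2)] RM M in auto)
  have "Harnack_close (12 * k + k) (\<Phi> (\<xi>, of_real R)) (\<Phi> (\<zeta>, V))"
    using Harnack_close_trans[OF c1[OF z(2,1)] h2] by simp
  thus "Harnack_close (12 * (36 / \<delta>) + 12 + 36 / \<delta>) (\<Phi> (\<xi>, of_real (cmod V))) (\<Phi> (\<zeta>, V))"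
    unfolding k_def[symmetric] R_def[symmetric]
    by (rule Harnack_close_mono) (use k pos[OF zr(1)] RM in auto)
qed

lemma holomorphic_real_valued_constant:
  assumes hol: "g holomorphic_on S" and S: "open S" "connected S" and re: "\<And>z. z \<in> S \<Longrightarrow> Im (g z) = 0"
  shows "g constant_on S"
proof (rule has_field_derivative_0_imp_constant_on[OF _ S(2,1)])
  fix z assume z: "z \<in> S"
  define P where "P = (\<lambda>z. exp (\<i> * g z))"
  have "cmod (deriv P z) = cmod (deriv (\<lambda>z. 0) z)"
  proof (rule norm_sq_diff_eq_Re[OF S(1) z, where G = "\<lambda>z. 1"])
    show "P holomorphic_on S" unfolding P_def by (intro holomorphic_intros hol)
  qed (use re in \<open>auto simp: P_def\<close>)
  moreover have dg: "(g has_field_derivative deriv g z) (at z)" by (rule holomorphic_derivI[OF hol S(1) z])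
  have "deriv P z = exp (\<i> * g z) * (\<i> * deriv g z)"
    unfolding P_def by (rule DERIV_imp_deriv) (auto intro!: derivative_eq_intros dg)
  ultimately have "deriv g z = 0" by simp
  thus "(g has_field_derivative 0) (at z)" using dg by simp
qed

context deck_pair
begin

text \<open>For fixed \<open>\<zeta>\<close> the function \<open>Y(\<zeta>, R) / R\<close> tends to a nonnegative real number. As a function of
\<open>\<zeta>\<close> the limit is holomorphic, so near \<open>\<zeta>0\<close> it is a constant \<open>lam\<close>. The first conclusion
transfers the limit from the real ray to the given sequence by Harnack's inequality. The second
one is Julia's inequality for \<open>2 Y - c exp (2 \<i> X)\<close>, \<open>|c| = 1\<close>, whose real part is positive on
the covering; along the ray the exponential is \<open>o(R)\<close> because the images tend to \<open>w = 0\<close>, so its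
angular derivative is still \<open>2 lam\<close>.\<close>
lemma Julia_Wolff:
  assumes z: "\<zeta>s \<longlonglongrightarrow> \<zeta>0" "\<bar>2 * Re \<zeta>0\<bar> < \<mu>"
    and V: "filterlim (\<lambda>k. cmod (Vs k)) at_top sequentially" "\<And>k. Re (Vs k) \<ge> \<delta> * cmod (Vs k)" "\<delta> > 0"
    and Cover: "\<And>k::nat. (\<zeta>s k, Vs k) \<in> Cover" and w: "(\<lambda>k. wcoord (L (\<zeta>s k, Vs k))) \<longlonglongrightarrow> 0"
  obtains lam r where "lam \<ge> 0" "r > 0"
    "\<And>\<epsilon>. \<epsilon> > 0 \<Longrightarrow> \<forall>\<^sub>F k in sequentially. Re (snd (L (\<zeta>s k, Vs k))) \<le> lam * Re (Vs k) + \<epsilon> * cmod (Vs k)"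
    "\<And>\<zeta> V. \<lbrakk>dist \<zeta>0 \<zeta> < r; 2 * Re V > emod \<zeta>\<rbrakk> \<Longrightarrow>
       Re (snd (L (\<zeta>, V))) - emod (fst (L (\<zeta>, V))) / 2 \<ge> lam * (Re V - emod \<zeta> / 2)"
proof -
  obtain b where b: "b > 0" "\<And>p. p \<in> Cover \<Longrightarrow> \<bar>2 * Re (fst p)\<bar> < b" using Cover_t_bounded by blast
  define \<rho>1 where "\<rho>1 = (\<mu> - \<bar>2 * Re \<zeta>0\<bar>) / 8"
  have \<rho>1: "\<rho>1 > 0" using z(2) by (simp add: \<rho>1_def)
  \<comment> \<open>a half-plane \<open>Re V > M\<close> that lies in all slices over the disc of radius \<open>4 \<rho>1\<close>\<close>
  define M where "M = emod \<zeta>0 * exp (8 * \<rho>1) / 2"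
  have M: "M > 0" by (simp add: M_def)
  have flat: "\<bar>2 * Re \<zeta>\<bar> \<le> \<mu>" and eM: "emod \<zeta> / 2 \<le> M" if "dist \<zeta>0 \<zeta> < 4 * \<rho>1" for \<zeta>
  proof -
    have "\<bar>Re \<zeta>0 - Re \<zeta>\<bar> < 4 * \<rho>1" "\<bar>Im \<zeta>0 - Im \<zeta>\<bar> < 4 * \<rho>1"
      using that abs_Re_le_cmod[of "\<zeta>0 - \<zeta>"] abs_Im_le_cmod[of "\<zeta>0 - \<zeta>"] by (auto simp: dist_norm)
    note d = this
    from d(1) show "\<bar>2 * Re \<zeta>\<bar> \<le> \<mu>" by (simp add: \<rho>1_def abs_if split: if_splits)
    have "emod \<zeta> \<le> exp (- 2 * Im \<zeta>0 + 8 * \<rho>1)" using d(2) by (simp add: emod_def)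
    also have "\<dots> = 2 * M" unfolding M_def emod_def exp_add by simp
    finally show "emod \<zeta> / 2 \<le> M" by simp
  qed
  have inOm: "(\<zeta>, V) \<in> Cover" if "dist \<zeta>0 \<zeta> < 4 * \<rho>1" "2 * Re V > emod \<zeta>" for \<zeta> V
    using Cover_flat[OF flat[OF that(1)]] that(2) by blast
  have inOm': "(\<zeta>, V) \<in> Cover" if "dist \<zeta>0 \<zeta> < 4 * \<rho>1" "Re V > M" for \<zeta> V
    using inOm[OF that(1)] eM[OF that(1)] that(2) by auto
  define Y where "Y = (\<lambda>p. snd (L p))"
  define X where "X = (\<lambda>p. fst (L p))"
  have YX: "2 * Re (Y p) > emod (X p)" "Re (Y p) > 0" if "p \<in> Cover" for p
    using Cover_D[of "X p" "Y p"] L_Cover[OF that] by (auto simp: X_def Y_def)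
  have Yslice: "(\<lambda>V. Y (\<zeta>, V)) holomorphic_on {V. Re V > emod \<zeta> / 2}"
    and Xslice: "(\<lambda>V. X (\<zeta>, V)) holomorphic_on {V. Re V > emod \<zeta> / 2}" if "dist \<zeta>0 \<zeta> < 4 * \<rho>1" for \<zeta>
  proof -
    have r: "(\<zeta>, V) \<in> Cover" if "V \<in> {V. Re V > emod \<zeta> / 2}" for V using inOm[OF \<open>dist \<zeta>0 \<zeta> < 4 * \<rho>1\<close>] that by simp
    show "(\<lambda>V. Y (\<zeta>, V)) holomorphic_on {V. Re V > emod \<zeta> / 2}"
      unfolding Y_def by (rule hol2_slice2[OF Y_hol open_halfspace_Re_gt r])
    show "(\<lambda>V. X (\<zeta>, V)) holomorphic_on {V. Re V > emod \<zeta> / 2}"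
      unfolding X_def by (rule hol2_slice2[OF X_hol open_halfspace_Re_gt r])
  qed
  have "\<forall>\<zeta>\<in>ball \<zeta>0 (4 * \<rho>1). \<exists>l\<ge>0. (\<forall>V. Re V > emod \<zeta> / 2 \<longrightarrow> Re (Y (\<zeta>, V)) \<ge> l * (Re V - emod \<zeta> / 2)) \<and>
     ((\<lambda>R. Y (\<zeta>, of_real R) / of_real R) \<longlongrightarrow> of_real l) at_top"
  proof
    fix \<zeta> assume "\<zeta> \<in> ball \<zeta>0 (4 * \<rho>1)"
    hence d: "dist \<zeta>0 \<zeta> < 4 * \<rho>1" by simp
    have pos: "Re (Y (\<zeta>, V)) \<ge> 0" if "Re V > emod \<zeta> / 2" for V
      using YX(2)[OF inOm[OF d]] that by (simp add: less_imp_le)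
    show "\<exists>l\<ge>0. (\<forall>V. Re V > emod \<zeta> / 2 \<longrightarrow> Re (Y (\<zeta>, V)) \<ge> l * (Re V - emod \<zeta> / 2)) \<and>
     ((\<lambda>R. Y (\<zeta>, of_real R) / of_real R) \<longlongrightarrow> of_real l) at_top"
      using Julia_halfplane[OF Yslice[OF d] pos] by metis
  qed
  from bchoice[OF this] obtain l where l0: "\<forall>\<zeta>\<in>ball \<zeta>0 (4 * \<rho>1). l \<zeta> \<ge> 0 \<and>
     (\<forall>V. Re V > emod \<zeta> / 2 \<longrightarrow> Re (Y (\<zeta>, V)) \<ge> l \<zeta> * (Re V - emod \<zeta> / 2)) \<and>
     ((\<lambda>R. Y (\<zeta>, of_real R) / of_real R) \<longlongrightarrow> of_real (l \<zeta>)) at_top" by blast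
  have l: "\<And>\<zeta>. dist \<zeta>0 \<zeta> < 4 * \<rho>1 \<Longrightarrow> l \<zeta> \<ge> 0"
    "\<And>\<zeta> V. dist \<zeta>0 \<zeta> < 4 * \<rho>1 \<Longrightarrow> Re V > emod \<zeta> / 2 \<Longrightarrow> Re (Y (\<zeta>, V)) \<ge> l \<zeta> * (Re V - emod \<zeta> / 2)"
    "\<And>\<zeta>. dist \<zeta>0 \<zeta> < 4 * \<rho>1 \<Longrightarrow> ((\<lambda>R. Y (\<zeta>, of_real R) / of_real R) \<longlongrightarrow> of_real (l \<zeta>)) at_top"
    using l0 by simp_all
  define S where "S = (\<lambda>k::nat. M + 1 + real k)"
  have S: "S k > M" "S k > 0" for k using M by (auto simp: S_def)
  have Slim: "filterlim S at_top sequentially"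
    unfolding S_def by (rule filterlim_tendsto_add_at_top[OF tendsto_const filterlim_real_sequentially])
  have lconst: "l \<zeta> = l \<zeta>0" if d: "dist \<zeta>0 \<zeta> < \<rho>1" for \<zeta>
  proof -
    define F where "F = (\<lambda>k \<zeta>. Y (\<zeta>, of_real (S k)) / of_real (S k))"
    have Flim: "(\<lambda>k. F k x) \<longlonglongrightarrow> of_real (l x)" if "dist \<zeta>0 x < \<rho>1" for x
      unfolding F_def using filterlim_compose[OF l(3) Slim] that \<rho>1 by auto
    have "Bseq (\<lambda>k. F k \<zeta>0)" using Flim[of \<zeta>0] \<rho>1 by (intro convergent_imp_Bseq convergentI) auto
    then obtain B where B: "\<And>k. cmod (F k \<zeta>0) \<le> B" using BseqE by blast
    have Fb: "cmod (F k x) \<le> 4 * B" if "x \<in> ball \<zeta>0 \<rho>1" for k x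
    proof -
      have "Harnack_close 3 (Y (x, of_real (S k))) (Y (\<zeta>0, of_real (S k)))"
        unfolding Harnack_close_def
      proof (rule Re_nonneg_disc_growth[of "\<lambda>x. Y (x, of_real (S k))" \<zeta>0 "2 * \<rho>1"])
        show "(\<lambda>x. Y (x, of_real (S k))) holomorphic_on ball \<zeta>0 (2 * \<rho>1)"
          unfolding Y_def by (rule hol2_slice1[OF Y_hol]) (use inOm' S \<rho>1 in auto)
        show "0 \<le> Re (Y (w, of_real (S k)))" if "w \<in> ball \<zeta>0 (2 * \<rho>1)" for w
          by (rule less_imp_le, rule YX(2), rule inOm') (use S \<rho>1 that in auto)
      qed (use \<rho>1 that in auto)
      from Harnack_close_norm[OF this] have "cmod (Y (x, of_real (S k))) \<le> 4 * cmod (Y (\<zeta>0, of_real (S k)))" by simp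
      hence "cmod (F k x) \<le> 4 * cmod (F k \<zeta>0)"
        using S(2)[of k] by (simp add: F_def norm_divide divide_right_mono)
      thus ?thesis using B[of k] by linarith
    qed
    have Fhol: "F k holomorphic_on ball \<zeta>0 \<rho>1" for k
    proof -
      have "(\<lambda>x. Y (x, of_real (S k))) holomorphic_on ball \<zeta>0 \<rho>1"
        unfolding Y_def by (rule hol2_slice1[OF Y_hol]) (use inOm' S \<rho>1 in auto)
      thus ?thesis unfolding F_def using S(2)[of k] by (intro holomorphic_intros) auto
    qed
    obtain g r where g: "g holomorphic_on ball \<zeta>0 \<rho>1" "strict_mono (r :: nat \<Rightarrow> nat)"
      "\<And>x. x \<in> ball \<zeta>0 \<rho>1 \<Longrightarrow> (\<lambda>k. F (r k) x) \<longlonglongrightarrow> g x"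
      by (rule Montel[of "ball \<zeta>0 \<rho>1" "range F" F]) (use Fhol Fb in \<open>fastforce+\<close>)
    have gl: "g x = of_real (l x)" if "x \<in> ball \<zeta>0 \<rho>1" for x
    proof (rule LIMSEQ_unique[OF g(3)[OF that]])
      show "(\<lambda>k. F (r k) x) \<longlonglongrightarrow> of_real (l x)"
        using LIMSEQ_subseq_LIMSEQ[OF Flim g(2)] that by (simp add: o_def)
    qed
    have "g constant_on ball \<zeta>0 \<rho>1"
      by (rule holomorphic_real_valued_constant[OF g(1)]) (use gl in auto)
    hence "g \<zeta> = g \<zeta>0" using d \<rho>1 unfolding constant_on_def by auto
    thus ?thesis using gl[of \<zeta>] gl[of \<zeta>0] d \<rho>1 by simp
  qed
  define lam where "lam = l \<zeta>0"
  have lam0: "lam \<ge> 0" using l(1)[of \<zeta>0] \<rho>1 by (simp add: lam_def)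
  define \<rho> where "\<rho> = \<rho>1 / 4"
  have \<rho>: "\<rho> > 0" "4 * \<rho> = \<rho>1" using \<rho>1 by (auto simp: \<rho>_def)
  define K where "K = 12 * (36 / \<delta>) + 12 + 36 / \<delta>"
  have K: "K > 0" using V(3) by (simp add: K_def add_pos_pos)
  define R where "R = (\<lambda>k. cmod (Vs k))"
  have Rlim: "filterlim R at_top sequentially" using V(1) by (simp add: R_def)
  have evR: "\<forall>\<^sub>F k in sequentially. R k > C" for C
    using Rlim by (simp add: filterlim_at_top_dense)
  have evz: "\<forall>\<^sub>F k in sequentially. dist \<zeta>0 (\<zeta>s k) \<le> \<rho>"
    using tendstoD[OF z(1) \<rho>(1)] by eventually_elim (simp add: dist_commute)
  have ev\<delta>: "\<forall>\<^sub>F k in sequentially. \<delta> * R k > 2 * M"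
    using evR[of "2 * M / \<delta>"] by eventually_elim (use V(3) in \<open>simp add: field_simps\<close>)
  have Ylim: "(\<lambda>k. Y (\<zeta>, of_real (R k)) / of_real (R k)) \<longlonglongrightarrow> of_real lam" if "dist \<zeta>0 \<zeta> < \<rho>1" for \<zeta>
    using filterlim_compose[OF l(3) Rlim, of \<zeta>] lconst[OF that] that \<rho>1 by (simp add: lam_def)
  have RlimRe: "(\<lambda>k. Re (Y (\<zeta>, of_real (R k))) / R k) \<longlonglongrightarrow> lam" if "dist \<zeta>0 \<zeta> < \<rho>1" for \<zeta>
    using tendsto_Re[OF Ylim[OF that]] by simp
  have part1: "\<forall>\<^sub>F k in sequentially. Re (Y (\<zeta>s k, Vs k)) \<le> lam * Re (Vs k) + \<epsilon> * cmod (Vs k)" if e: "\<epsilon> > 0" for \<epsilon>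
  proof -
    define Z where "Z = (\<lambda>p. Y p - of_real lam * (snd p - of_real M))"
    have Zh: "hol2 Z Cover" unfolding Z_def Y_def by (intro hol2_intros Y_hol)
    have Zp: "(\<zeta>, V) \<in> Cover \<and> Re (Z (\<zeta>, V)) \<ge> 0" if "dist \<zeta>0 \<zeta> < 4 * \<rho>" "Re V > M" for \<zeta> V
    proof
      have d: "dist \<zeta>0 \<zeta> < \<rho>1" "dist \<zeta>0 \<zeta> < 4 * \<rho>1" using that \<rho> \<rho>1 by auto
      show "(\<zeta>, V) \<in> Cover" by (rule inOm'[OF d(2) that(2)])
      have "lam * (Re V - M) \<le> lam * (Re V - emod \<zeta> / 2)" using eM[OF d(2)] lam0 by (intro mult_left_mono) auto
      also have "\<dots> \<le> Re (Y (\<zeta>, V))"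
        using l(2)[OF d(2)] eM[OF d(2)] that(2) lconst[OF d(1)] by (simp add: lam_def)
      finally show "Re (Z (\<zeta>, V)) \<ge> 0" by (simp add: Z_def)
    qed
    have "(\<lambda>k. Re (Y (\<zeta>0, of_real (R k))) / R k - lam * (1 - M / R k)) \<longlonglongrightarrow> lam - lam * (1 - 0)"
      by (intro tendsto_intros RlimRe tendsto_divide_0[OF tendsto_const]
          filterlim_at_top_imp_at_infinity Rlim) (use \<rho>1 in auto)
    hence "\<forall>\<^sub>F k in sequentially. Re (Y (\<zeta>0, of_real (R k))) / R k - lam * (1 - M / R k) < \<epsilon> / K"
      by (rule order_tendstoD) (use e K in auto)
    thus ?thesis using evR[of 0] evz ev\<delta>
    proof eventually_elim
      case (elim k)
      have "Harnack_close K (Z (\<zeta>s k, Vs k)) (Z (\<zeta>0, of_real (cmod (Vs k))))"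
        unfolding K_def
        by (rule Harnack_product(1)[OF Zh Zp \<rho>(1) _ V(3) V(2)]) (use elim M \<rho> in \<open>auto simp: R_def\<close>)
      from Harnack_close_Re[OF this] have "Re (Z (\<zeta>s k, Vs k)) \<le> Re (Z (\<zeta>0, of_real (R k))) * K" by (simp add: R_def)
      also have "Re (Z (\<zeta>0, of_real (R k))) = (Re (Y (\<zeta>0, of_real (R k))) / R k - lam * (1 - M / R k)) * R k"
        using elim by (simp add: Z_def field_simps)
      also have "\<dots> * K \<le> (\<epsilon> / K * R k) * K"
        using elim K by (intro mult_right_mono) auto
      also have "\<dots> = \<epsilon> * R k" using K by simp
      finally have "Re (Y (\<zeta>s k, Vs k)) \<le> lam * (Re (Vs k) - M) + \<epsilon> * R k" by (simp add: Z_def)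
      also have "\<dots> \<le> lam * Re (Vs k) + \<epsilon> * R k" using lam0 M by (simp add: algebra_simps)
      finally show ?case by (simp add: R_def)
    qed
  qed
  have eX0: "(\<lambda>k. emod (X (\<zeta>, of_real (R k))) / R k) \<longlonglongrightarrow> 0" if d: "dist \<zeta>0 \<zeta> \<le> \<rho>" for \<zeta>
  proof -
    have "Bseq (\<lambda>k. Y (\<zeta>0, of_real (R k)) / of_real (R k))"
      using Ylim[of \<zeta>0] \<rho>1 by (intro convergent_imp_Bseq convergentI) auto
    then obtain C where C: "\<And>k. cmod (Y (\<zeta>0, of_real (R k)) / of_real (R k)) \<le> C" using BseqE by blast
    define C' where "C' = exp (2 * b * K) * ((1 + K) * C)"
    have "\<forall>\<^sub>F k in sequentially. norm (emod (X (\<zeta>, of_real (R k))) / R k) \<le> C' * cmod (wcoord (L (\<zeta>s k, Vs k)))"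
      using evR[of 0] evz ev\<delta>
    proof eventually_elim
      case (elim k)
      define p where "p = (\<zeta>s k, Vs k)"
      have reg: "(x, W) \<in> Cover" if "dist \<zeta>0 x < 4 * \<rho>" "Re W > M" for x W
        using inOm' that \<rho> \<rho>1 by auto
      have Yc: "Harnack_close K (Y p) (Y (\<zeta>0, of_real (cmod (Vs k))))"
        unfolding K_def p_def
      proof (rule Harnack_product(1)[of Y Cover, OF _ _ \<rho>(1) _ V(3) V(2)])
        show "hol2 Y Cover" unfolding Y_def by (rule Y_hol)
        show "(x, W) \<in> Cover \<and> 0 \<le> Re (Y (x, W))" if "dist \<zeta>0 x < 4 * \<rho>" "Re W > M" for x W
          using reg[OF that] YX(2)[OF reg[OF that]] by simp
      qed (use elim M \<rho> in \<open>auto simp: R_def\<close>)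
      have Xc: "Harnack_close K (of_real b - 2 * X (\<zeta>, of_real (cmod (Vs k)))) (of_real b - 2 * X p)"
        unfolding K_def p_def
      proof (rule Harnack_product(2)[of "\<lambda>p. of_real b - 2 * X p" Cover, OF _ _ \<rho>(1) _ V(3) V(2)])
        show "hol2 (\<lambda>p. of_real b - 2 * X p) Cover" unfolding X_def by (intro hol2_intros X_hol)
        show "(x, W) \<in> Cover \<and> 0 \<le> Re (of_real b - 2 * X (x, W))" if "dist \<zeta>0 x < 4 * \<rho>" "Re W > M" for x W
          using reg[OF that] b(2)[OF L_Cover[OF reg[OF that]]] by (auto simp: X_def abs_less_iff)
      qed (use elim M \<rho> d in \<open>auto simp: R_def\<close>)
      have pOm: "p \<in> Cover" using Cover by (simp add: p_def)
      have "\<bar>2 * Im (X p) - 2 * Im (X (\<zeta>, of_real (R k)))\<bar> \<le> Re (of_real b - 2 * X p) * K"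
        using Harnack_close_Im[OF Xc] by (simp add: R_def)
      also have "\<dots> \<le> 2 * b * K"
        using b(2)[OF L_Cover[OF pOm]] K by (intro mult_right_mono) (auto simp: X_def abs_less_iff)
      finally have "- 2 * Im (X (\<zeta>, of_real (R k))) \<le> 2 * b * K + - 2 * Im (X p)" by linarith
      hence "emod (X (\<zeta>, of_real (R k))) \<le> exp (2 * b * K) * emod (X p)" by (simp add: emod_def exp_add[symmetric])
      also have "emod (X p) = cmod (wcoord (L p)) * cmod (Y p)"
        using Cover_D(3)[of "X p" "Y p"] L_Cover[OF pOm] by (simp add: norm_wcoord X_def Y_def)
      also have "exp (2 * b * K) * (cmod (wcoord (L p)) * cmod (Y p))
          \<le> exp (2 * b * K) * (cmod (wcoord (L p)) * ((1 + K) * cmod (Y (\<zeta>0, of_real (R k)))))"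
        using Harnack_close_norm[OF Yc] K by (intro mult_left_mono) (auto simp: R_def)
      also have "cmod (Y (\<zeta>0, of_real (R k))) \<le> C * R k"
        using C[of k] elim by (simp add: norm_divide field_simps)
      hence "exp (2 * b * K) * (cmod (wcoord (L p)) * ((1 + K) * cmod (Y (\<zeta>0, of_real (R k)))))
         \<le> exp (2 * b * K) * (cmod (wcoord (L p)) * ((1 + K) * (C * R k)))"
        using K by (intro mult_left_mono) auto
      finally have "emod (X (\<zeta>, of_real (R k))) \<le> C' * cmod (wcoord (L p)) * R k"
        by (simp add: C'_def mult_ac)
      thus ?case using elim by (simp add: p_def field_simps)
    qed
    moreover have "(\<lambda>k. C' * cmod (wcoord (L (\<zeta>s k, Vs k)))) \<longlonglongrightarrow> C' * cmod 0" by (intro tendsto_intros w)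
    hence "(\<lambda>k. C' * cmod (wcoord (L (\<zeta>s k, Vs k)))) \<longlonglongrightarrow> 0" by simp
    ultimately show ?thesis by (rule Lim_null_comparison)
  qed
  show thesis
  proof (rule that[OF lam0 \<rho>(1)])
    show "\<forall>\<^sub>F k in sequentially. Re (snd (L (\<zeta>s k, Vs k))) \<le> lam * Re (Vs k) + \<epsilon> * cmod (Vs k)" if "\<epsilon> > 0" for \<epsilon>
      using part1[OF that] by (simp add: Y_def)
    fix \<zeta> V0 assume d: "dist \<zeta>0 \<zeta> < \<rho>" and V0: "2 * Re V0 > emod \<zeta>"
    have d': "dist \<zeta>0 \<zeta> < \<rho>1" "dist \<zeta>0 \<zeta> < 4 * \<rho>1" using d \<rho> \<rho>1 by auto
    define E where "E = exp (2 * \<i> * X (\<zeta>, V0))"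
    \<comment> \<open>the phase for which \<open>c exp (2 \<i> X)\<close> is positive at the given point\<close>
    define c where "c = of_real (cmod E) / E"
    have c1: "cmod c = 1" by (simp add: c_def norm_divide E_def)
    have cE: "c * E = of_real (emod (X (\<zeta>, V0)))"
    proof -
      have "c * E = of_real (cmod E)" by (simp add: c_def E_def)
      thus ?thesis by (simp only: E_def norm_exp_emod)
    qed
    define \<phi> where "\<phi> = (\<lambda>V. 2 * Y (\<zeta>, V) - c * exp (2 * \<i> * X (\<zeta>, V)))"
    have ReE: "Re (c * exp (2 * \<i> * X p)) \<le> emod (X p)" for p
      using complex_Re_le_cmod[of "c * exp (2 * \<i> * X p)"] c1 by (simp only: norm_mult norm_exp_emod mult_1)
    have ph: "\<phi> holomorphic_on {V. Re V > emod \<zeta> / 2}"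
      unfolding \<phi>_def by (intro holomorphic_intros Yslice[OF d'(2)] Xslice[OF d'(2)])
    have pp: "Re (\<phi> V) \<ge> 0" if "Re V > emod \<zeta> / 2" for V
      using YX(1)[OF inOm[OF d'(2)], of V] that ReE[of "(\<zeta>, V)"] by (simp add: \<phi>_def)
    obtain l' where l': "\<And>V. Re V > emod \<zeta> / 2 \<Longrightarrow> Re (\<phi> V) \<ge> l' * (Re V - emod \<zeta> / 2)"
      "((\<lambda>R. \<phi> (of_real R) / of_real R) \<longlongrightarrow> of_real l') at_top"
      using Julia_halfplane[OF ph pp] by metis
    have lim1: "(\<lambda>k. Re (\<phi> (of_real (R k))) / R k) \<longlonglongrightarrow> l'"
      using tendsto_Re[OF filterlim_compose[OF l'(2) Rlim]] by simp
    have lim2: "(\<lambda>k. 2 * (Re (Y (\<zeta>, of_real (R k))) / R k) - emod (X (\<zeta>, of_real (R k))) / R k) \<longlonglongrightarrow> 2 * lam - 0"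
      by (intro tendsto_intros RlimRe eX0) (use d d' in auto)
    have "2 * lam - 0 \<le> l'"
    proof (rule tendsto_le[OF _ lim1 lim2])
      show "\<forall>\<^sub>F k in sequentially. 2 * (Re (Y (\<zeta>, of_real (R k))) / R k) - emod (X (\<zeta>, of_real (R k))) / R k
          \<le> Re (\<phi> (of_real (R k))) / R k"
        using evR[of 0]
      proof eventually_elim
        case (elim k)
        have "2 * Re (Y (\<zeta>, of_real (R k))) - emod (X (\<zeta>, of_real (R k))) \<le> Re (\<phi> (of_real (R k)))"
          using ReE[of "(\<zeta>, of_real (R k))"] by (simp add: \<phi>_def)
        from divide_right_mono[OF this, of "R k"] show ?case using elim by (simp add: diff_divide_distrib)
      qed
    qed simp
    hence "2 * lam * (Re V0 - emod \<zeta> / 2) \<le> l' * (Re V0 - emod \<zeta> / 2)"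
      using V0 by (intro mult_right_mono) auto
    also have "\<dots> \<le> Re (\<phi> V0)" using l'(1)[of V0] V0 by simp
    also have "\<dots> = 2 * Re (Y (\<zeta>, V0)) - emod (X (\<zeta>, V0))"
    proof -
      have "\<phi> V0 = 2 * Y (\<zeta>, V0) - of_real (emod (X (\<zeta>, V0)))"
        unfolding \<phi>_def E_def[symmetric] cE ..
      thus ?thesis by simp
    qed
    finally show "Re (snd (L (\<zeta>, V0))) - emod (fst (L (\<zeta>, V0))) / 2 \<ge> lam * (Re V0 - emod \<zeta> / 2)"
      by (simp add: X_def Y_def)
  qed
qed

end

section \<open>Lifts that commute with the deck transformations\<close>

lemma holomorphic_norm_1_constant:
  assumes hol: "h holomorphic_on S" and S: "open S" "connected S" and re: "\<And>z. z \<in> S \<Longrightarrow> cmod (h z) = 1"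
  shows "h constant_on S"
proof (rule has_field_derivative_0_imp_constant_on[OF _ S(2,1)])
  fix z assume z: "z \<in> S"
  have "cmod (deriv h z) = cmod (deriv (\<lambda>z. 0) z)"
    by (rule norm_sq_diff_eq_Re[OF S(1) z hol, where G = "\<lambda>z. 1"]) (use re in auto)
  thus "(h has_field_derivative 0) (at z)" using holomorphic_derivI[OF hol S(1) z] by simp
qed

context deck_pair
begin

text \<open>This vanishes on the boundary of the half-planes that lie over the flat part.\<close>
definition height :: "complex \<times> complex \<Rightarrow> real" where "height p = Re (snd p) - emod (fst p) / 2"

lemma height_pos: "p \<in> Cover \<Longrightarrow> height p > 0"
  using Cover_D(1)[of "fst p" "snd p"] by (simp add: height_def)

lemma height_Rot: "height (Rot \<theta> p) = exp (- 2 * \<theta>) * height p"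
  unfolding height_def emod_Rot by (simp add: Rot_def algebra_simps)

lemma Re_snd_Rot: "Re (snd (Rot \<theta> p)) = exp (- 2 * \<theta>) * Re (snd p)"
  and norm_snd_Rot: "cmod (snd (Rot \<theta> p)) = exp (- 2 * \<theta>) * cmod (snd p)"
  by (simp_all add: Rot_def norm_mult)

text \<open>The images \<open>q k\<close> of the points \<open>p k = (0, R k)\<close> are moved by deck transformations to \<open>q' k\<close>,
so that their first coordinates stay bounded and subconverge to some \<open>\<xi>\<close>. Applying
\<open>Julia_Wolff\<close> to \<open>L\<close> at \<open>0\<close> and to \<open>L'\<close> at \<open>\<xi>\<close>, the two growth bounds show \<open>lam' lam \<ge> 1\<close>, while the
height inequalities bound \<open>lam' lam\<close> by \<open>1\<close> and hence are equalities. That \<open>n = 1\<close> enters in the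
growth bounds: both coordinates \<open>V\<close> are rescaled by the same factor under the deck
transformation.\<close>
lemma equality_in_Julia_Wolff:
  assumes n1: "n = 1"
  obtains lam R e where "lam > 0" "e > 0" "ball 0 e \<times> ball (of_real R) e \<subseteq> Cover"
    "\<And>p. p \<in> ball 0 e \<times> ball (of_real R) e \<Longrightarrow> height (L p) = lam * height p"
proof -
  obtain R :: "nat \<Rightarrow> real" and c \<delta> where R: "c > 0" "\<delta> > 0" "\<And>k. R k \<ge> 1" "filterlim R at_top sequentially"
    "(\<lambda>k. wcoord (L (0, of_real (R k)))) \<longlonglongrightarrow> 0"
    "\<And>k. \<bar>2 * Re (fst (L (0, of_real (R k))))\<bar> \<le> \<mu> - c"
    "\<And>k. Re (snd (L (0, of_real (R k)))) \<ge> \<delta> * cmod (snd (L (0, of_real (R k))))"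
    by (rule nontangential_sequence) (assumption | rule that)+
  define p where "p = (\<lambda>k. (0::complex, complex_of_real (R k)))"
  have pOm: "p k \<in> Cover" for k using fibre_Cover[OF R(3), of 0 k] strip_width(1) by (simp add: p_def fibre_def)
  define q where "q = (\<lambda>k. L (p k))"
  have qOm: "q k \<in> Cover" for k using pOm by (simp add: q_def)
  define m where "m = (\<lambda>k. - \<lfloor>Im (fst (q k)) / (2 * pi)\<rfloor>)"
  define q' where "q' = (\<lambda>k. Rot (2 * pi * of_int (m k)) (q k))"
  have q'Cover: "q' k \<in> Cover" for k using qOm by (simp add: q'_def)
  have fq': "fst (q' k) = fst (q k) + \<i> * (2 * pi * of_int (m k))" for k by (simp add: q'_def Rot_def)
  have Im01: "0 \<le> Im (fst (q' k))" "Im (fst (q' k)) \<le> 2 * pi" for k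
  proof -
    define j where "j = \<lfloor>Im (fst (q k)) / (2 * pi)\<rfloor>"
    have "of_int j \<le> Im (fst (q k)) / (2 * pi)" "Im (fst (q k)) / (2 * pi) \<le> of_int j + 1"
      unfolding j_def by linarith+
    moreover have "m k = - j" by (simp add: m_def j_def)
    ultimately show "0 \<le> Im (fst (q' k))" "Im (fst (q' k)) \<le> 2 * pi" by (auto simp: fq' field_simps)
  qed
  have Re01: "\<bar>2 * Re (fst (q' k))\<bar> \<le> \<mu> - c" for k using R(6)[of k] by (simp add: fq' q_def p_def)
  define B where "B = cbox (Complex (- (\<mu> - c) / 2) 0) (Complex ((\<mu> - c) / 2) (2 * pi))"
  have "fst (q' k) \<in> B" for k
    using Im01[of k] Re01[of k] by (auto simp: B_def in_cbox_complex_iff abs_le_iff)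
  moreover have "seq_compact B" unfolding B_def by (intro compact_imp_seq_compact compact_cbox)
  ultimately obtain \<xi> s where s: "\<xi> \<in> B" "strict_mono (s :: nat \<Rightarrow> nat)" "((\<lambda>k. fst (q' k)) \<circ> s) \<longlonglongrightarrow> \<xi>"
    using seq_compactE[of B "\<lambda>k. fst (q' k)"] by blast
  have xi: "\<bar>2 * Re \<xi>\<bar> < \<mu>" using s(1) R(1) by (auto simp: B_def in_cbox_complex_iff abs_less_iff)
  have wq: "(\<lambda>k. wcoord (q k)) \<longlonglongrightarrow> 0" using R(5) by (simp add: q_def p_def)
  have Rlim: "filterlim (\<lambda>k. cmod (of_real (R k) :: complex)) at_top sequentially"
  proof -
    have "cmod (of_real (R k) :: complex) = R k" for k using R(3)[of k] by simp
    thus ?thesis using R(4) by simp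
  qed
  have RlimI: "(\<lambda>k. 1 / complex_of_real (R k)) \<longlonglongrightarrow> 0"
    by (rule tendsto_divide_0[OF tendsto_const filterlim_norm_at_top_imp_at_infinity[OF Rlim]])
  obtain lam r where J: "lam \<ge> 0" "r > 0"
    "\<And>\<epsilon>. \<epsilon> > 0 \<Longrightarrow> \<forall>\<^sub>F k in sequentially. Re (snd (L (0, of_real (R k)))) \<le> lam * Re (of_real (R k)) + \<epsilon> * cmod (of_real (R k))"
    "\<And>\<zeta> V. \<lbrakk>dist 0 \<zeta> < r; 2 * Re V > emod \<zeta>\<rbrakk> \<Longrightarrow>
       Re (snd (L (\<zeta>, V))) - emod (fst (L (\<zeta>, V))) / 2 \<ge> lam * (Re V - emod \<zeta> / 2)"
  proof (rule Julia_Wolff[of "\<lambda>_. 0" 0 "\<lambda>k. of_real (R k)" 1])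
    show "1 * cmod (complex_of_real (R k)) \<le> Re (complex_of_real (R k))" for k using R(3)[of k] by simp
    show "(0, complex_of_real (R k)) \<in> Cover" for k using pOm by (simp add: p_def)
    show "(\<lambda>k. wcoord (L (0, complex_of_real (R k)))) \<longlonglongrightarrow> 0" by (rule R(5))
  qed (use mu Rlim in auto)
  have L'q': "L' (q' k) = Rot (2 * pi * of_int (m k)) (p k)" for k
    using deck_map_Rot_int[OF L' qOm[of k], of "m k"] L'L[OF pOm[of k]] by (simp add: q'_def q_def n1)
  obtain lam' r' where J': "lam' \<ge> 0" "r' > 0"
    "\<And>\<epsilon>. \<epsilon> > 0 \<Longrightarrow> \<forall>\<^sub>F k in sequentially. Re (snd (L' (fst (q' (s k)), snd (q' (s k)))))
        \<le> lam' * Re (snd (q' (s k))) + \<epsilon> * cmod (snd (q' (s k)))"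
    "\<And>\<zeta> V. \<lbrakk>dist \<xi> \<zeta> < r'; 2 * Re V > emod \<zeta>\<rbrakk> \<Longrightarrow>
       Re (snd (L' (\<zeta>, V))) - emod (fst (L' (\<zeta>, V))) / 2 \<ge> lam' * (Re V - emod \<zeta> / 2)"
  proof (rule deck_pair.Julia_Wolff[OF swap, of "\<lambda>k. fst (q' (s k))" \<xi> "\<lambda>k. snd (q' (s k))" \<delta>])
    show "(\<lambda>k. fst (q' (s k))) \<longlonglongrightarrow> \<xi>" using s(3) by (simp add: o_def)
    show "\<delta> * cmod (snd (q' (s k))) \<le> Re (snd (q' (s k)))" for k
      using R(7)[of "s k"] by (simp add: q'_def Re_snd_Rot norm_snd_Rot q_def p_def)
    show "(fst (q' (s k)), snd (q' (s k))) \<in> Cover" for k using q'Cover by simp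
    have "wcoord (L' (q' (s k))) = 1 / of_real (R (s k))" for k
      unfolding L'q' wcoord_Rot by (simp add: p_def wcoord_def)
    thus "(\<lambda>k. wcoord (L' (fst (q' (s k)), snd (q' (s k))))) \<longlonglongrightarrow> 0"
      using LIMSEQ_subseq_LIMSEQ[OF RlimI s(2)] by (simp add: o_def)
    show "filterlim (\<lambda>k. cmod (snd (q' (s k)))) at_top sequentially"
    proof -
      have "(\<lambda>k. cmod (wcoord (q (s k)))) \<longlonglongrightarrow> 0"
        using tendsto_norm[OF LIMSEQ_subseq_LIMSEQ[OF wq s(2)]] by (simp add: o_def)
      moreover have "\<forall>\<^sub>F k in sequentially. 0 < cmod (wcoord (q (s k)))"
        using Cover_eta_wcoord(3)[OF qOm] by simp
      ultimately have "filterlim (\<lambda>k. inverse (cmod (wcoord (q (s k))))) at_top sequentially"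
        by (rule filterlim_inverse_at_top)
      hence l: "filterlim (\<lambda>k. exp (- 4 * pi) * inverse (cmod (wcoord (q (s k))))) at_top sequentially"
        by (intro filterlim_tendsto_pos_mult_at_top[OF tendsto_const]) auto
      have "exp (- 4 * pi) * inverse (cmod (wcoord (q (s k)))) \<le> cmod (snd (q' (s k)))" for k
      proof -
        have w: "wcoord (q' (s k)) = wcoord (q (s k))" by (simp add: q'_def)
        have nz: "snd (q' (s k)) \<noteq> 0" using Cover_D(3)[of "fst (q' (s k))" "snd (q' (s k))"] q'Cover by simp
        have "cmod (snd (q' (s k))) = emod (fst (q' (s k))) * inverse (cmod (wcoord (q (s k))))"
          using nz unfolding w[symmetric] norm_wcoord by (simp add: field_simps)
        moreover have "exp (- 4 * pi) \<le> emod (fst (q' (s k)))" using Im01(2)[of "s k"] by (simp add: emod_def)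
        ultimately show ?thesis by (simp add: mult_right_mono)
      qed
      thus ?thesis using filterlim_at_top_mono[OF l] by auto
    qed
  qed (use xi R(2) in auto)
  have prod: "1 \<le> (lam' + \<epsilon> / \<delta>) * (lam + \<epsilon>)" if e: "\<epsilon> > 0" for \<epsilon>
  proof -
    have "\<forall>\<^sub>F k in sequentially. Re (snd (L (0, of_real (R (s k))))) \<le> lam * Re (of_real (R (s k))) + \<epsilon> * cmod (of_real (R (s k)))"
      using eventually_subseq[OF s(2) J(3)[OF e]] .
    with J'(3)[OF e] have "\<forall>\<^sub>F k in sequentially. 1 \<le> (lam' + \<epsilon> / \<delta>) * (lam + \<epsilon>)"
    proof eventually_elim
      case (elim k)
      define x where "x = exp (- 2 * (2 * pi * of_int (m (s k))))"
      define y where "y = snd (q (s k))"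
      have x: "x > 0" by (simp add: x_def)
      have R1: "R (s k) > 0" using R(3)[of "s k"] by simp
      have "x * R (s k) \<le> lam' * (x * Re y) + \<epsilon> * (x * cmod y)"
        using elim(1) unfolding prod.collapse L'q' Re_snd_Rot
        by (simp add: q'_def Re_snd_Rot norm_snd_Rot p_def x_def y_def)
      hence "x * R (s k) \<le> x * (lam' * Re y + \<epsilon> * cmod y)" by (simp add: algebra_simps)
      hence "R (s k) \<le> lam' * Re y + \<epsilon> * cmod y" using x by simp
      moreover have "\<epsilon> * cmod y \<le> \<epsilon> / \<delta> * Re y"
        using R(7)[of "s k"] R(2) e by (simp add: y_def q_def p_def field_simps)
      ultimately have "R (s k) \<le> (lam' + \<epsilon> / \<delta>) * Re y" by (simp add: algebra_simps)
      also have "\<dots> \<le> (lam' + \<epsilon> / \<delta>) * ((lam + \<epsilon>) * R (s k))"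
        using elim(2) R1 J'(1) e R(2) by (intro mult_left_mono) (auto simp: y_def q_def p_def algebra_simps)
      finally have "1 * R (s k) \<le> ((lam' + \<epsilon> / \<delta>) * (lam + \<epsilon>)) * R (s k)" by (simp add: mult_ac)
      thus ?case using R1 by (subst (asm) mult_le_cancel_right_pos) auto
    qed
    thus ?thesis by simp
  qed
  have "((\<lambda>\<epsilon>. (lam' + \<epsilon> / \<delta>) * (lam + \<epsilon>)) \<longlongrightarrow> (lam' + 0 / \<delta>) * (lam + 0)) (at_right 0)"
    by (intro tendsto_intros) (use R(2) in auto)
  hence lim: "((\<lambda>\<epsilon>. (lam' + \<epsilon> / \<delta>) * (lam + \<epsilon>)) \<longlongrightarrow> lam' * lam) (at_right 0)" by simp
  have ll: "1 \<le> lam' * lam"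
    by (rule tendsto_lowerbound[OF lim]) (use prod in \<open>auto simp: eventually_at_filter\<close>)
  have lam: "lam > 0" using ll J(1) by (cases "lam = 0") auto
  obtain k where k: "dist \<xi> (fst (q' k)) < r'"
  proof -
    have "\<forall>\<^sub>F k in sequentially. dist (fst (q' (s k))) \<xi> < r'"
      using tendstoD[OF s(3) J'(2)] by (simp add: o_def)
    then obtain k where "dist (fst (q' (s k))) \<xi> < r'" by (auto simp: eventually_sequentially)
    thus thesis using that[of "s k"] by (simp add: dist_commute)
  qed
  \<comment> \<open>one index \<open>k\<close> far out in the sequence: near \<open>p k\<close> both height inequalities apply\<close>
  define \<theta> where "\<theta> = 2 * pi * of_int (m k)"
  define N where "N = {z \<in> Cover. dist \<xi> (fst (Rot \<theta> (L z))) < r' \<and> dist 0 (fst z) < r}"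
  have Xc: "continuous_on Cover (\<lambda>p. fst (L p))" by (rule hol2_continuous_on[OF X_hol])
  have "N = (Cover \<inter> (\<lambda>z. dist \<xi> (fst (L z) + \<i> * \<theta>)) -` {..<r'}) \<inter> (Cover \<inter> (\<lambda>z. dist 0 (fst z)) -` {..<r})"
    by (auto simp: N_def Rot_def)
  moreover have "open (Cover \<inter> (\<lambda>z. dist \<xi> (fst (L z) + \<i> * \<theta>)) -` {..<r'})"
    by (intro continuous_open_preimage open_Cover open_lessThan continuous_intros Xc)
  moreover have "open (Cover \<inter> (\<lambda>z. dist 0 (fst z)) -` {..<r})"
    by (intro continuous_open_preimage open_Cover open_lessThan continuous_intros)
  ultimately have "open N" by auto
  moreover have "(0, of_real (R k)) \<in> N"
    using pOm[of k] k J(2) by (simp add: N_def p_def q'_def q_def \<theta>_def)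
  ultimately obtain e where e: "e > 0" "ball 0 e \<times> ball (of_real (R k)) e \<subseteq> N"
    using open_prod_ball by blast
  have eq: "height (L z) = lam * height z" if z: "z \<in> N" for z
  proof -
    have zOm: "z \<in> Cover" using z by (simp add: N_def)
    define w where "w = L z"
    have wOm: "w \<in> Cover" using zOm by (simp add: w_def)
    have 1: "height w \<ge> lam * height z"
      using J(4)[of "fst z" "snd z"] z Cover_D(1)[of "fst z" "snd z"] zOm by (simp add: N_def height_def w_def)
    have "lam' * height (Rot \<theta> w) \<le> height (L' (Rot \<theta> w))"
      using J'(4)[of "fst (Rot \<theta> w)" "snd (Rot \<theta> w)"] z Cover_D(1)[of "fst (Rot \<theta> w)" "snd (Rot \<theta> w)"] wOm
      by (simp add: N_def height_def w_def)
    also have "L' (Rot \<theta> w) = Rot \<theta> z"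
      unfolding \<theta>_def using deck_map_Rot_int[OF L' wOm, of "m k"] L'L[OF zOm] by (simp add: w_def n1)
    finally have "exp (- 2 * \<theta>) * (lam' * height w) \<le> exp (- 2 * \<theta>) * height z" by (simp add: height_Rot mult_ac)
    hence 2: "lam' * height w \<le> height z" by (subst (asm) mult_le_cancel_left_pos) auto
    have "1 * height w \<le> lam' * lam * height w" by (intro mult_right_mono ll) (use height_pos[OF wOm] in simp)
    also have "\<dots> \<le> lam * height z" using mult_left_mono[OF 2, of lam] lam by (simp add: mult_ac)
    finally show ?thesis using 1 by (simp add: w_def)
  qed
  have "N \<subseteq> Cover" by (auto simp: N_def)
  show thesis by (rule that[OF lam e(1)]) (use e(2) eq \<open>N \<subseteq> Cover\<close> in blast)+
qed

lemma Cover_identity: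
  assumes "hol2 \<Phi> Cover" "a \<in> A" "b \<in> B" "open A" "open B" "A \<times> B \<subseteq> Cover" "\<And>x y. x \<in> A \<Longrightarrow> y \<in> B \<Longrightarrow> \<Phi> (x, y) = 0" "p \<in> Cover"
  shows "\<Phi> p = 0"
  by (rule hol2_identity[OF assms(1) open_Cover connected_Cover, of "A \<times> B"])
     (use assms in \<open>auto intro: open_Times\<close>)

text \<open>With \<open>P = exp (\<i> X)\<close> the equality of heights reads
\<open>|P|\<^sup>2 - lam |exp (\<i> \<zeta>)|\<^sup>2 = 2 Re (Y - lam V)\<close> on a small polydisc. In the variable \<open>V\<close> this
makes \<open>|P|\<^sup>2\<close> harmonic, so \<open>P\<close> depends only on \<open>\<zeta>\<close>. In the variable \<open>\<zeta>\<close> it gives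
\<open>|P'|\<^sup>2 = lam |exp (\<i> \<zeta>)|\<^sup>2\<close>, so \<open>P = C exp (\<i> \<zeta>) + d\<close> with \<open>|C|\<^sup>2 = lam\<close>. The identity theorem
extends the formulas to the covering, where equivariance kills the additive constants. Finally
\<open>X - \<zeta>\<close> is imaginary, because otherwise iteration would leave the bounded range of \<open>Re \<zeta>\<close>.\<close>
theorem degree_one_imp_Rot:
  assumes n1: "n = 1"
  obtains \<kappa> where "\<And>p. p \<in> Cover \<Longrightarrow> L p = Rot \<kappa> p"
proof -
  obtain lam R e where E: "lam > 0" "e > 0" "ball 0 e \<times> ball (of_real R) e \<subseteq> Cover"
    "\<And>p. p \<in> ball 0 e \<times> ball (of_real R) e \<Longrightarrow> height (L p) = lam * height p"
    by (rule equality_in_Julia_Wolff[OF n1]) (assumption | rule that)+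
  define A B where "A = ball (0::complex) e" and "B = ball (complex_of_real R) e"
  have AB: "open A" "connected A" "0 \<in> A" "open B" "connected B" "of_real R \<in> B" "A \<times> B \<subseteq> Cover"
    using E by (auto simp: A_def B_def)
  define X Y where "X = (\<lambda>p. fst (L p))" and "Y = (\<lambda>p. snd (L p))"
  have hX: "hol2 X Cover" and hY: "hol2 Y Cover" unfolding X_def Y_def by (rule X_hol Y_hol)+
  have Rot1: "X (Rot (2 * pi) p) = X p + \<i> * (2 * pi)" "Y (Rot (2 * pi) p) = of_real (exp (- 4 * pi)) * Y p"
    if "p \<in> Cover" for p
    using deck_map_Rot_int[OF L that, of 1] by (simp_all add: X_def Y_def n1 Rot_def)
  have sliceV: "(\<lambda>V. \<Phi> (\<zeta>, V)) holomorphic_on B" if "hol2 \<Phi> Cover" "\<zeta> \<in> A" for \<Phi> \<zeta>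
    by (rule hol2_slice2[OF that(1) AB(4)]) (use AB(7) that in auto)
  have slicez: "(\<lambda>\<zeta>. \<Phi> (\<zeta>, V)) holomorphic_on A" if "hol2 \<Phi> Cover" "V \<in> B" for \<Phi> V
    by (rule hol2_slice1[OF that(1) AB(1)]) (use AB(7) that in auto)
  define P where "P = (\<lambda>p. exp (\<i> * X p))"
  have hP: "hol2 P Cover" unfolding P_def by (intro hol2_intros hX)
  have P2: "(cmod (P p))\<^sup>2 = emod (X p)" for p by (simp only: P_def norm_exp_ii)
  have eq: "(cmod (P (\<zeta>, V)))\<^sup>2 = 2 * Re (Y (\<zeta>, V)) - 2 * lam * Re V + lam * emod \<zeta>" if "\<zeta> \<in> A" "V \<in> B" for \<zeta> V
    using E(4)[of "(\<zeta>, V)"] that unfolding P2 by (simp add: height_def X_def Y_def A_def B_def algebra_simps)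
  have Pconst: "P (\<zeta>, V) = P (\<zeta>, of_real R)" if z: "\<zeta> \<in> A" "V \<in> B" for \<zeta> V
  proof -
    have "(\<lambda>V. P (\<zeta>, V)) constant_on B"
    proof (rule has_field_derivative_0_imp_constant_on[OF _ AB(5,4)])
      fix U assume U: "U \<in> B"
      have "cmod (deriv (\<lambda>V. P (\<zeta>, V)) U) = cmod (deriv (\<lambda>z. 0) U)"
        by (rule norm_sq_diff_eq_Re[OF AB(4) U sliceV[OF hP z(1)],
              where G = "\<lambda>V. 2 * Y (\<zeta>, V) - of_real (2 * lam) * V + of_real (lam * emod \<zeta>)"])
           (use eq[OF z(1)] in \<open>auto intro!: holomorphic_intros sliceV[OF hY z(1)]\<close>)
      thus "((\<lambda>V. P (\<zeta>, V)) has_field_derivative 0) (at U)"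
        using holomorphic_derivI[OF sliceV[OF hP z(1)] AB(4) U] by simp
    qed
    thus ?thesis using z(2) AB(6) unfolding constant_on_def by metis
  qed
  define p where "p = (\<lambda>\<zeta>. P (\<zeta>, of_real R))"
  define Q where "Q = (\<lambda>\<zeta>. of_real (sqrt lam) * exp (\<i> * \<zeta>))"
  have ph: "p holomorphic_on A" unfolding p_def by (rule slicez[OF hP AB(6)])
  have Qh: "Q holomorphic_on S" for S unfolding Q_def by (intro holomorphic_intros)
  have Q2: "(cmod (Q \<zeta>))\<^sup>2 = lam * emod \<zeta>" for \<zeta>
    unfolding Q_def norm_mult power_mult_distrib norm_exp_ii using E(1) by simp
  have dQ: "(Q has_field_derivative \<i> * Q \<zeta>) (at \<zeta>)" for \<zeta>
    unfolding Q_def by (auto intro!: derivative_eq_intros)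
  have Qnz: "Q \<zeta> \<noteq> 0" for \<zeta> using E(1) by (simp add: Q_def)
  have mod: "cmod (deriv p \<zeta>) = cmod (\<i> * Q \<zeta>)" if z: "\<zeta> \<in> A" for \<zeta>
  proof -
    have "cmod (deriv p \<zeta>) = cmod (deriv Q \<zeta>)"
    proof (rule norm_sq_diff_eq_Re[OF AB(1) z ph Qh])
      show "(\<lambda>\<zeta>. 2 * Y (\<zeta>, of_real R) - of_real (2 * lam * R)) holomorphic_on A"
        by (intro holomorphic_intros slicez[OF hY AB(6)])
      show "(cmod (p z))\<^sup>2 - (cmod (Q z))\<^sup>2 = Re (2 * Y (z, of_real R) - of_real (2 * lam * R))" if "z \<in> A" for z
        using eq[OF that AB(6)] unfolding Q2 by (simp add: p_def)
    qed
    thus ?thesis using DERIV_imp_deriv[OF dQ] by simp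
  qed
  obtain \<gamma> where \<gamma>: "\<And>\<zeta>. \<zeta> \<in> A \<Longrightarrow> deriv p \<zeta> / (\<i> * Q \<zeta>) = \<gamma>"
  proof -
    have "(\<lambda>\<zeta>. deriv p \<zeta> / (\<i> * Q \<zeta>)) constant_on A"
    proof (rule holomorphic_norm_1_constant[OF _ AB(1,2)])
      show "(\<lambda>\<zeta>. deriv p \<zeta> / (\<i> * Q \<zeta>)) holomorphic_on A"
        by (intro holomorphic_intros holomorphic_deriv ph Qh AB(1)) (use Qnz in auto)
    qed (use mod Qnz in \<open>auto simp: norm_divide\<close>)
    thus thesis using that unfolding constant_on_def by blast
  qed
  have g1: "cmod \<gamma> = 1" using \<gamma>[OF AB(3)] mod[OF AB(3)] Qnz[of 0] by (auto simp: norm_divide)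
  obtain d where d: "\<And>\<zeta>. \<zeta> \<in> A \<Longrightarrow> p \<zeta> - \<gamma> * Q \<zeta> = d"
  proof -
    have "(\<lambda>\<zeta>. p \<zeta> - \<gamma> * Q \<zeta>) constant_on A"
    proof (rule has_field_derivative_0_imp_constant_on[OF _ AB(2,1)])
      fix \<zeta> assume z: "\<zeta> \<in> A"
      have "deriv p \<zeta> = \<gamma> * (\<i> * Q \<zeta>)" using \<gamma>[OF z] Qnz[of \<zeta>] by (simp add: field_simps)
      thus "((\<lambda>\<zeta>. p \<zeta> - \<gamma> * Q \<zeta>) has_field_derivative 0) (at \<zeta>)"
        using DERIV_diff[OF holomorphic_derivI[OF ph AB(1) z] DERIV_cmult[OF dQ, of \<gamma>]] by simp
    qed
    thus thesis using that unfolding constant_on_def by blast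
  qed
  define C where "C = \<gamma> * of_real (sqrt lam)"
  have C2: "(cmod C)\<^sup>2 = lam" using g1 E(1) by (simp add: C_def norm_mult power_mult_distrib)
  have Cnz: "C \<noteq> 0" using C2 E(1) by auto
  have form: "exp (\<i> * X z) = C * exp (\<i> * fst z) + d" if z: "z \<in> Cover" for z
  proof -
    have "P z - C * exp (\<i> * fst z) - d = 0"
    proof (rule Cover_identity[OF _ AB(3,6,1,4,7) _ z])
      show "hol2 (\<lambda>z. P z - C * exp (\<i> * fst z) - d) Cover" by (intro hol2_intros hP)
      show "P (x, y) - C * exp (\<i> * fst (x, y)) - d = 0" if "x \<in> A" "y \<in> B" for x y
        using Pconst[OF that] d[OF that(1)] by (simp add: p_def Q_def C_def mult_ac)
    qed
    thus ?thesis by (simp add: P_def algebra_simps)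
  qed
  define p0 where "p0 = (0::complex, complex_of_real R)"
  have p0: "p0 \<in> Cover" using AB by (auto simp: p0_def)
  \<comment> \<open>under the deck transformation \<open>exp (\<i> X)\<close> and \<open>exp (\<i> \<zeta>)\<close> are multiplied by the same factor\<close>
  have d0: "d = 0"
  proof -
    have "exp (\<i> * (\<zeta> + \<i> * (2 * pi))) = of_real (exp (- 2 * pi)) * exp (\<i> * \<zeta>)" for \<zeta>
    proof -
      have "\<i> * (\<zeta> + \<i> * (2 * pi)) = \<i> * \<zeta> + of_real (- 2 * pi)" by (simp add: complex_eq_iff)
      thus ?thesis by (simp only: exp_add exp_of_real mult.commute)
    qed
    note sh = this
    have "exp (\<i> * X (Rot (2 * pi) p0)) = C * exp (\<i> * fst (Rot (2 * pi) p0)) + d"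
      by (rule form) (use p0 in simp)
    hence "of_real (exp (- 2 * pi)) * exp (\<i> * X p0) = C * (of_real (exp (- 2 * pi)) * exp (\<i> * fst p0)) + d"
      unfolding Rot1(1)[OF p0] sh by (simp only: Rot_def fst_conv sh)
    hence "d * (of_real (exp (- 2 * pi)) - 1) = 0" unfolding form[OF p0] by (simp add: algebra_simps)
    moreover have "complex_of_real (exp (- 2 * pi)) \<noteq> 1"
      unfolding of_real_eq_1_iff using pi_gt_zero by simp
    ultimately show ?thesis by simp
  qed
  obtain s where s: "\<And>z. z \<in> Cover \<Longrightarrow> X z = fst z + s" "exp (\<i> * s) = C"
  proof -
    define h where "h = (\<lambda>z. \<i> * (X z - fst z - (X p0 - fst p0)))"
    have eC: "exp (\<i> * (X z - fst z)) = C" if "z \<in> Cover" for z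
      using form[OF that] d0 by (simp add: right_diff_distrib exp_diff)
    have "exp (h z) = 1" if "z \<in> Cover" for z
      using eC[OF that] eC[OF p0] Cnz by (simp add: h_def right_diff_distrib exp_diff)
    moreover have "continuous_on Cover h" unfolding h_def
      by (intro continuous_intros hol2_continuous_on[OF hX])
    ultimately obtain j :: int where j: "\<And>z. z \<in> Cover \<Longrightarrow> h z = 2 * pi * j * \<i>"
      using exp_eq_1_imp_const_int[OF connected_Cover] by blast
    have "j = 0" using j[OF p0] by (simp add: h_def)
    hence "h z = 0" if "z \<in> Cover" for z using j[OF that] by simp
    hence "X z - fst z - (X p0 - fst p0) = 0" if "z \<in> Cover" for z
      using that unfolding h_def mult_eq_0_iff by simp
    hence "X z = fst z + (X p0 - fst p0)" if "z \<in> Cover" for z using that by (metis add.commute diff_add_cancel diff_eq_diff_eq diff_self)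
    thus thesis using that[of "X p0 - fst p0"] eC[OF p0] by blast
  qed
  have lam: "lam = exp (- 2 * Im s)"
    using C2 norm_exp_ii[of s] by (simp add: s(2) emod_def)
  obtain c0 where c0: "\<And>x y. x \<in> A \<Longrightarrow> y \<in> B \<Longrightarrow> Y (x, y) - of_real lam * y = c0"
  proof -
    define D where "D = (\<lambda>z. \<i> * (Y z - of_real lam * snd z))"
    have hD: "hol2 D Cover" unfolding D_def by (intro hol2_intros hY)
    have ImD: "Im (D (x, y)) = 0" if "x \<in> A" "y \<in> B" for x y
    proof -
      have "(cmod (P (x, y)))\<^sup>2 = lam * emod x"
      proof -
        have "(x, y) \<in> Cover" using that AB(7) by auto
        hence "P (x, y) = C * exp (\<i> * x)" unfolding P_def using form[of "(x, y)"] d0 by simp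
        thus ?thesis by (simp only: norm_mult power_mult_distrib C2 norm_exp_ii)
      qed
      thus ?thesis using eq[OF that] by (simp add: D_def)
    qed
    have 1: "D (x, y) = D (x, of_real R)" if "x \<in> A" "y \<in> B" for x y
    proof -
      have "(\<lambda>y. D (x, y)) constant_on B"
        by (rule holomorphic_real_valued_constant[OF sliceV[OF hD that(1)] AB(4,5)]) (use ImD that in auto)
      thus ?thesis using that AB(6) unfolding constant_on_def by metis
    qed
    have 2: "D (x, of_real R) = D (0, of_real R)" if "x \<in> A" for x
    proof -
      have "(\<lambda>x. D (x, of_real R)) constant_on A"
        by (rule holomorphic_real_valued_constant[OF slicez[OF hD AB(6)] AB(1,2)]) (use ImD AB(6) in auto)
      thus ?thesis using that AB(3) unfolding constant_on_def by metis
    qed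
    show thesis by (rule that[of "- \<i> * D (0, of_real R)"]) (use 1 2 in \<open>auto simp: D_def\<close>)
  qed
  have Yform: "Y z = of_real lam * snd z + c0" if z: "z \<in> Cover" for z
  proof -
    have "Y z - of_real lam * snd z - c0 = 0"
      by (rule Cover_identity[OF _ AB(3,6,1,4,7) _ z]) (use c0 in \<open>auto intro!: hol2_intros hY\<close>)
    thus ?thesis by (simp add: algebra_simps)
  qed
  have "c0 = 0"
  proof -
    have "Y (Rot (2 * pi) p0) = of_real lam * snd (Rot (2 * pi) p0) + c0" by (rule Yform) (use p0 in simp)
    hence "of_real (exp (- 4 * pi)) * Y p0 = of_real lam * (of_real (exp (- 4 * pi)) * snd p0) + c0"
      unfolding Rot1(2)[OF p0] by (simp add: Rot_def)
    hence "c0 * (of_real (exp (- 4 * pi)) - 1) = 0" unfolding Yform[OF p0] by (simp add: algebra_simps)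
    moreover have "complex_of_real (exp (- 4 * pi)) \<noteq> 1"
      unfolding of_real_eq_1_iff using pi_gt_zero by simp
    ultimately show ?thesis by simp
  qed
  have "Re s = 0"
  proof -
    obtain b where b: "b > 0" "\<And>p. p \<in> Cover \<Longrightarrow> \<bar>2 * Re (fst p)\<bar> < b" using Cover_t_bounded by blast
    have iter: "(L ^^ k) p0 \<in> Cover \<and> fst ((L ^^ k) p0) = of_nat k * s" for k
    proof (induction k)
      case 0 thus ?case using p0 by (simp add: p0_def)
    next
      case (Suc k)
      thus ?case using s(1)[of "(L ^^ k) p0"] by (auto simp: X_def algebra_simps)
    qed
    show ?thesis
    proof (rule ccontr)
      assume "Re s \<noteq> 0"
      then obtain k :: nat where k: "b < of_nat k * \<bar>2 * Re s\<bar>"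
        using reals_Archimedean3[of "\<bar>2 * Re s\<bar>"] by auto
      have "\<bar>2 * Re (fst ((L ^^ k) p0))\<bar> < b" using b(2) iter by blast
      moreover have "Re (fst ((L ^^ k) p0)) = of_nat k * Re s" using iter[of k] by simp
      ultimately show False using k by (simp add: abs_mult)
    qed
  qed
  hence s': "s = \<i> * of_real (Im s)" by (simp add: complex_eq_iff)
  show thesis
  proof (rule that[of "Im s"])
    fix z assume z: "z \<in> Cover"
    show "L z = Rot (Im s) z"
      using s(1)[OF z] s' Yform[OF z] \<open>c0 = 0\<close> unfolding Rot_def lam
      by (simp add: X_def Y_def prod_eq_iff)
  qed
qed

end

section \<open>Lifts that reverse the deck transformations\<close>

text \<open>The lift of the antiholomorphic symmetry \<open>(z, w) \<mapsto> (1 / cnj z, cnj w)\<close>, which exists because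
\<open>\<eta>\<close> is even. It has degree one.\<close>
definition Cj :: "complex \<times> complex \<Rightarrow> complex \<times> complex" where
  "Cj p = (- cnj (fst p), cnj (snd p))"

lemma Cj_Cj [simp]: "Cj (Cj p) = p" by (simp add: Cj_def)

lemma Cj_Rot: "Cj (Rot \<theta> p) = Rot \<theta> (Cj p)"
  by (simp add: Cj_def Rot_def)

lemma hol2_cnj_Cj:
  assumes "hol2 \<Phi> S" "\<And>p. p \<in> S \<Longrightarrow> Cj p \<in> S"
  shows "hol2 (\<lambda>p. cnj (\<Phi> (Cj p))) S"
  unfolding hol2_def
proof
  fix p assume "p \<in> S"
  then obtain a b where ab: "(\<Phi> has_derivative (\<lambda>v. a * fst v + b * snd v)) (at (Cj p))"
    using assms unfolding hol2_def by blast
  have "bounded_linear Cj"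
    unfolding Cj_def
    by (intro bounded_linear_Pair bounded_linear_minus
        bounded_linear_compose[OF bounded_linear_cnj] bounded_linear_fst bounded_linear_snd)
  hence "(Cj has_derivative Cj) (at p)" by (rule bounded_linear_imp_has_derivative)
  from has_derivative_compose[OF this ab]
  have "((\<lambda>p. \<Phi> (Cj p)) has_derivative (\<lambda>v. a * fst (Cj v) + b * snd (Cj v))) (at p)" .
  from bounded_linear.has_derivative[OF bounded_linear_cnj this]
  have "((\<lambda>p. cnj (\<Phi> (Cj p))) has_derivative (\<lambda>v. cnj (a * fst (Cj v) + b * snd (Cj v)))) (at p)" .
  thus "\<exists>a b. ((\<lambda>p. cnj (\<Phi> (Cj p))) has_derivative (\<lambda>v. a * fst v + b * snd v)) (at p)"
    by (intro exI[of _ "- cnj a"] exI[of _ "cnj b"]) (simp add: Cj_def)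
qed

context worm
begin

lemma Cj_Cover [simp]: "Cj p \<in> Cover \<longleftrightarrow> p \<in> Cover"
proof -
  obtain \<zeta> V where p: "p = (\<zeta>, V)" by (cases p)
  show ?thesis using eta_even[of "2 * Re \<zeta>"] by (simp add: p Cj_def Cover_iff emod_def)
qed

lemma deck_map_comp:
  assumes "deck_map a L1" "deck_map b L2" shows "deck_map (a * b) (\<lambda>p. L1 (L2 p))"
  unfolding deck_map_def
proof (intro conjI ballI)
  have 1: "hol2 (\<lambda>p. fst (L1 p)) Cover" "hol2 (\<lambda>p. snd (L1 p)) Cover" "\<And>p. p \<in> Cover \<Longrightarrow> L1 p \<in> Cover"
    and 2: "hol2 (\<lambda>p. fst (L2 p)) Cover" "hol2 (\<lambda>p. snd (L2 p)) Cover" "\<And>p. p \<in> Cover \<Longrightarrow> L2 p \<in> Cover"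
    using assms by (auto simp: deck_map_def)
  show "L1 (L2 p) \<in> Cover" if "p \<in> Cover" for p using 1 2 that by blast
  show "hol2 (\<lambda>p. fst (L1 (L2 p))) Cover" "hol2 (\<lambda>p. snd (L1 (L2 p))) Cover"
    using hol2_compose2[OF 1(1) 2(1,2)] hol2_compose2[OF 1(2) 2(1,2)] 2(3) by simp_all
  fix p assume p: "p \<in> Cover"
  have "L2 (Rot (2 * pi) p) = Rot (2 * pi * b) (L2 p)" using assms(2) p by (simp add: deck_map_def)
  thus "L1 (L2 (Rot (2 * pi) p)) = Rot (2 * pi * of_int (a * b)) (L1 (L2 p))"
    using deck_map_Rot_int[OF assms(1) 2(3)[OF p], of b] by simp
qed

lemma deck_map_Rot: "deck_map 1 (Rot \<theta>)"
proof -
  have "hol2 (\<lambda>p. fst (Rot \<theta> p)) Cover" "hol2 (\<lambda>p. snd (Rot \<theta> p)) Cover"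
    unfolding Rot_def fst_conv snd_conv by (intro hol2_intros)+
  thus ?thesis by (simp add: deck_map_def Rot_Rot add.commute)
qed

lemma deck_map_Cj: assumes "deck_map a L1" shows "deck_map a (\<lambda>p. Cj (L1 (Cj p)))"
proof -
  have 1: "hol2 (\<lambda>p. fst (L1 p)) Cover" "hol2 (\<lambda>p. snd (L1 p)) Cover" "\<And>p. p \<in> Cover \<Longrightarrow> L1 p \<in> Cover"
    "\<And>p. p \<in> Cover \<Longrightarrow> L1 (Rot (2 * pi) p) = Rot (2 * pi * a) (L1 p)"
    using assms by (auto simp: deck_map_def)
  have "hol2 (\<lambda>p. fst (Cj (L1 (Cj p)))) Cover" "hol2 (\<lambda>p. snd (Cj (L1 (Cj p)))) Cover"
    using hol2_uminus[OF hol2_cnj_Cj[OF 1(1)]] hol2_cnj_Cj[OF 1(2)] by (simp_all add: Cj_def[of "L1 _"])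
  thus ?thesis using 1(3,4) by (simp add: deck_map_def Cj_Rot)
qed

end

text \<open>A decreasing involution would exchange the two ends of the interval.\<close>
lemma continuous_involution_fixing_infinity:
  fixes G :: "real \<Rightarrow> real"
  assumes cont: "continuous_on {a<..} G" and dom: "\<And>x. x > a \<Longrightarrow> G x > a" and inv: "\<And>x. x > a \<Longrightarrow> G (G x) = x"
    and lim: "\<And>M. \<exists>x>M. G x > M" and x: "x > a"
  shows "G x = x"
proof (rule ccontr)
  assume ne: "G x \<noteq> x"
  obtain u v where uv: "a < u" "u < v" "G u = v" "G v = u"
  proof (cases "x < G x")
    case True thus thesis using that[of x "G x"] x inv by auto
  next
    case False thus thesis using that[of "G x" x] x dom inv ne by auto
  qed
  obtain R where R: "R > v" "G R > v" using lim by blast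
  have "inj_on G {u..R}"
    by (rule inj_on_inverseI[of _ G]) (use inv uv in auto)
  moreover have "continuous_on {u..R} G" by (rule continuous_on_subset[OF cont]) (use uv in auto)
  ultimately have "(G u < G v \<and> G v < G R) \<or> (G R < G v \<and> G v < G u)"
    using continuous_inj_imp_mono[of u v R G] uv R by auto
  thus False using uv R by auto
qed

context deck_pair
begin

text \<open>The conjugate of a rotation by \<open>L\<close> has degree one, whatever the degree of \<open>L\<close> is.\<close>
lemma L_Rot_normalises:
  obtains \<phi> where "\<And>p. p \<in> Cover \<Longrightarrow> L (Rot \<theta> p) = Rot \<phi> (L p)"
proof -
  have dm: "deck_map (n * (1 * n)) (\<lambda>p. L (Rot x (L' p)))" for x
    by (rule deck_map_comp[OF L deck_map_comp[OF deck_map_Rot L']])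
  interpret A: deck_pair \<mu> \<eta> "\<lambda>p. L (Rot \<theta> (L' p))" "\<lambda>p. L (Rot (- \<theta>) (L' p))" 1
    by unfold_locales (use dm nn L'L LL' in \<open>auto simp: Rot_Rot\<close>)
  obtain \<phi> where "\<And>p. p \<in> Cover \<Longrightarrow> L (Rot \<theta> (L' p)) = Rot \<phi> p" using A.degree_one_imp_Rot by blast
  hence "L (Rot \<theta> p) = Rot \<phi> (L p)" if "p \<in> Cover" for p using L'L[OF that] L_Cover[OF that] by metis
  thus thesis using that by blast
qed

lemma L_squared:
  obtains c where "\<And>p. p \<in> Cover \<Longrightarrow> L (L p) = Rot c p"
proof -
  have dm: "deck_map (n * n) (\<lambda>p. L (L p))" "deck_map (n * n) (\<lambda>p. L' (L' p))"
    by (rule deck_map_comp[OF L L] deck_map_comp[OF L' L'])+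
  interpret A: deck_pair \<mu> \<eta> "\<lambda>p. L (L p)" "\<lambda>p. L' (L' p)" 1
    by unfold_locales (use dm nn L'L LL' in auto)
  show thesis using A.degree_one_imp_Rot that by blast
qed

lemma L_Cj:
  obtains \<phi> where "\<And>p. p \<in> Cover \<Longrightarrow> Cj (L (Cj p)) = Rot \<phi> (L p)"
proof -
  have dm: "deck_map (n * n) (\<lambda>p. Cj (L (Cj (L' p))))" "deck_map (n * n) (\<lambda>p. L (Cj (L' (Cj p))))"
    using deck_map_comp[OF deck_map_Cj[OF L] L'] deck_map_comp[OF L deck_map_Cj[OF L']] by simp_all
  interpret A: deck_pair \<mu> \<eta> "\<lambda>p. Cj (L (Cj (L' p)))" "\<lambda>p. L (Cj (L' (Cj p)))" 1
    by unfold_locales (use dm nn L'L LL' in auto)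
  obtain \<phi> where "\<And>p. p \<in> Cover \<Longrightarrow> Cj (L (Cj (L' p))) = Rot \<phi> p" using A.degree_one_imp_Rot by blast
  hence "Cj (L (Cj p)) = Rot \<phi> (L p)" if "p \<in> Cover" for p using L'L[OF that] L_Cover[OF that] by metis
  thus thesis using that by blast
qed

lemma real_points: assumes "v > 1/2" shows "(0, complex_of_real v) \<in> Cover"
  using assms mu by (subst Cover_flat) (auto simp: emod_def)

text \<open>The points \<open>(0, v)\<close> are fixed by \<open>Cj\<close>, and \<open>L\<close> commutes with \<open>Cj\<close> up to a rotation; comparison of
the imaginary parts of the first coordinates shows that the rotation is trivial.\<close>
lemma L_real_points:
  assumes v: "v > 1/2"
  obtains \<theta> G where "G > 1/2" "L (0, of_real v) = Rot \<theta> (0, of_real G)"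
proof -
  define p where "p = (0::complex, complex_of_real v)"
  have p: "p \<in> Cover" using real_points[OF v] by (simp add: p_def)
  obtain \<phi> where "\<And>p. p \<in> Cover \<Longrightarrow> Cj (L (Cj p)) = Rot \<phi> (L p)" using L_Cj by blast
  from this[OF p] have eq: "Cj (L p) = Rot \<phi> (L p)" by (simp add: p_def Cj_def)
  define X Y where "X = fst (L p)" and "Y = snd (L p)"
  have X: "- cnj X = X + \<i> * \<phi>" and Y: "cnj Y = of_real (exp (- 2 * \<phi>)) * Y"
    using eq by (simp_all add: Cj_def Rot_def X_def Y_def)
  have phi: "\<phi> = 0" and X0: "Re X = 0" using X by (auto simp: complex_eq_iff)
  have Y0: "Im Y = 0" using Y phi by (auto simp: complex_eq_iff)
  define \<theta> where "\<theta> = Im X"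
  define G where "G = exp (2 * \<theta>) * Re Y"
  have Lp: "L p = Rot \<theta> (0, of_real G)"
  proof (rule prod_eqI)
    show "fst (L p) = fst (Rot \<theta> (0, of_real G))" using X0 by (simp add: Rot_def X_def \<theta>_def complex_eq_iff)
    have "exp (- 2 * \<theta>) * G = Re Y" by (simp add: G_def exp_add[symmetric] mult.assoc[symmetric])
    hence "of_real (exp (- 2 * \<theta>)) * of_real G = complex_of_real (Re Y)" by (metis of_real_mult)
    thus "snd (L p) = snd (Rot \<theta> (0, of_real G))" using Y0 by (simp add: Rot_def Y_def complex_eq_iff)
  qed
  have "L p \<in> Cover" using p by simp
  hence "(0, of_real G) \<in> Cover" unfolding Lp by simp
  hence "G > 1/2" using Cover_D(1)[of 0 "of_real G"] by (simp add: emod_def)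
  thus thesis using that Lp by (simp add: p_def)
qed

lemma wcoord_real: "wcoord (0, of_real v) = 1 / of_real v"
  by (simp add: wcoord_def)

text \<open>On real points \<open>L\<close> acts, up to rotations, by a function \<open>G\<close>. It is an involution since the square of
\<open>L\<close> is a rotation, and it does not exchange the ends of the interval since \<open>L\<close> maps points near
the flat annulus to points near it.\<close>
lemma wcoord_L_real:
  assumes v: "v > 1/2" shows "wcoord (L (0, of_real v)) = 1 / of_real v"
proof -
  define G where "G = (\<lambda>v. Re (1 / wcoord (L (0, of_real v))))"
  have G: "\<exists>\<theta>. G v > 1/2 \<and> L (0, of_real v) = Rot \<theta> (0, of_real (G v))" if "v > 1/2" for v
  proof -
    obtain \<theta> g where g: "g > 1/2" "L (0, of_real v) = Rot \<theta> (0, of_real g)" using L_real_points[OF \<open>v > 1/2\<close>] by blast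
    have "G v = g" using g by (simp add: G_def wcoord_real)
    thus ?thesis using g by auto
  qed
  have wG: "wcoord (L (0, of_real v)) = 1 / of_real (G v)" if "v > 1/2" for v
    using G[OF that] by (auto simp: wcoord_real)
  have inv: "G (G v) = v" if v: "v > 1/2" for v
  proof -
    obtain \<theta> where \<theta>: "G v > 1/2" "L (0, of_real v) = Rot \<theta> (0, of_real (G v))" using G[OF v] by blast
    obtain \<phi> where \<phi>: "\<And>p. p \<in> Cover \<Longrightarrow> L (Rot \<theta> p) = Rot \<phi> (L p)" using L_Rot_normalises by blast
    obtain c where c: "\<And>p. p \<in> Cover \<Longrightarrow> L (L p) = Rot c p" using L_squared by blast
    have "wcoord (L (L (0, of_real v))) = 1 / of_real v"
      using c[OF real_points[OF v]] by (simp add: wcoord_real)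
    moreover have "wcoord (L (L (0, of_real v))) = 1 / of_real (G (G v))"
      using \<theta> \<phi>[OF real_points[OF \<theta>(1)]] wG[OF \<theta>(1)] by simp
    ultimately have "complex_of_real (G (G v)) = of_real v" by (metis div_by_1 divide_divide_eq_right mult_1)
    thus ?thesis by simp
  qed
  have cont: "continuous_on {1/2<..} G"
  proof -
    have "continuous_on {1/2<..} (\<lambda>v. wcoord (L (0, complex_of_real v)))"
      by (rule continuous_on_compose2[OF hol2_continuous_on[OF wcoord_L_hol]])
         (use real_points in \<open>auto intro!: continuous_intros\<close>)
    moreover have "wcoord (L (0, complex_of_real v)) \<noteq> 0" if "v > 1/2" for v
      using Cover_eta_wcoord(3)[OF L_Cover[OF real_points[OF that]]] .
    ultimately show ?thesis unfolding G_def by (intro continuous_intros) auto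
  qed
  have lim: "\<exists>x>M. G x > M" for M
  proof -
    obtain R :: "nat \<Rightarrow> real" where R: "\<And>k. R k \<ge> 1" "filterlim R at_top sequentially"
      "(\<lambda>k. wcoord (L (0, of_real (R k)))) \<longlonglongrightarrow> 0"
      by (rule nontangential_sequence) (assumption | rule that)+
    define M' where "M' = max M 1"
    have "\<forall>\<^sub>F k in sequentially. R k > M'" using R(2) by (simp add: filterlim_at_top_dense)
    moreover have "\<forall>\<^sub>F k in sequentially. dist (wcoord (L (0, of_real (R k)))) 0 < 1 / M'"
      by (rule tendstoD[OF R(3)]) (simp add: M'_def)
    ultimately have "\<forall>\<^sub>F k in sequentially. R k > M' \<and> dist (wcoord (L (0, of_real (R k)))) 0 < 1 / M'"
      by (rule eventually_conj)
    then obtain k where k: "R k > M'" "dist (wcoord (L (0, of_real (R k)))) 0 < 1 / M'"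
      by (auto simp: eventually_sequentially)
    have R2: "R k > 1/2" using R(1)[of k] by simp
    have "G (R k) > 1/2" using G[OF R2] by blast
    hence "1 / G (R k) < 1 / M'" using k(2) by (simp add: wG[OF R2] norm_divide)
    hence "G (R k) > M'" using \<open>G (R k) > 1/2\<close> by (simp add: M'_def field_simps)
    thus ?thesis using k(1) by (intro exI[of _ "R k"]) (auto simp: M'_def)
  qed
  have "G v = v"
    by (rule continuous_involution_fixing_infinity[OF cont _ inv lim v]) (use G in auto)
  thus ?thesis using wG[OF v] by simp
qed

text \<open>The rotations carry the real points onto a totally real surface, on which the previous lemma
applies. The identity theorem in \<open>V\<close> extends the equation to the half-planes over the
imaginary axis, and in \<open>\<zeta>\<close> from there to an open set.\<close>
lemma wcoord_L:
  assumes p: "p \<in> Cover" shows "wcoord (L p) = wcoord p"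
proof -
  define \<Phi> where "\<Phi> = (\<lambda>p. wcoord (L p) - wcoord p)"
  have wh: "hol2 wcoord Cover"
  proof -
    have "snd p \<noteq> 0" if "p \<in> Cover" for p using Cover_D(3)[of "fst p" "snd p"] that by simp
    thus ?thesis unfolding wcoord_def by (intro hol2_intros)
  qed
  have h: "hol2 \<Phi> Cover" unfolding \<Phi>_def by (intro hol2_intros wcoord_L_hol wh)
  have real0: "\<Phi> (\<i> * of_real y, of_real (exp (- 2 * y) * v)) = 0" if "v > 1/2" for y v
  proof -
    obtain \<phi> where \<phi>: "\<And>p. p \<in> Cover \<Longrightarrow> L (Rot y p) = Rot \<phi> (L p)" using L_Rot_normalises by blast
    have e: "(\<i> * of_real y, of_real (exp (- 2 * y) * v)) = Rot y (0, of_real v)" by (simp add: Rot_def)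
    show ?thesis unfolding e \<Phi>_def using \<phi>[OF real_points[OF that]] wcoord_L_real[OF that] by (simp add: wcoord_real)
  qed
  have V0: "\<Phi> (\<i> * of_real y, V) = 0" if V: "Re V > emod (\<i> * of_real y) / 2" for y V
  proof -
    define H where "H = {V. Re V > emod (\<i> * of_real y) / 2}"
    define U where "U = complex_of_real ` {emod (\<i> * of_real y) / 2 <..}"
    define a where "a = emod (\<i> * of_real y)"
    have a: "a > 0" "a = exp (- 2 * y)" by (simp_all add: a_def emod_def)
    show ?thesis
    proof (rule analytic_continuation[of "\<lambda>V. \<Phi> (\<i> * of_real y, V)" H U "of_real a"])
      show oH: "open H" unfolding H_def by (rule open_halfspace_Re_gt)
      show "connected H" unfolding H_def by (intro convex_connected convex_halfspace_Re_gt)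
      show "(\<lambda>V. \<Phi> (\<i> * of_real y, V)) holomorphic_on H"
        by (rule hol2_slice2[OF h oH]) (use mu in \<open>auto simp: H_def Cover_flat\<close>)
      show "U \<subseteq> H" by (auto simp: U_def H_def)
      show "of_real a \<in> H" using a(1) by (simp add: H_def a_def[symmetric])
      show "(of_real a :: complex) islimpt U"
        unfolding islimpt_approachable
      proof (intro allI impI)
        fix e :: real assume e: "e > 0"
        have "dist (complex_of_real (a + e / 2)) (of_real a) = e / 2"
          using e by (simp add: dist_norm)
        thus "\<exists>x'\<in>U. x' \<noteq> of_real a \<and> dist x' (of_real a) < e"
          using e a(1) by (intro bexI[of _ "of_real (a + e / 2)"]) (auto simp: U_def a_def[symmetric] simp del: of_real_add)
      qed
      show "\<Phi> (\<i> * of_real y, z) = 0" if "z \<in> U" for z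
      proof -
        obtain r where r: "z = of_real r" "r > a / 2" using \<open>z \<in> U\<close> by (auto simp: U_def a_def)
        have "\<Phi> (\<i> * of_real y, of_real (exp (- 2 * y) * (r / a))) = 0"
          by (rule real0) (use r a(1) in \<open>simp add: field_simps\<close>)
        thus ?thesis using a r(1) by (simp add: a(2)[symmetric])
      qed
    qed (use V in \<open>auto simp: H_def\<close>)
  qed
  define \<rho> where "\<rho> = min (1/4) (\<mu> / 4)"
  have \<rho>: "\<rho> > 0" "\<rho> \<le> 1/4" "\<rho> \<le> \<mu> / 4" using mu by (auto simp: \<rho>_def)
  have e12: "exp (1/2 :: real) < 3"
  proof -
    have "exp (1/2 :: real) < exp 1" by simp
    also have "\<dots> \<le> 3" by (rule exp_le)
    finally show ?thesis .
  qed
  have reg: "(x, V) \<in> Cover" "Re V > emod x / 2" if "x \<in> ball 0 \<rho>" "V \<in> ball 2 (1/2)" for x V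
  proof -
    have "\<bar>Re x\<bar> < \<rho>" "\<bar>Im x\<bar> < \<rho>"
      using that abs_Re_le_cmod[of x] abs_Im_le_cmod[of x] by auto
    note x = this
    have "\<bar>Re (2 - V)\<bar> < 1/2" using that abs_Re_le_cmod[of "2 - V"] by (auto simp: dist_norm)
    hence "\<bar>2 - Re V\<bar> < 1/2" by simp
    hence V: "Re V > 3/2" by linarith
    have "emod x \<le> exp (1/2)" using x \<rho> by (simp add: emod_def)
    hence e: "emod x < 3" using e12 by linarith
    show "Re V > emod x / 2" using e V by simp
    thus "(x, V) \<in> Cover" using x \<rho> by (subst Cover_flat) auto
  qed
  have z0: "\<Phi> (x, V) = 0" if xV: "x \<in> ball 0 \<rho>" "V \<in> ball 2 (1/2)" for x V
  proof (rule analytic_continuation[of "\<lambda>x. \<Phi> (x, V)" "ball 0 \<rho>" "(\<lambda>y. \<i> * of_real y) ` {-\<rho><..<\<rho>}" 0])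
    show "(\<lambda>x. \<Phi> (x, V)) holomorphic_on ball 0 \<rho>"
      by (rule hol2_slice1[OF h]) (use reg xV in auto)
    show "(\<lambda>y. \<i> * complex_of_real y) ` {-\<rho><..<\<rho>} \<subseteq> ball 0 \<rho>" by (auto simp: norm_mult)
    show "(0::complex) islimpt (\<lambda>y. \<i> * of_real y) ` {-\<rho><..<\<rho>}"
      unfolding islimpt_approachable
    proof (intro allI impI)
      fix e :: real assume e: "e > 0"
      define y where "y = min e \<rho> / 2"
      have y: "0 < y" "y < e" "y < \<rho>" using e \<rho> by (auto simp: y_def)
      thus "\<exists>x'\<in>(\<lambda>y. \<i> * of_real y) ` {-\<rho><..<\<rho>}. x' \<noteq> (0::complex) \<and> dist x' 0 < e"
        by (intro bexI[of _ "\<i> * of_real y"]) (auto simp: norm_mult)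
    qed
    show "\<Phi> (z, V) = 0" if "z \<in> (\<lambda>y. \<i> * of_real y) ` {-\<rho><..<\<rho>}" for z
    proof -
      obtain y where y: "z = \<i> * of_real y" "\<bar>y\<bar> < \<rho>" using \<open>z \<in> _\<close> by auto
      hence "z \<in> ball 0 \<rho>" by (simp add: norm_mult)
      from reg(2)[OF this xV(2)] show ?thesis unfolding y(1) by (rule V0)
    qed
  qed (use \<rho> xV in auto)
  have "\<Phi> p = 0"
  proof (rule Cover_identity[OF h, of 0 "ball 0 \<rho>" 2 "ball 2 (1/2)"])
    show "ball 0 \<rho> \<times> ball 2 (1/2) \<subseteq> Cover" using reg(1) by blast
  qed (use \<rho> z0 p in auto)
  thus ?thesis by (simp add: \<Phi>_def)
qed

lemma polar: "V \<noteq> 0 \<Longrightarrow> V = of_real (cmod V) * cis (Im (Ln V))"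
  using exp_Ln[of V] exp_eq_polar[of "Ln V"] by simp

text \<open>The fibre through \<open>(0, V)\<close> has the range \<open>|t + arg V| < D\<close>; the bound on \<open>|V|\<close> makes this interval
short.\<close>
lemma near_axis:
  assumes "0 < d" "d < pi / 2" "Re V > 1/2" "cmod V < 1 / (2 * cos d)"
  obtains D where "0 < D" "D < d" "cos D = 1 / (2 * cmod V)" "\<bar>Im (Ln V)\<bar> < D"
proof -
  have cd: "cos d > 0" using assms by (intro cos_gt_zero_pi) auto
  have V: "cmod V > 1/2" using assms(3) complex_Re_le_cmod[of V] by simp
  have V0: "V \<noteq> 0" using V by auto
  define D where "D = arccos (1 / (2 * cmod V))"
  have q: "- 1 \<le> 1 / (2 * cmod V)" "1 / (2 * cmod V) \<le> 1"
  proof -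
    have "0 \<le> 1 / (2 * cmod V)" by simp
    thus "- 1 \<le> 1 / (2 * cmod V)" by linarith
    show "1 / (2 * cmod V) \<le> 1" using V by (subst divide_le_eq_1_pos) auto
  qed
  have c: "cos D = 1 / (2 * cmod V)" unfolding D_def by (rule cos_arccos[OF q])
  have D: "0 \<le> D" "D \<le> pi" unfolding D_def by (rule arccos_lbound[OF q] arccos_ubound[OF q])+
  have c1: "cos D < 1" unfolding c using V by (subst divide_less_eq_1_pos) auto
  have D0: "D > 0" using D c1 by (cases "D = 0") auto
  have Dd: "D < d"
  proof (rule ccontr)
    assume "\<not> D < d"
    hence "cos D \<le> cos d" using assms D by (intro cos_monotone_0_pi_le) auto
    hence "cos D * (2 * cmod V) \<le> cos d * (2 * cmod V)" by (rule mult_right_mono) simp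
    hence "1 \<le> cos d * (2 * cmod V)" using V V0 by (simp add: c)
    moreover have "cmod V * (2 * cos d) < 1" using assms(4) cd by (subst (asm) less_divide_eq) auto
    ultimately show False by (simp add: mult_ac)
  qed
  have a: "\<bar>Im (Ln V)\<bar> \<le> pi" using mpi_less_Im_Ln[OF V0] Im_Ln_le_pi[OF V0] by linarith
  have "Re V = cmod V * cos (Im (Ln V))" using arg_cong[OF polar[OF V0], of Re] by simp
  hence "1 < cos (Im (Ln V)) * (2 * cmod V)" using assms(3) by (simp add: mult_ac)
  moreover have "2 * cmod V > 0" using V by linarith
  ultimately have "cos (Im (Ln V)) > cos D" unfolding c by (simp only: pos_divide_less_eq)
  hence "\<bar>Im (Ln V)\<bar> < D"
    using cos_monotone_0_pi_le[of D "\<bar>Im (Ln V)\<bar>"] D a by (cases "\<bar>Im (Ln V)\<bar> < D") auto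
  thus thesis using that D0 Dd c by blast
qed

lemma Re_exp_2i: assumes "V \<noteq> 0"
  shows "Re (exp (2 * \<i> * \<zeta>) * V) = emod \<zeta> * cmod V * cos (2 * Re \<zeta> + Im (Ln V))"
proof -
  have "exp (2 * \<i> * \<zeta>) * V = of_real (emod \<zeta> * cmod V) * cis (2 * Re \<zeta> + Im (Ln V))"
    unfolding exp_2i using polar[OF assms] by (metis (no_types, lifting) cis_mult mult.assoc mult.left_commute of_real_mult)
  thus ?thesis by simp
qed

text \<open>On a fibre \<open>w = const\<close> the real part of \<open>X\<close> is invariant under translation by imaginary numbers,
because \<open>L\<close> normalises the rotations. So \<open>X\<close> is affine with real slope, and the degree makes the
slope \<open>- 1\<close>. As \<open>L\<close> preserves \<open>w\<close>, it maps the interval \<open>|t + arg V| < D\<close> into itself modulo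
\<open>2 \<pi>\<close> by a reflection, which must fix the centre. This says that \<open>\<gamma> = 2 Re X(0, V) + 2 arg V\<close>
is a multiple of \<open>2 \<pi>\<close>, or that \<open>exp (2 \<i> X) V\<^sup>2\<close> is positive.\<close>
lemma reflection_on_fibre:
  assumes n: "n = - 1" and V: "Re V > 1/2" "cmod V < 1 / (2 * cos d)" and d: "0 < d" "d < pi / 2" "2 * d \<le> \<mu>"
    and D: "0 < D" "D < d" "cos D = 1 / (2 * cmod V)" "\<bar>Im (Ln V)\<bar> < D"
  shows "\<And>\<zeta>. \<bar>2 * Re \<zeta> + Im (Ln V)\<bar> < D \<Longrightarrow> fst (L (\<zeta>, exp (2 * \<i> * \<zeta>) * V)) = fst (L (0, V)) - \<zeta>"
    and "Im (exp (2 * \<i> * fst (L (0, V))) * V\<^sup>2) = 0"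
    and "Re (exp (2 * \<i> * fst (L (0, V))) * V\<^sup>2) > 0"
proof -
  define a where "a = Im (Ln V)"
  define S where "S = {\<zeta>. \<bar>2 * Re \<zeta> + a\<bar> < D}"
  have V0: "V \<noteq> 0" using V by auto
  have cV: "cmod V > 0" using V0 by simp
  have cD: "cos D > 0" using D d by (intro cos_gt_zero_pi) auto
  have "open S" "convex S" unfolding S_def by (rule open_convex_vertical_strip)+
  note S = this convex_connected[OF this(2)]
  have S0: "0 \<in> S" "2 * pi * \<i> \<in> S" using D(4) by (auto simp: S_def a_def)
  define c where "c = (\<lambda>\<zeta>. (\<zeta>, exp (2 * \<i> * \<zeta>) * V))"
  have cOm: "c \<zeta> \<in> Cover" if z: "\<zeta> \<in> S" for \<zeta>
  proof -
    have "\<bar>2 * Re \<zeta>\<bar> \<le> \<mu>" using z D d by (auto simp: S_def a_def[symmetric])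
    moreover have "cos D < cos \<bar>2 * Re \<zeta> + a\<bar>"
      by (rule cos_monotone_0_pi) (use z D d in \<open>auto simp: S_def\<close>)
    hence "1 < 2 * cmod V * cos (2 * Re \<zeta> + a)" using cV by (simp add: D(3) field_simps)
    hence "emod \<zeta> * 1 < emod \<zeta> * (2 * cmod V * cos (2 * Re \<zeta> + a))" by (intro mult_strict_left_mono) auto
    hence "emod \<zeta> < 2 * Re (exp (2 * \<i> * \<zeta>) * V)" unfolding Re_exp_2i[OF V0] a_def by (simp add: mult_ac)
    ultimately show ?thesis unfolding c_def using Cover_flat by blast
  qed
  have cRot: "c (\<zeta> + \<i> * of_real y) = Rot y (c \<zeta>)" for \<zeta> y
    using exp_2i_shift[of \<zeta> y] by (simp add: c_def Rot_def)
  define x where "x = (\<lambda>\<zeta>. fst (L (c \<zeta>)))"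
  have xh: "x holomorphic_on S" unfolding x_def c_def
    by (rule hol2_curve[OF X_hol S(1)]) (use cOm in \<open>auto simp: c_def intro!: holomorphic_intros\<close>)
  have xper: "Re (x (\<zeta> + \<i> * of_real y)) = Re (x \<zeta>)" if "\<zeta> \<in> S" for \<zeta> y
  proof -
    obtain \<phi> where "\<And>p. p \<in> Cover \<Longrightarrow> L (Rot y p) = Rot \<phi> (L p)" using L_Rot_normalises by blast
    thus ?thesis using cOm[OF that] by (simp add: x_def cRot Rot_def)
  qed
  have dx: "Im (deriv x \<zeta>) = 0" if z: "\<zeta> \<in> S" for \<zeta>
  proof -
    have l: "((\<lambda>y::real. \<zeta> + \<i> * of_real y) has_vector_derivative \<i>) (at 0)"
      by (auto intro!: derivative_eq_intros)
    have "(x has_field_derivative deriv x \<zeta>) (at (\<zeta> + \<i> * of_real 0))"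
      using holomorphic_derivI[OF xh S(1) z] by simp
    from field_vector_diff_chain_at[OF l this]
    have "((\<lambda>y. x (\<zeta> + \<i> * of_real y)) has_vector_derivative \<i> * deriv x \<zeta>) (at 0)" by (simp add: o_def)
    from bounded_linear.has_vector_derivative[OF bounded_linear_Re this]
    have "((\<lambda>y. Re (x \<zeta>)) has_real_derivative - Im (deriv x \<zeta>)) (at 0)"
      unfolding xper[OF z] has_real_derivative_iff_has_vector_derivative by simp
    thus ?thesis using DERIV_unique[OF _ DERIV_const] by fastforce
  qed
  obtain A where A: "\<And>\<zeta>. \<zeta> \<in> S \<Longrightarrow> deriv x \<zeta> = A"
    using holomorphic_real_valued_constant[OF holomorphic_deriv[OF xh S(1)] S(1,3) dx]
    unfolding constant_on_def by blast
  obtain B where B: "\<And>\<zeta>. \<zeta> \<in> S \<Longrightarrow> x \<zeta> - A * \<zeta> = B"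
  proof -
    have "(\<lambda>\<zeta>. x \<zeta> - A * \<zeta>) constant_on S"
    proof (rule has_field_derivative_0_imp_constant_on[OF _ S(3,1)])
      fix \<zeta> assume z: "\<zeta> \<in> S"
      have "(x has_field_derivative A) (at \<zeta>)" using holomorphic_derivI[OF xh S(1) z] A[OF z] by simp
      thus "((\<lambda>\<zeta>. x \<zeta> - A * \<zeta>) has_field_derivative 0) (at \<zeta>)"
        by (auto intro!: derivative_eq_intros)
    qed
    thus thesis using that unfolding constant_on_def by blast
  qed
  have "c (0 + \<i> * of_real (2 * pi)) = Rot (2 * pi) (c 0)" by (rule cRot)
  hence "x (2 * pi * \<i>) = x 0 - 2 * pi * \<i>"
    using deck_map_Rot_int[OF L cOm[OF S0(1)], of 1] by (simp add: x_def n Rot_def mult_ac)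
  moreover have "x (2 * pi * \<i>) - A * (2 * pi * \<i>) = x 0" using B[OF S0(1)] B[OF S0(2)] by simp
  ultimately have "(A + 1) * (2 * pi * \<i>) = 0" by (simp add: algebra_simps)
  hence A1: "A = - 1" by (simp add: add_eq_0_iff2)
  have c0: "c 0 = (0, V)" by (simp add: c_def)
  have x: "x \<zeta> = x 0 - \<zeta>" if "\<zeta> \<in> S" for \<zeta>
    using B[OF that] B[OF S0(1)] A1 by (simp add: algebra_simps)
  thus "\<And>\<zeta>. \<bar>2 * Re \<zeta> + Im (Ln V)\<bar> < D \<Longrightarrow> fst (L (\<zeta>, exp (2 * \<i> * \<zeta>) * V)) = fst (L (0, V)) - \<zeta>"
    using c0 by (simp add: S_def a_def x_def c_def)
  define \<gamma> where "\<gamma> = 2 * Re (x 0) + 2 * a"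
  have cg: "cos D \<le> cos (\<gamma> - \<tau>)" if t: "\<tau> \<in> {- D<..<D}" for \<tau>
  proof -
    define \<zeta> where "\<zeta> = complex_of_real ((\<tau> - a) / 2)"
    have z1: "2 * Re \<zeta> + a = \<tau>" by (simp add: \<zeta>_def field_simps)
    hence z: "\<zeta> \<in> S" using t by (simp add: S_def abs_less_iff)
    have Y: "snd (L (c \<zeta>)) \<noteq> 0"
      using Cover_D(3)[of "fst (L (c \<zeta>))" "snd (L (c \<zeta>))"] L_Cover[OF cOm[OF z]] by simp
    have "wcoord (L (c \<zeta>)) = 1 / V"
      unfolding wcoord_L[OF cOm[OF z]] using V0 by (simp add: wcoord_def c_def)
    hence "snd (L (c \<zeta>)) = exp (2 * \<i> * x \<zeta>) * V"
      using Y V0 by (simp add: wcoord_def x_def field_simps)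
    moreover have "2 * Re (snd (L (c \<zeta>))) > emod (x \<zeta>)"
      using Cover_D(1)[of "fst (L (c \<zeta>))" "snd (L (c \<zeta>))"] L_Cover[OF cOm[OF z]] by (simp add: x_def)
    ultimately have "2 * Re (exp (2 * \<i> * x \<zeta>) * V) > emod (x \<zeta>)" by (simp only:)
    hence "2 * (emod (x \<zeta>) * cmod V * cos (2 * Re (x \<zeta>) + a)) > emod (x \<zeta>)"
      unfolding Re_exp_2i[OF V0] a_def .
    hence "emod (x \<zeta>) * 1 < emod (x \<zeta>) * (2 * cmod V * cos (2 * Re (x \<zeta>) + a))" by (simp add: mult_ac)
    hence "1 < 2 * cmod V * cos (2 * Re (x \<zeta>) + a)" by (subst (asm) mult_less_cancel_left_pos) auto
    hence "cos D < cos (2 * Re (x \<zeta>) + a)" using cV by (simp add: D(3) field_simps)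
    also have "2 * Re (x \<zeta>) + a = \<gamma> - \<tau>"
    proof -
      have "Re (x \<zeta>) = Re (x 0) - Re \<zeta>" using x[OF z] by simp
      thus ?thesis using z1 unfolding \<gamma>_def by linarith
    qed
    finally show ?thesis by simp
  qed
  have cg': "cos D \<le> cos (\<gamma> - \<tau>)" if "\<tau> \<in> {- D..D}" for \<tau>
    by (rule continuous_ge_on_closure[of "{- D<..<D}" "\<lambda>\<tau>. cos (\<gamma> - \<tau>)"])
       (use that D(1) cg in \<open>auto intro!: continuous_intros\<close>)
  have "2 * cos D \<le> cos (\<gamma> - D) + cos (\<gamma> - (- D))" using cg'[of D] cg'[of "- D"] D(1) by simp
  also have "\<dots> = 2 * cos \<gamma> * cos D" by (simp add: cos_add cos_diff)
  finally have "1 \<le> cos \<gamma>" using cD by simp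
  hence cos1: "cos \<gamma> = 1" using cos_le_one[of \<gamma>] by linarith
  hence sin0: "sin \<gamma> = 0" using sin_cos_squared_add[of \<gamma>] by simp
  have "exp (2 * \<i> * x 0) * V\<^sup>2 = of_real (emod (x 0) * (cmod V)\<^sup>2) * cis \<gamma>"
  proof -
    have "V\<^sup>2 = of_real ((cmod V)\<^sup>2) * cis (2 * a)"
    proof -
      have "V\<^sup>2 = (of_real (cmod V) * cis a)\<^sup>2"
        unfolding a_def by (rule arg_cong[where f = "\<lambda>z. z\<^sup>2", OF polar[OF V0]])
      also have "\<dots> = of_real ((cmod V)\<^sup>2) * (cis a * cis a)" by (simp add: power2_eq_square mult_ac)
      also have "cis a * cis a = cis (2 * a)" by (simp add: cis_mult)
      finally show ?thesis .
    qed
    hence "exp (2 * \<i> * x 0) * V\<^sup>2 = of_real (emod (x 0) * (cmod V)\<^sup>2) * (cis (2 * Re (x 0)) * cis (2 * a))"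
      unfolding exp_2i by (simp add: mult_ac)
    thus ?thesis by (simp add: cis_mult \<gamma>_def)
  qed
  hence e: "exp (2 * \<i> * x 0) * V\<^sup>2 = of_real (emod (x 0) * (cmod V)\<^sup>2)"
    using cos1 sin0 by (simp add: complex_eq_iff)
  hence e': "exp (2 * \<i> * fst (L (0, V))) * V\<^sup>2 = of_real (emod (x 0) * (cmod V)\<^sup>2)"
    by (simp add: x_def c0)
  show "Im (exp (2 * \<i> * fst (L (0, V))) * V\<^sup>2) = 0" "Re (exp (2 * \<i> * fst (L (0, V))) * V\<^sup>2) > 0"
    unfolding e' using cV by (simp_all del: of_real_mult)
qed

end

context deck_pair
begin

text \<open>A holomorphic function with positive values is constant, so \<open>exp (2 \<i> X) V\<^sup>2 = C\<close> at \<open>\<zeta> = 0\<close> for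
\<open>V\<close> slightly to the right of \<open>1/2\<close>. The reflection extends this to
\<open>exp (2 \<i> X) V\<^sup>2 = C exp (2 \<i> \<zeta>)\<close> near these points and then everywhere, which determines
\<open>2 Re X = t - 2 arg V + 2 \<pi> j\<close>. Letting \<open>V\<close> tend to infinity shows \<open>|2 Re X| \<le> \<mu>\<close> for all
\<open>|t| \<le> \<mu>\<close> and \<open>|arg V| < \<pi>/2\<close>, but the right-hand side varies by more than \<open>2 \<mu>\<close>.\<close>
theorem degree_not_minus_one: "n \<noteq> - 1"
proof
  assume n: "n = - 1"
  \<comment> \<open>with this \<open>d\<close> the fibres through \<open>U\<close> stay in \<open>|t| < 2 d \<le> \<mu>\<close>, over the flat part\<close>
  define d where "d = min \<mu> 1 / 4"
  have d: "0 < d" "d < pi / 2" "2 * d \<le> \<mu>" "4 * d \<le> 1" using mu pi_gt3 by (auto simp: d_def)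
  have cd: "cos d > 0" "cos d < 1"
  proof -
    show "cos d > 0" using d by (intro cos_gt_zero_pi) auto
    show "cos d < 1" using cos_monotone_0_pi[of 0 d] d by simp
  qed
  define U where "U = {V. Re V > 1/2} \<inter> ball 0 (1 / (2 * cos d))"
  have U: "open U" "connected U"
    unfolding U_def by (intro open_Int open_halfspace_Re_gt open_ball convex_connected convex_Int
        convex_halfspace_Re_gt convex_ball)+
  have UD: "Re V > 1/2" "cmod V < 1 / (2 * cos d)" if "V \<in> U" for V using that by (auto simp: U_def)
  obtain V1 where V1: "1/2 < V1" and V1': "V1 < 1 / (2 * cos d)"
  proof -
    have "1/2 < 1 / (2 * cos d)" using cd by (simp add: field_simps)
    from dense[OF this] show thesis using that by blast
  qed
  have V1U: "of_real V1 \<in> U" using V1 V1' by (simp add: U_def)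
  define X where "X = (\<lambda>p. fst (L p))"
  define E where "E = (\<lambda>V. exp (2 * \<i> * X (0, V)) * V\<^sup>2)"
  have refl: "\<exists>D. 0 < D \<and> D < d \<and> cos D = 1 / (2 * cmod V) \<and>
      (\<forall>\<zeta>. \<bar>2 * Re \<zeta> + Im (Ln V)\<bar> < D \<longrightarrow> X (\<zeta>, exp (2 * \<i> * \<zeta>) * V) = X (0, V) - \<zeta>) \<and>
      Im (E V) = 0 \<and> Re (E V) > 0 \<and> \<bar>Im (Ln V)\<bar> < D" if V: "V \<in> U" for V
  proof -
    obtain D where D: "0 < D" "D < d" "cos D = 1 / (2 * cmod V)" "\<bar>Im (Ln V)\<bar> < D"
      using near_axis[OF d(1,2) UD[OF V]] by blast
    thus ?thesis using reflection_on_fibre[OF n UD[OF V] d(1,2,3) D] unfolding X_def E_def by blast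
  qed
  obtain C where C: "\<And>V. V \<in> U \<Longrightarrow> E V = C"
  proof -
    have "E constant_on U"
    proof (rule holomorphic_real_valued_constant[OF _ U])
      have "(\<lambda>V. X (0, V)) holomorphic_on U"
        unfolding X_def
      proof (rule hol2_slice2[OF X_hol U(1)])
        show "(0, V) \<in> Cover" if "V \<in> U" for V
          using UD(1)[OF that] mu by (subst Cover_flat) (auto simp: emod_def)
      qed
      thus "E holomorphic_on U" unfolding E_def by (intro holomorphic_intros)
    qed (use refl in blast)
    thus thesis using that unfolding constant_on_def by blast
  qed
  have Cpos: "Im C = 0" "Re C > 0" using refl[OF V1U] C[OF V1U] by auto
  have C0: "C \<noteq> 0" using Cpos by auto
  define O1 where "O1 = {p. \<bar>2 * Re (fst p)\<bar> < d} \<inter> {p. emod (fst p) < 2 * Re (snd p)} \<inter>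
      {p. 1/2 < Re (exp (- 2 * \<i> * fst p) * snd p)} \<inter> {p. cmod (exp (- 2 * \<i> * fst p) * snd p) < 1 / (2 * cos d)}"
  have O1: "open O1" unfolding O1_def
    by (intro open_Int open_Collect_less continuous_intros)
  have O1ne: "(0, of_real V1) \<in> O1" using V1 V1' d by (simp add: O1_def emod_def)
  have O1sub: "O1 \<subseteq> Cover"
  proof
    fix p assume "p \<in> O1"
    hence "\<bar>2 * Re (fst p)\<bar> \<le> \<mu>" "emod (fst p) < 2 * Re (snd p)" using d by (auto simp: O1_def)
    thus "p \<in> Cover" using Cover_flat[of "fst p" "snd p"] by simp
  qed
  have form0: "exp (2 * \<i> * X p) * (snd p)\<^sup>2 - C * exp (2 * \<i> * fst p) = 0" if p: "p \<in> O1" for p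
  proof -
    obtain \<zeta> V where pe: "p = (\<zeta>, V)" by (cases p)
    define V' where "V' = exp (- 2 * \<i> * \<zeta>) * V"
    have VV': "V = exp (2 * \<i> * \<zeta>) * V'" by (simp add: V'_def mult.assoc[symmetric] exp_add[symmetric])
    have V'U: "V' \<in> U" using p by (simp add: pe O1_def U_def V'_def)
    have V'0: "V' \<noteq> 0" "cmod V' > 0" using UD(1)[OF V'U] by auto
    obtain D where D: "0 < D" "D < d" "cos D = 1 / (2 * cmod V')" "\<bar>Im (Ln V')\<bar> < D"
      "\<And>\<zeta>. \<bar>2 * Re \<zeta> + Im (Ln V')\<bar> < D \<Longrightarrow> X (\<zeta>, exp (2 * \<i> * \<zeta>) * V') = X (0, V') - \<zeta>"
      using refl[OF V'U] by blast
    have "emod \<zeta> < 2 * Re V" using p by (simp add: pe O1_def)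
    also have "Re V = emod \<zeta> * cmod V' * cos (2 * Re \<zeta> + Im (Ln V'))" unfolding VV' by (rule Re_exp_2i[OF V'0(1)])
    finally have "emod \<zeta> * 1 < emod \<zeta> * (2 * cmod V' * cos (2 * Re \<zeta> + Im (Ln V')))" by (simp add: mult_ac)
    hence "1 < 2 * cmod V' * cos (2 * Re \<zeta> + Im (Ln V'))" by (subst (asm) mult_less_cancel_left_pos) auto
    hence "cos D < cos \<bar>2 * Re \<zeta> + Im (Ln V')\<bar>" using V'0(2) by (simp add: D(3) field_simps)
    moreover have "\<bar>2 * Re \<zeta> + Im (Ln V')\<bar> \<le> pi"
      using p D d pi_gt3 by (auto simp: pe O1_def)
    ultimately have "\<bar>2 * Re \<zeta> + Im (Ln V')\<bar> < D"
      using cos_monotone_0_pi_le[of D "\<bar>2 * Re \<zeta> + Im (Ln V')\<bar>"] D(1) by (meson not_le less_imp_le)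
    from D(5)[OF this] have XX: "X (\<zeta>, V) = X (0, V') - \<zeta>" by (simp add: VV')
    have "exp (2 * \<i> * X (\<zeta>, V)) * V\<^sup>2 = exp (2 * \<i> * X (0, V')) * exp (- (2 * \<i> * \<zeta>)) * (exp (2 * \<i> * \<zeta>) * V')\<^sup>2"
      unfolding XX by (simp add: VV' right_diff_distrib exp_diff exp_minus field_simps)
    also have "\<dots> = (exp (- (2 * \<i> * \<zeta>)) * exp (2 * \<i> * \<zeta>)) * exp (2 * \<i> * \<zeta>) * E V'"
      by (simp add: E_def power2_eq_square mult_ac)
    also have "\<dots> = C * exp (2 * \<i> * \<zeta>)" using C[OF V'U] by (simp add: exp_minus)
    finally show ?thesis by (simp add: pe)
  qed
  have form: "exp (2 * \<i> * X p) * (snd p)\<^sup>2 = C * exp (2 * \<i> * fst p)" if p: "p \<in> Cover" for p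
  proof -
    have "hol2 (\<lambda>p. exp (2 * \<i> * X p) * (snd p)\<^sup>2 - C * exp (2 * \<i> * fst p)) Cover"
      unfolding X_def power2_eq_square by (intro hol2_intros X_hol)
    from hol2_identity[OF this open_Cover connected_Cover O1 _ O1sub form0 p] O1ne
    show ?thesis by auto
  qed
  define h where "h = (\<lambda>p. 2 * \<i> * X p + 2 * Ln (snd p) - 2 * \<i> * fst p - Ln C)"
  have sndp: "Re (snd p) > 0" "snd p \<noteq> 0" if "p \<in> Cover" for p
    using Cover_D(2,3)[of "fst p" "snd p"] that by simp_all
  have "continuous_on Cover h"
    unfolding h_def X_def
    by (intro continuous_intros hol2_continuous_on[OF X_hol])
       (use sndp in \<open>auto simp: complex_nonpos_Reals_iff not_le\<close>)
  moreover have "exp (h p) = 1" if p: "p \<in> Cover" for p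
  proof -
    have "exp (2 * Ln (snd p)) = (snd p)\<^sup>2"
      by (simp only: mult_2 exp_add exp_Ln[OF sndp(2)[OF p]] power2_eq_square)
    hence "exp (h p) = exp (2 * \<i> * X p) * (snd p)\<^sup>2 / exp (2 * \<i> * fst p) / C"
      using C0 by (simp add: h_def exp_add exp_diff)
    thus ?thesis unfolding form[OF p] using C0 by simp
  qed
  ultimately obtain j :: int where j: "\<And>p. p \<in> Cover \<Longrightarrow> h p = 2 * pi * j * \<i>"
    using exp_eq_1_imp_const_int[OF connected_Cover] by blast
  have LnC: "Im (Ln C) = 0"
  proof -
    have "C = of_real (Re C)" using Cpos(1) by (simp add: complex_eq_iff)
    thus ?thesis using Ln_of_real[OF Cpos(2)] by (metis Im_complex_of_real)
  qed
  have u: "2 * Re (X p) = 2 * Re (fst p) - 2 * Im (Ln (snd p)) + 2 * pi * j" if "p \<in> Cover" for p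
    using arg_cong[OF j[OF that], of Im] LnC by (simp add: h_def)
  have bound: "\<bar>t - 2 * b + 2 * pi * j\<bar> \<le> \<mu>" if t: "\<bar>t\<bar> \<le> \<mu>" and b: "\<bar>b\<bar> < pi / 2" for t b
  proof -
    have cb: "cos b > 0" using b by (intro cos_gt_zero_pi) auto
    define v where "v = t - 2 * b + 2 * pi * j"
    have small: "\<eta> v \<le> 2 / R" if R: "R > 1 / cos b" for R
    proof -
      have R0: "R > 0" using R cb by (meson divide_pos_pos less_trans zero_less_one)
      define p where "p = (complex_of_real (t / 2), of_real R * cis b)"
      have "1 < 2 * (R * cos b)" using R cb R0 by (simp add: field_simps)
      hence pOm: "p \<in> Cover" unfolding p_def using t by (subst Cover_flat) (auto simp: emod_def)
      have "cis b = exp (\<i> * of_real b)" by (rule cis_conv_exp)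
      hence "Ln (of_real R * cis b) = of_real (ln R) + \<i> * of_real b"
        using R0 b pi_gt_zero by (subst Ln_times_of_real) (auto simp: Ln_exp Ln_of_real abs_less_iff)
      hence "2 * Re (X p) = v" using u[OF pOm] by (simp add: p_def v_def)
      moreover have "\<eta> (2 * Re (fst (L p))) < 2 * cmod (wcoord (L p))" by (rule Cover_eta_wcoord(1)[OF L_Cover[OF pOm]])
      moreover have "cmod (wcoord (L p)) = 1 / R"
        unfolding wcoord_L[OF pOm] norm_wcoord using R0 by (simp add: p_def emod_def norm_mult)
      ultimately show ?thesis by (simp add: X_def)
    qed
    have "\<eta> v \<le> 0"
    proof (rule tendsto_lowerbound)
      show "((\<lambda>R. 2 / R) \<longlongrightarrow> 0) (at_top :: real filter)" by real_asymp
      show "\<forall>\<^sub>F R in at_top. \<eta> v \<le> 2 / R"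
        using eventually_gt_at_top[of "1 / cos b"] by eventually_elim (rule small)
    qed simp
    hence "\<eta> v = 0" using eta_nonneg[of v] by simp
    thus ?thesis using eta_eq_0[of v] by (simp add: v_def)
  qed
  have "\<bar>\<mu> - 2 * (- 1) + 2 * pi * j\<bar> \<le> \<mu>" "\<bar>- \<mu> - 2 * 1 + 2 * pi * j\<bar> \<le> \<mu>"
    using bound[of \<mu> "- 1"] bound[of "- \<mu>" 1] mu pi_gt3 by auto
  thus False by linarith
qed

end

section \<open>Automorphisms of the worm domain\<close>

lemma holomorphic2_on_imp_hol2:
  assumes "f holomorphic2_on S" "open S"
  shows "hol2 (\<lambda>p. fst (f p)) S" "hol2 (\<lambda>p. snd (f p)) S"
proof -
  have "\<exists>a b c d. (f has_derivative (\<lambda>v. (a * fst v + b * snd v, c * fst v + d * snd v))) (at p)"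
    if p: "p \<in> S" for p
  proof -
    from assms(1) p obtain D where D0: "(f has_derivative D) (at p within S) \<and> (\<forall>c v. D (cscale2 c v) = cscale2 c (D v))"
      unfolding holomorphic2_on_def by blast
    note D = D0[THEN conjunct1] D0[THEN conjunct2, rule_format]
    have D': "(f has_derivative D) (at p)" using D(1) by (simp only: at_within_open[OF p assms(2)])
    have lin: "linear D" using has_derivative_linear[OF D'] .
    have "D v = (fst (D (1, 0)) * fst v + fst (D (0, 1)) * snd v, snd (D (1, 0)) * fst v + snd (D (0, 1)) * snd v)" for v
    proof -
      have e: "cscale2 (fst v) (1, 0) + cscale2 (snd v) (0, 1) = v" by (simp add: cscale2_def)
      have "D v = cscale2 (fst v) (D (1, 0)) + cscale2 (snd v) (D (0, 1))"
        using linear_add[OF lin, of "cscale2 (fst v) (1, 0)" "cscale2 (snd v) (0, 1)"] unfolding e D(2) .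
      also have "\<dots> = (fst (D (1, 0)) * fst v + fst (D (0, 1)) * snd v, snd (D (1, 0)) * fst v + snd (D (0, 1)) * snd v)"
        by (simp add: cscale2_def mult.commute)
      finally show ?thesis .
    qed
    hence "D = (\<lambda>v. (fst (D (1, 0)) * fst v + fst (D (0, 1)) * snd v, snd (D (1, 0)) * fst v + snd (D (0, 1)) * snd v))"
      by (rule ext)
    with D' have "(f has_derivative (\<lambda>v. (fst (D (1, 0)) * fst v + fst (D (0, 1)) * snd v, snd (D (1, 0)) * fst v + snd (D (0, 1)) * snd v))) (at p)"
      by (rule has_derivative_eq_rhs)
    thus ?thesis by blast
  qed
  note * = this
  show "hol2 (\<lambda>p. fst (f p)) S" "hol2 (\<lambda>p. snd (f p)) S"
    unfolding hol2_def
  proof safe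
    fix x y assume "(x, y) \<in> S"
    from *[OF this] obtain a b c d where
      "(f has_derivative (\<lambda>v. (a * fst v + b * snd v, c * fst v + d * snd v))) (at (x, y))" by blast
    from has_derivative_fst[OF this] has_derivative_snd[OF this]
    have "((\<lambda>p. fst (f p)) has_derivative (\<lambda>v. a * fst v + b * snd v)) (at (x, y))"
      "((\<lambda>p. snd (f p)) has_derivative (\<lambda>v. c * fst v + d * snd v)) (at (x, y))" by simp_all
    thus "\<exists>a b. ((\<lambda>p. fst (f p)) has_derivative (\<lambda>v. a * fst v + b * snd v)) (at (x, y))"
      "\<exists>a b. ((\<lambda>p. snd (f p)) has_derivative (\<lambda>v. a * fst v + b * snd v)) (at (x, y))" by blast+
  qed
qed

lemma hol2_continuous_log:
  assumes f: "hol2 f S" and S: "open S" and g: "continuous_on S g" "\<And>p. p \<in> S \<Longrightarrow> f p = exp (g p)"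
  shows "hol2 g S"
  unfolding hol2_def
proof
  fix p assume p: "p \<in> S"
  define N where "N = S \<inter> (\<lambda>q. g q - g p) -` ball 0 1"
  have N: "open N" unfolding N_def
    by (intro continuous_open_preimage S open_ball continuous_intros g(1))
  have pN: "p \<in> N" using p by (simp add: N_def)
  have eq: "g q = g p + Ln (f q / f p)" if q: "q \<in> N" for q
  proof -
    have "cmod (g q - g p) < 1" using q by (simp add: N_def)
    hence "\<bar>Im (g q - g p)\<bar> < 1" using abs_Im_le_cmod[of "g q - g p"] by linarith
    hence "Ln (exp (g q - g p)) = g q - g p" using pi_gt3 by (intro Ln_exp) auto
    moreover have "f q / f p = exp (g q - g p)" using g(2) q p by (simp add: N_def exp_diff)
    ultimately show ?thesis by simp
  qed
  have "hol2 (\<lambda>q. g p + Ln (f q / f p)) {p}"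
  proof -
    have "f p \<noteq> 0" using g(2)[OF p] by simp
    thus ?thesis by (intro hol2_intros hol2_Ln hol2_subset[OF f]) (use p in auto)
  qed
  then obtain a b where "((\<lambda>q. g p + Ln (f q / f p)) has_derivative (\<lambda>v. a * fst v + b * snd v)) (at p)"
    unfolding hol2_def by blast
  hence "(g has_derivative (\<lambda>v. a * fst v + b * snd v)) (at p)"
    by (rule has_derivative_transform_within_open[OF _ N pN]) (use eq in simp)
  thus "\<exists>a b. (g has_derivative (\<lambda>v. a * fst v + b * snd v)) (at p)" by blast
qed

context worm
begin

lemma cover_map_surj: assumes "(z, w) \<in> worm_domain \<eta>" obtains p where "p \<in> Cover" "cover_map p = (z, w)"
proof -
  have "exp (Ln z) = z" using worm_nz[OF assms] by simp
  thus thesis using worm_point_lift[OF assms] that by blast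
qed

text \<open>Only the first coordinate has to be lifted through the exponential function, which is possible on
the contractible covering. The second coordinate of the lift is then determined.\<close>
lemma lift_exists:
  assumes hol: "F holomorphic2_on worm_domain \<eta>" and maps: "F ` worm_domain \<eta> \<subseteq> worm_domain \<eta>"
  obtains L n where "deck_map n L" "\<And>p. p \<in> Cover \<Longrightarrow> cover_map (L p) = F (cover_map p)"
proof -
  let ?W = "worm_domain \<eta>"
  have wh: "hol2 wcoord Cover"
  proof -
    have "snd p \<noteq> 0" if "p \<in> Cover" for p using Cover_D(3)[of "fst p" "snd p"] that by simp
    thus ?thesis unfolding wcoord_def by (intro hol2_intros)
  qed
  have FW: "F (cover_map p) \<in> ?W" if "p \<in> Cover" for p using maps cover_map_Cover[OF that] by blast
  define f g where "f = (\<lambda>p. fst (F (cover_map p)))" and "g = (\<lambda>p. snd (F (cover_map p)))"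
  have fnz: "f p \<noteq> 0" and gnz: "g p \<noteq> 0" if "p \<in> Cover" for p
    using worm_nz[of "f p" "g p"] FW[OF that] by (simp_all add: f_def g_def)
  have pW: "(exp (fst p), wcoord p) \<in> ?W" if "p \<in> Cover" for p using cover_map_Cover[OF that] by (simp add: cover_map_def)
  have fh: "hol2 f Cover" and gh: "hol2 g Cover"
    unfolding f_def g_def cover_map_def
    by (rule hol2_compose2[OF holomorphic2_on_imp_hol2(1)[OF hol open_worm] hol2_exp[OF hol2_fst] wh pW]
        hol2_compose2[OF holomorphic2_on_imp_hol2(2)[OF hol open_worm] hol2_exp[OF hol2_fst] wh pW], assumption)+
  obtain X where X: "continuous_on Cover X" "\<And>p. p \<in> Cover \<Longrightarrow> f p = exp (X p)"
    using continuous_logarithm_on_contractible[OF hol2_continuous_on[OF fh] contractible_Cover fnz] by blast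
  have Xh: "hol2 X Cover" by (rule hol2_continuous_log[OF fh open_Cover X])
  define L where "L = (\<lambda>p. (X p, exp (2 * \<i> * X p) / g p))"
  have Lprop: "L p \<in> Cover \<and> cover_map (L p) = F (cover_map p)" if p: "p \<in> Cover" for p
    using worm_point_lift[of "f p" "g p" "X p"] FW[OF p] X(2)[OF p] by (simp add: L_def f_def g_def)
  have "continuous_on Cover (Rot (2 * pi))" unfolding Rot_def by (intro continuous_intros)
  hence cRot: "continuous_on Cover (\<lambda>p. X (Rot (2 * pi) p))"
    by (rule continuous_on_compose2[OF X(1)]) auto
  have prR: "cover_map (Rot (2 * pi) p) = cover_map p" for p
    using cover_map_Rot[of "2 * pi" p] by (simp add: mult.commute)
  have per: "f (Rot (2 * pi) p) = f p" "g (Rot (2 * pi) p) = g p" for p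
    by (simp_all add: f_def g_def prR)
  obtain n :: int where n: "\<And>p. p \<in> Cover \<Longrightarrow> X (Rot (2 * pi) p) - X p = 2 * pi * n * \<i>"
  proof (rule exp_eq_1_imp_const_int[OF connected_Cover])
    show "continuous_on Cover (\<lambda>p. X (Rot (2 * pi) p) - X p)" by (intro continuous_intros cRot X(1))
    show "exp (X (Rot (2 * pi) p) - X p) = 1" if "p \<in> Cover" for p
      using X(2)[of p] X(2)[of "Rot (2 * pi) p"] per(1)[of p] that fnz[OF that] by (simp add: exp_diff)
  qed blast
  have "deck_map n L"
    unfolding deck_map_def
  proof (intro conjI ballI)
    show "L p \<in> Cover" if "p \<in> Cover" for p using Lprop[OF that] by blast
    show "hol2 (\<lambda>p. fst (L p)) Cover" "hol2 (\<lambda>p. snd (L p)) Cover"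
      unfolding L_def fst_conv snd_conv by (intro hol2_intros Xh gh gnz; assumption)+
    fix p assume p: "p \<in> Cover"
    have XR: "X (Rot (2 * pi) p) = X p + \<i> * of_real (2 * pi * n)" using n[OF p] by (simp add: algebra_simps)
    show "L (Rot (2 * pi) p) = Rot (2 * pi * of_int n) (L p)"
      using exp_2i_shift[of "X p" "2 * pi * n"] by (simp add: L_def Rot_def[of "2 * pi * of_int n"] XR per)
  qed
  thus thesis using that Lprop by blast
qed

lemma deck_map_eq:
  assumes L: "deck_map a L1" "deck_map b L2" and eq: "\<And>p. p \<in> Cover \<Longrightarrow> cover_map (L1 p) = cover_map (L2 p)"
  obtains k :: int where "\<And>p. p \<in> Cover \<Longrightarrow> L1 p = Rot (2 * pi * k) (L2 p)"
proof -
  have h: "hol2 (\<lambda>p. fst (L1 p)) Cover" "hol2 (\<lambda>p. fst (L2 p)) Cover"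
    and Om12: "\<And>p. p \<in> Cover \<Longrightarrow> L1 p \<in> Cover" "\<And>p. p \<in> Cover \<Longrightarrow> L2 p \<in> Cover"
    using L by (auto simp: deck_map_def)
  obtain k :: int where k: "\<And>p. p \<in> Cover \<Longrightarrow> fst (L1 p) - fst (L2 p) = 2 * pi * k * \<i>"
  proof (rule exp_eq_1_imp_const_int[OF connected_Cover])
    show "continuous_on Cover (\<lambda>p. fst (L1 p) - fst (L2 p))"
      by (intro continuous_intros hol2_continuous_on h)
    show "exp (fst (L1 p) - fst (L2 p)) = 1" if "p \<in> Cover" for p
      using eq[OF that] by (simp add: cover_map_def exp_diff)
  qed blast
  show thesis
  proof (rule that[of k])
    fix p assume p: "p \<in> Cover"
    have nz: "snd (L1 p) \<noteq> 0" "snd (L2 p) \<noteq> 0"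
      using Cover_D(3)[of "fst (L1 p)" "snd (L1 p)"] Cover_D(3)[of "fst (L2 p)" "snd (L2 p)"] Om12[OF p] by simp_all
    obtain m :: int where m: "L1 p = Rot (2 * pi * m) (L2 p)" using cover_map_eq_imp_Rot[OF eq[OF p] nz] .
    have "2 * pi * of_int m * \<i> = 2 * pi * of_int k * \<i>" using k[OF p] unfolding m by (simp add: Rot_def mult_ac)
    hence "m = k" by simp
    thus "L1 p = Rot (2 * pi * k) (L2 p)" using m by simp
  qed
qed

lemma deck_map_degree_unique:
  assumes "deck_map a L1" "deck_map b L2" "\<And>p. p \<in> Cover \<Longrightarrow> L1 p = L2 p"
  shows "a = b"
proof -
  define p where "p = (0::complex, 1::complex)"
  have p: "p \<in> Cover" unfolding p_def using mu by (subst Cover_flat) (auto simp: emod_def)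
  have "Rot (2 * pi * a) (L1 p) = Rot (2 * pi * b) (L1 p)"
    using assms p unfolding deck_map_def by (metis Rot_Cover)
  thus ?thesis by (simp add: Rot_def)
qed

lemma deck_map_id: "deck_map 1 (\<lambda>p. p)"
proof -
  have "Rot 0 = (\<lambda>p. p)" by (rule ext) simp
  thus ?thesis using deck_map_Rot[of 0] by (simp only:)
qed

text \<open>The lift of the inverse is corrected by a deck transformation so that it inverts the lift of \<open>F\<close>.
Then the product of the two degrees is \<open>1\<close>.\<close>
theorem worm_automorphism_is_rotation:
  assumes F: "biholomorphic_self_map (worm_domain \<eta>) F"
  obtains \<theta> where "\<And>z w. (z, w) \<in> worm_domain \<eta> \<Longrightarrow> F (z, w) = (exp (\<i> * of_real \<theta>) * z, w)"
proof -
  let ?W = "worm_domain \<eta>"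
  define F' where "F' = inv_into ?W F"
  have bij: "bij_betw F ?W ?W" and hol: "F holomorphic2_on ?W" "F' holomorphic2_on ?W"
    using F by (auto simp: biholomorphic_self_map_def F'_def)
  have maps: "F ` ?W \<subseteq> ?W" "F' ` ?W \<subseteq> ?W"
    using bij bij_betw_inv_into[OF bij] by (auto simp: bij_betw_def F'_def)
  have F'F: "F' (F p) = p" "F (F' p) = p" if "p \<in> ?W" for p
    using bij_betw_inv_into_left[OF bij that] bij_betw_inv_into_right[OF bij that] by (simp_all add: F'_def)
  obtain L n where L: "deck_map n L" "\<And>p. p \<in> Cover \<Longrightarrow> cover_map (L p) = F (cover_map p)" using lift_exists[OF hol(1) maps(1)] by blast
  obtain M m where M: "deck_map m M" "\<And>p. p \<in> Cover \<Longrightarrow> cover_map (M p) = F' (cover_map p)" using lift_exists[OF hol(2) maps(2)] by blast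
  have LOm: "L p \<in> Cover" and MOm: "M p \<in> Cover" if "p \<in> Cover" for p using L M that by (auto simp: deck_map_def)
  have MoL: "cover_map (M (L p)) = cover_map p" if "p \<in> Cover" for p
    using L(2) M(2) LOm MOm that F'F cover_map_Cover by simp_all
  obtain k :: int where k: "\<And>p. p \<in> Cover \<Longrightarrow> M (L p) = Rot (2 * pi * k) p"
    using deck_map_eq[OF deck_map_comp[OF M(1) L(1)] deck_map_id MoL] by blast
  define L' where "L' = (\<lambda>p. Rot (- (2 * pi * k)) (M p))"
  have dL': "deck_map m L'" unfolding L'_def using deck_map_comp[OF deck_map_Rot M(1)] by simp
  have L'L: "L' (L p) = p" if "p \<in> Cover" for p using k[OF that] by (simp add: L'_def Rot_Rot)
  have "m * n = 1" by (rule deck_map_degree_unique[OF deck_map_comp[OF dL' L(1)] deck_map_id L'L])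
  hence mn: "m = n" "n * n = 1" by (metis zmult_eq_1_iff mult.commute)+
  have prL': "cover_map (L' p) = F' (cover_map p)" if "p \<in> Cover" for p
  proof -
    have "Re (\<i> * complex_of_real (- (2 * pi * of_int k))) = 0 \<and>
        Im (\<i> * complex_of_real (- (2 * pi * of_int k))) = of_int (2 * (- k)) * pi" by simp
    hence "exp (\<i> * complex_of_real (- (2 * pi * of_int k))) = 1" unfolding exp_eq_1 by blast
    thus ?thesis using M(2)[OF that] by (simp add: L'_def cover_map_Rot)
  qed
  have L'Cover: "L' p \<in> Cover" if "p \<in> Cover" for p using dL' that by (auto simp: deck_map_def)
  have LL': "L (L' p) = p" if p: "p \<in> Cover" for p
  proof -
    have "cover_map (L (L' q)) = cover_map q" if "q \<in> Cover" for q
      using L(2)[OF L'Cover[OF that]] prL'[OF that] F'F(2)[OF cover_map_Cover[OF that]] by simp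
    then obtain j :: int where j: "\<And>q. q \<in> Cover \<Longrightarrow> L (L' q) = Rot (2 * pi * j) q"
      using deck_map_eq[OF deck_map_comp[OF L(1) dL'] deck_map_id] by blast
    have "L p = Rot (2 * pi * j) (L p)" using j[OF LOm[OF p]] L'L[OF p] by simp
    hence "j = 0" by (auto simp: Rot_def prod_eq_iff)
    thus ?thesis using j[OF p] by simp
  qed
  interpret P: deck_pair \<mu> \<eta> L L' n
    by unfold_locales (use L(1) dL' mn L'L LL' in auto)
  have "n = 1" using P.n_cases P.degree_not_minus_one by blast
  then obtain \<kappa> where \<kappa>: "\<And>p. p \<in> Cover \<Longrightarrow> L p = Rot \<kappa> p" using P.degree_one_imp_Rot by blast
  show thesis
  proof (rule that[of \<kappa>])
    fix z w assume zw: "(z, w) \<in> ?W"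
    obtain p where p: "p \<in> Cover" "cover_map p = (z, w)" using cover_map_surj[OF zw] .
    have "F (z, w) = cover_map (Rot \<kappa> p)" using L(2)[OF p(1)] \<kappa>[OF p(1)] p(2) by simp
    thus "F (z, w) = (exp (\<i> * of_real \<kappa>) * z, w)" by (simp add: cover_map_Rot p(2))
  qed
qed

lemma rotation_maps: "(z, w) \<in> worm_domain \<eta> \<Longrightarrow> (exp (\<i> * complex_of_real \<theta>) * z, w) \<in> worm_domain \<eta>"
  by (simp add: worm_domain_def norm_mult)

lemma rotation_is_automorphism:
  "biholomorphic_self_map (worm_domain \<eta>) (restrict (\<lambda>(z, w). (exp (\<i> * complex_of_real \<theta>) * z, w)) (worm_domain \<eta>))"
proof -
  let ?W = "worm_domain \<eta>"
  define r where "r = (\<lambda>\<theta>. \<lambda>(z, w). (exp (\<i> * complex_of_real \<theta>) * z, w :: complex))"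
  have rW: "r t p \<in> ?W" if "p \<in> ?W" for t p using that rotation_maps by (auto simp: r_def split: prod.splits)
  have rr: "r (- t) (r t p) = p" "r t (r (- t) p) = p" for t p
    by (auto simp: r_def mult.assoc[symmetric] exp_add[symmetric] split: prod.splits)
  have hol: "r t holomorphic2_on ?W" for t
    unfolding holomorphic2_on_def
  proof
    fix p assume "p \<in> ?W"
    define D where "D = (\<lambda>v :: complex \<times> complex. (exp (\<i> * complex_of_real t) * fst v, snd v))"
    have rD: "r t = D" by (auto simp: r_def D_def)
    have "(r t has_derivative D) (at p within ?W)"
      unfolding rD unfolding D_def by (intro derivative_intros)
    thus "\<exists>D. (r t has_derivative D) (at p within ?W) \<and> (\<forall>c v. D (cscale2 c v) = cscale2 c (D v))"
      by (intro exI[of _ D]) (auto simp: D_def cscale2_def)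
  qed
  have inj: "inj_on (r \<theta>) ?W" using rr(1) by (metis inj_onI)
  have bij: "bij_betw (restrict (r \<theta>) ?W) ?W ?W"
    by (rule bij_betw_byWitness[where f' = "r (- \<theta>)"]) (use rW rr in auto)
  have inv: "inv_into ?W (restrict (r \<theta>) ?W) p = r (- \<theta>) p" if "p \<in> ?W" for p
    by (rule inv_into_f_eq) (use bij rW rr that in \<open>auto simp: bij_betw_def\<close>)
  have "restrict (r \<theta>) ?W holomorphic2_on ?W" "inv_into ?W (restrict (r \<theta>) ?W) holomorphic2_on ?W"
    using hol[of \<theta>] hol[of "- \<theta>"] holomorphic2_on_cong[of ?W "restrict (r \<theta>) ?W" "r \<theta>"]
      holomorphic2_on_cong[of ?W "inv_into ?W (restrict (r \<theta>) ?W)" "r (- \<theta>)"] inv by simp_all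
  thus ?thesis using bij by (simp add: biholomorphic_self_map_def r_def)
qed

end

theorem theorem1:
  fixes \<mu> :: real and \<eta> :: "real \<Rightarrow> real"
  assumes "\<mu> > 0" and "worm_profile \<mu> \<eta>"
  shows "carrier (aut_group (worm_domain \<eta>)) =
    {restrict (\<lambda>(z, w). (exp (\<i> * complex_of_real \<theta>) * z, w)) (worm_domain \<eta>) | \<theta> :: real. True}"
proof -
  interpret worm \<mu> \<eta> by unfold_locales (rule assms)+
  let ?W = "worm_domain \<eta>"
  let ?r = "\<lambda>\<theta>. restrict (\<lambda>(z, w). (exp (\<i> * complex_of_real \<theta>) * z, w)) ?W"
  have carrier: "carrier (aut_group ?W) = {f \<in> extensional ?W. biholomorphic_self_map ?W f}"
    by (simp add: aut_group_def)
  show ?thesis unfolding carrier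
  proof (intro equalityI subsetI)
    fix F assume "F \<in> {f \<in> extensional ?W. biholomorphic_self_map ?W f}"
    hence F: "F \<in> extensional ?W" "biholomorphic_self_map ?W F" by auto
    obtain \<theta> where \<theta>: "\<And>z w. (z, w) \<in> ?W \<Longrightarrow> F (z, w) = (exp (\<i> * of_real \<theta>) * z, w)"
      using worm_automorphism_is_rotation[OF F(2)] by blast
    have "F = ?r \<theta>"
      by (rule extensionalityI[OF F(1)]) (use \<theta> in \<open>auto split: prod.splits\<close>)
    thus "F \<in> {?r \<theta> | \<theta>. True}" by blast
  next
    fix F assume "F \<in> {?r \<theta> | \<theta>. True}"
    thus "F \<in> {f \<in> extensional ?W. biholomorphic_self_map ?W f}"
      using rotation_is_automorphism by auto
  qed
qed

end
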